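(* Let $M$ be a $(2n+s)$-dimensional $S$-manifold with $n\geq 2$, endowed with the semi-symmetric metric connection $$\nabla^*_XY=\nabla_XY+\sum_{j=1}^s\eta^j(Y)X-\sum_{j=1}^s g(X,Y)\xi_j,$$ where $\nabla$ is the Riemannian (Levi-Civita) connection of $g$. If the $\mathcal{L}$-sectional curvature associated with $\nabla^*$ is constant equal to $c$, then $c=0$. In this case, the scalar curvature of $M$ with respect to $\nabla^*$ is $$\tau^*=\frac{(4ns+s(s-1))(2-s)}{2}.$$
   Context: A metric $f$-manifold is a $(2n+s)$-dimensional differentiable manifold $M$ ($n,s\geq 1$) with a $(1,1)$ tensor field $f$, vector fields $\xi_1,\dots,\xi_s$ (structure vector fields), 1-forms $\eta^1,\dots,\eta^s$ and a Riemannian metric $g$ such that $f^2=-I+\sum_{\alpha=1}^s\eta^\alpha\otimes\xi_\alpha$, $\eta^\alpha(\xi_\beta)=\delta_{\alpha\beta}$, $f\xi_\alpha=0$, $\eta^\alpha\circ f=0$, $g(fX,fY)=g(X,Y)-\sum_{\alpha=1}^s\eta^\alpha(X)\eta^\alpha(Y)$; moreover $\eta^\alpha(X)=g(X,\xi_\alpha)$ and $g(X,fY)=-g(fX,Y)$. The fundamental 2-form is $\Phi(X,Y)=g(X,fY)$. $M$ is an $S$-manifold if it is normal, i.e. $[f,f]+2\sum_{\alpha=1}^s d\eta^\alpha\otimes\xi_\alpha=0$ with $[f,f](X,Y)=f^2[X,Y]+[fX,fY]-f[fX,Y]-f[X,fY]$, and for every $1\leq\alpha\leq s$: $\eta^1\wedge\cdots\wedge\eta^s\wedge(d\eta^\alpha)^n\neq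 0$ everywhere and $\Phi=d\eta^\alpha$. Convention: $d\eta(X,Y)=\frac12\left(X\eta(Y)-Y\eta(X)-\eta([X,Y])\right)$. $\mathcal{L}$ is the distribution orthogonal to the span of $\xi_1,\dots,\xi_s$. The curvature of $\nabla^*$ is $R^*(X,Y)Z=\nabla^*_X\nabla^*_YZ-\nabla^*_Y\nabla^*_XZ-\nabla^*_{[X,Y]}Z$, and $K^*(X,Y)=g(R^*(X,Y)Y,X)$ for orthonormal $X,Y$. The $\mathcal{L}$-sectional curvature of $\nabla^*$ is $K^*_{\mathcal{L}}(X,Y)=K^*(X,Y)$ for orthonormal $X,Y\in\mathcal{L}$; it is constant equal to $c$ if this value is $c$ at every point and for all orthonormal $X,Y\in\mathcal{L}$. The scalar curvature with respect to $\nabla^*$ is $\tau^*=\frac12\sum_{i,j=1}^{2n+s}K^*(e_i,e_j)$ for any local orthonormal frame $\{e_1,\dots,e_{2n+s}\}$, the terms with $i=j$ being zero. *)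

theory Defs
  imports "HOL-Analysis.Analysis" "HOL-Combinatorics.Permutations" "HOL-Library.Function_Algebras"
begin

section \<open>Smooth maps between Euclidean spaces\<close>

text \<open>\<open>Ck_on k h S\<close> is only meant for open \<open>S\<close>: all iterated directional derivatives of order
  at most \<open>k\<close> exist and are continuous.\<close>

primrec Ck_on :: "nat \<Rightarrow> ('e::euclidean_space \<Rightarrow> 'b::real_normed_vector) \<Rightarrow> 'e set \<Rightarrow> bool" where
  "Ck_on 0 h S \<longleftrightarrow> continuous_on S h"
| "Ck_on (Suc k) h S \<longleftrightarrow> (\<forall>x\<in>S. h differentiable (at x)) \<and>
     (\<forall>v. Ck_on k (\<lambda>x. frechet_derivative h (at x) v) S)"

definition smooth_on :: "('e::euclidean_space \<Rightarrow> 'b::real_normed_vector) \<Rightarrow> 'e set \<Rightarrow> bool" where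
  "smooth_on h S \<longleftrightarrow> (\<forall>k. Ck_on k h S)"


section \<open>Smooth manifolds\<close>

text \<open>A manifold is a whole type \<open>'m\<close> (Hausdorff and second countable by its type classes, and
  nonempty as a type) with an atlas of charts \<open>(U, \<phi>)\<close> into the model space \<open>'e\<close>; its dimension
  is \<open>DIM('e)\<close>. Only the values of \<open>\<phi>\<close> on \<open>U\<close> are relevant. The atlas need not be maximal.\<close>

type_synonym ('m, 'e) atlas = "('m set \<times> ('m \<Rightarrow> 'e)) set"

definition smooth_manifold ::
    "('m::{t2_space, second_countable_topology}, 'e::euclidean_space) atlas \<Rightarrow> bool" where
  "smooth_manifold A \<longleftrightarrow>
     (\<Union>(U, \<phi>)\<in>A. U) = UNIV \<and>
     (\<forall>(U, \<phi>)\<in>A. open U \<and> open (\<phi> ` U) \<and> homeomorphism U (\<phi> ` U) \<phi> (inv_into U \<phi>)) \<and>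
     (\<forall>(U, \<phi>)\<in>A. \<forall>(V, \<psi>)\<in>A. smooth_on (\<psi> \<circ> inv_into U \<phi>) (\<phi> ` (U \<inter> V)))"

definition smooth_funs :: "('m, 'e::euclidean_space) atlas \<Rightarrow> ('m \<Rightarrow> real) set" where
  "smooth_funs A = {u. \<forall>(U, \<phi>)\<in>A. smooth_on (u \<circ> inv_into U \<phi>) (\<phi> ` U)}"

text \<open>Tangent vectors at \<open>p\<close> are derivations at \<open>p\<close> of the algebra of smooth functions. A derivation
  is a total function here; it is required to vanish on non-smooth arguments so that
  equality of tangent vectors is equality of derivations. Vectors and fields are added with the
  pointwise operations on functions.\<close>

type_synonym 'm tvec = "('m \<Rightarrow> real) \<Rightarrow> real"
type_synonym 'm vfield = "'m \<Rightarrow> 'm tvec"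

definition tangent_space :: "('m, 'e::euclidean_space) atlas \<Rightarrow> 'm \<Rightarrow> 'm tvec set" where
  "tangent_space A p = {v.
     (\<forall>u. u \<notin> smooth_funs A \<longrightarrow> v u = 0) \<and>
     (\<forall>u\<in>smooth_funs A. \<forall>w\<in>smooth_funs A. \<forall>a b.
        v (\<lambda>x. a * u x + b * w x) = a * v u + b * v w) \<and>
     (\<forall>u\<in>smooth_funs A. \<forall>w\<in>smooth_funs A. v (\<lambda>x. u x * w x) = u p * v w + w p * v u)}"

definition tscale :: "real \<Rightarrow> 'm tvec \<Rightarrow> 'm tvec"  (infixr "*\<^sub>T" 75) where
  "a *\<^sub>T v = (\<lambda>u. a * v u)"

definition fscale :: "('m \<Rightarrow> real) \<Rightarrow> 'm vfield \<Rightarrow> 'm vfield"  (infixr "*\<^sub>F" 75) where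
  "h *\<^sub>F X = (\<lambda>p. h p *\<^sub>T X p)"

definition vfields :: "('m, 'e::euclidean_space) atlas \<Rightarrow> 'm vfield set" where
  "vfields A = {X. (\<forall>p. X p \<in> tangent_space A p) \<and>
     (\<forall>u\<in>smooth_funs A. (\<lambda>p. X p u) \<in> smooth_funs A)}"

definition lie_bracket :: "'m vfield \<Rightarrow> 'm vfield \<Rightarrow> 'm vfield" where
  "lie_bracket X Y = (\<lambda>p u. X p (\<lambda>q. Y q u) - Y p (\<lambda>q. X q u))"


section \<open>Tensor fields\<close>

definition one_form :: "('m, 'e::euclidean_space) atlas \<Rightarrow> ('m \<Rightarrow> 'm tvec \<Rightarrow> real) \<Rightarrow> bool" where
  "one_form A \<eta> \<longleftrightarrow>
     (\<forall>p. \<forall>v\<in>tangent_space A p. \<forall>w\<in>tangent_space A p. \<forall>a b.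
        \<eta> p (a *\<^sub>T v + b *\<^sub>T w) = a * \<eta> p v + b * \<eta> p w) \<and>
     (\<forall>X\<in>vfields A. (\<lambda>p. \<eta> p (X p)) \<in> smooth_funs A)"

definition tensor11 :: "('m, 'e::euclidean_space) atlas \<Rightarrow> ('m \<Rightarrow> 'm tvec \<Rightarrow> 'm tvec) \<Rightarrow> bool" where
  "tensor11 A f \<longleftrightarrow>
     (\<forall>p. \<forall>v\<in>tangent_space A p. f p v \<in> tangent_space A p) \<and>
     (\<forall>p. \<forall>v\<in>tangent_space A p. \<forall>w\<in>tangent_space A p. \<forall>a b.
        f p (a *\<^sub>T v + b *\<^sub>T w) = a *\<^sub>T f p v + b *\<^sub>T f p w) \<and>
     (\<forall>X\<in>vfields A. (\<lambda>p. f p (X p)) \<in> vfields A)"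

definition riemannian_metric ::
    "('m, 'e::euclidean_space) atlas \<Rightarrow> ('m \<Rightarrow> 'm tvec \<Rightarrow> 'm tvec \<Rightarrow> real) \<Rightarrow> bool" where
  "riemannian_metric A g \<longleftrightarrow>
     (\<forall>p. \<forall>v\<in>tangent_space A p. \<forall>w\<in>tangent_space A p. g p v w = g p w v) \<and>
     (\<forall>p. \<forall>v\<in>tangent_space A p. \<forall>w\<in>tangent_space A p. \<forall>z\<in>tangent_space A p. \<forall>a b.
        g p (a *\<^sub>T v + b *\<^sub>T w) z = a * g p v z + b * g p w z) \<and>
     (\<forall>p. \<forall>v\<in>tangent_space A p. v \<noteq> 0 \<longrightarrow> g p v v > 0) \<and>
     (\<forall>X\<in>vfields A. \<forall>Y\<in>vfields A. (\<lambda>p. g p (X p) (Y p)) \<in> smooth_funs A)"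

definition ext_deriv :: "('m \<Rightarrow> 'm tvec \<Rightarrow> real) \<Rightarrow> 'm vfield \<Rightarrow> 'm vfield \<Rightarrow> 'm \<Rightarrow> real" where
  "ext_deriv \<eta> X Y = (\<lambda>p. 1 / 2 *
     (X p (\<lambda>q. \<eta> q (Y q)) - Y p (\<lambda>q. \<eta> q (X q)) - \<eta> p (lie_bracket X Y p)))"

definition apply_field :: "('m \<Rightarrow> 'm tvec \<Rightarrow> 'm tvec) \<Rightarrow> 'm vfield \<Rightarrow> 'm vfield" where
  "apply_field f X = (\<lambda>p. f p (X p))"

definition nijenhuis :: "('m \<Rightarrow> 'm tvec \<Rightarrow> 'm tvec) \<Rightarrow> 'm vfield \<Rightarrow> 'm vfield \<Rightarrow> 'm vfield" where
  "nijenhuis f X Y =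
     apply_field f (apply_field f (lie_bracket X Y))
     + lie_bracket (apply_field f X) (apply_field f Y)
     - apply_field f (lie_bracket (apply_field f X) Y)
     - apply_field f (lie_bracket X (apply_field f Y))"


section \<open>Wedge products\<close>

text \<open>A \<open>k\<close>-form is represented by its action on sequences of vector fields, of which only the
  entries with index below \<open>k\<close> matter. The normalisation \<open>1/(k+l)!\<close> of the wedge product goes with
  the factor \<open>1/2\<close> in \<open>ext_deriv\<close>.\<close>

type_synonym 'm form = "(nat \<Rightarrow> 'm vfield) \<Rightarrow> 'm \<Rightarrow> real"

definition wedge :: "nat \<Rightarrow> nat \<Rightarrow> 'm form \<Rightarrow> 'm form \<Rightarrow> 'm form" where
  "wedge k l \<omega> \<theta> = (\<lambda>X p.
     (\<Sum>\<sigma> | \<sigma> permutes {..<k + l}.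
        of_int (sign \<sigma>) * \<omega> (\<lambda>i. X (\<sigma> i)) p * \<theta> (\<lambda>i. X (\<sigma> (k + i))) p) / fact (k + l))"

primrec wedge_one_forms :: "(nat \<Rightarrow> 'm \<Rightarrow> 'm tvec \<Rightarrow> real) \<Rightarrow> nat \<Rightarrow> 'm form" where
  "wedge_one_forms \<eta> 0 = (\<lambda>X p. 1)"
| "wedge_one_forms \<eta> (Suc s) =
     wedge s 1 (wedge_one_forms \<eta> s) (\<lambda>X p. \<eta> (Suc s) p (X 0 p))"

primrec wedge_power :: "nat \<Rightarrow> 'm form \<Rightarrow> nat \<Rightarrow> 'm form" where
  "wedge_power k \<omega> 0 = (\<lambda>X p. 1)"
| "wedge_power k \<omega> (Suc n) = wedge (k * n) k (wedge_power k \<omega> n) \<omega>"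

definition nonvanishing :: "('m, 'e::euclidean_space) atlas \<Rightarrow> 'm form \<Rightarrow> bool" where
  "nonvanishing A \<omega> \<longleftrightarrow> (\<forall>p. \<exists>X. (\<forall>i. X i \<in> vfields A) \<and> \<omega> X p \<noteq> 0)"


section \<open>Metric f-manifolds and S-manifolds\<close>

text \<open>The structure vector fields and 1-forms are indexed by \<open>{1..s}\<close>.\<close>

definition metric_f_manifold ::
    "('m::{t2_space, second_countable_topology}, 'e::euclidean_space) atlas \<Rightarrow> nat \<Rightarrow> nat \<Rightarrow>
     ('m \<Rightarrow> 'm tvec \<Rightarrow> 'm tvec) \<Rightarrow> (nat \<Rightarrow> 'm vfield) \<Rightarrow> (nat \<Rightarrow> 'm \<Rightarrow> 'm tvec \<Rightarrow> real) \<Rightarrow>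
     ('m \<Rightarrow> 'm tvec \<Rightarrow> 'm tvec \<Rightarrow> real) \<Rightarrow> bool" where
  "metric_f_manifold A n s f \<xi> \<eta> g \<longleftrightarrow>
     smooth_manifold A \<and> n \<ge> 1 \<and> s \<ge> 1 \<and> DIM('e) = 2 * n + s \<and>
     tensor11 A f \<and> (\<forall>\<alpha>\<in>{1..s}. \<xi> \<alpha> \<in> vfields A) \<and> (\<forall>\<alpha>\<in>{1..s}. one_form A (\<eta> \<alpha>)) \<and>
     riemannian_metric A g \<and>
     (\<forall>p. \<forall>v\<in>tangent_space A p. f p (f p v) = - v + (\<Sum>\<alpha>\<in>{1..s}. \<eta> \<alpha> p v *\<^sub>T \<xi> \<alpha> p)) \<and>
     (\<forall>p. \<forall>\<alpha>\<in>{1..s}. \<forall>\<beta>\<in>{1..s}. \<eta> \<alpha> p (\<xi> \<beta> p) = (if \<alpha> = \<beta> then 1 else 0)) \<and>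
     (\<forall>p. \<forall>\<alpha>\<in>{1..s}. f p (\<xi> \<alpha> p) = 0) \<and>
     (\<forall>p. \<forall>\<alpha>\<in>{1..s}. \<forall>v\<in>tangent_space A p. \<eta> \<alpha> p (f p v) = 0) \<and>
     (\<forall>p. \<forall>v\<in>tangent_space A p. \<forall>w\<in>tangent_space A p.
        g p (f p v) (f p w) = g p v w - (\<Sum>\<alpha>\<in>{1..s}. \<eta> \<alpha> p v * \<eta> \<alpha> p w)) \<and>
     (\<forall>p. \<forall>\<alpha>\<in>{1..s}. \<forall>v\<in>tangent_space A p. \<eta> \<alpha> p v = g p v (\<xi> \<alpha> p)) \<and>
     (\<forall>p. \<forall>v\<in>tangent_space A p. \<forall>w\<in>tangent_space A p. g p v (f p w) = - g p (f p v) w)"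

definition fundamental_form ::
    "('m \<Rightarrow> 'm tvec \<Rightarrow> 'm tvec) \<Rightarrow> ('m \<Rightarrow> 'm tvec \<Rightarrow> 'm tvec \<Rightarrow> real) \<Rightarrow>
     'm vfield \<Rightarrow> 'm vfield \<Rightarrow> 'm \<Rightarrow> real" where
  "fundamental_form f g X Y = (\<lambda>p. g p (X p) (f p (Y p)))"

definition normal_structure ::
    "('m, 'e::euclidean_space) atlas \<Rightarrow> nat \<Rightarrow>
     ('m \<Rightarrow> 'm tvec \<Rightarrow> 'm tvec) \<Rightarrow> (nat \<Rightarrow> 'm vfield) \<Rightarrow> (nat \<Rightarrow> 'm \<Rightarrow> 'm tvec \<Rightarrow> real) \<Rightarrow> bool" where
  "normal_structure A s f \<xi> \<eta> \<longleftrightarrow>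
     (\<forall>X\<in>vfields A. \<forall>Y\<in>vfields A.
        nijenhuis f X Y + (\<Sum>\<alpha>\<in>{1..s}. (\<lambda>p. 2 * ext_deriv (\<eta> \<alpha>) X Y p) *\<^sub>F \<xi> \<alpha>) = 0)"

definition S_manifold ::
    "('m::{t2_space, second_countable_topology}, 'e::euclidean_space) atlas \<Rightarrow> nat \<Rightarrow> nat \<Rightarrow>
     ('m \<Rightarrow> 'm tvec \<Rightarrow> 'm tvec) \<Rightarrow> (nat \<Rightarrow> 'm vfield) \<Rightarrow> (nat \<Rightarrow> 'm \<Rightarrow> 'm tvec \<Rightarrow> real) \<Rightarrow>
     ('m \<Rightarrow> 'm tvec \<Rightarrow> 'm tvec \<Rightarrow> real) \<Rightarrow> bool" where
  "S_manifold A n s f \<xi> \<eta> g \<longleftrightarrow>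
     metric_f_manifold A n s f \<xi> \<eta> g \<and>
     normal_structure A s f \<xi> \<eta> \<and>
     (\<forall>\<alpha>\<in>{1..s}.
        nonvanishing A (wedge s (2 * n) (wedge_one_forms \<eta> s)
          (wedge_power 2 (\<lambda>X. ext_deriv (\<eta> \<alpha>) (X 0) (X 1)) n)) \<and>
        (\<forall>X\<in>vfields A. \<forall>Y\<in>vfields A. fundamental_form f g X Y = ext_deriv (\<eta> \<alpha>) X Y))"


section \<open>Connections and curvature\<close>

text \<open>Only the values of a connection on smooth vector fields are relevant.\<close>

type_synonym 'm conn = "'m vfield \<Rightarrow> 'm vfield \<Rightarrow> 'm vfield"

definition affine_connection :: "('m, 'e::euclidean_space) atlas \<Rightarrow> 'm conn \<Rightarrow> bool" where
  "affine_connection A D \<longleftrightarrow>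
     (\<forall>X\<in>vfields A. \<forall>Y\<in>vfields A. D X Y \<in> vfields A) \<and>
     (\<forall>X\<in>vfields A. \<forall>Y\<in>vfields A. \<forall>Z\<in>vfields A. D (X + Y) Z = D X Z + D Y Z) \<and>
     (\<forall>h\<in>smooth_funs A. \<forall>X\<in>vfields A. \<forall>Y\<in>vfields A. D (h *\<^sub>F X) Y = h *\<^sub>F D X Y) \<and>
     (\<forall>X\<in>vfields A. \<forall>Y\<in>vfields A. \<forall>Z\<in>vfields A. D X (Y + Z) = D X Y + D X Z) \<and>
     (\<forall>h\<in>smooth_funs A. \<forall>X\<in>vfields A. \<forall>Y\<in>vfields A.
        D X (h *\<^sub>F Y) = h *\<^sub>F D X Y + (\<lambda>p. X p h) *\<^sub>F Y)"

definition levi_civita ::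
    "('m, 'e::euclidean_space) atlas \<Rightarrow> ('m \<Rightarrow> 'm tvec \<Rightarrow> 'm tvec \<Rightarrow> real) \<Rightarrow> 'm conn \<Rightarrow> bool" where
  "levi_civita A g D \<longleftrightarrow> affine_connection A D \<and>
     (\<forall>X\<in>vfields A. \<forall>Y\<in>vfields A. D X Y - D Y X = lie_bracket X Y) \<and>
     (\<forall>X\<in>vfields A. \<forall>Y\<in>vfields A. \<forall>Z\<in>vfields A. \<forall>p.
        X p (\<lambda>q. g q (Y q) (Z q)) = g p (D X Y p) (Z p) + g p (Y p) (D X Z p))"

definition semi_symmetric_connection ::
    "nat \<Rightarrow> (nat \<Rightarrow> 'm vfield) \<Rightarrow> (nat \<Rightarrow> 'm \<Rightarrow> 'm tvec \<Rightarrow> real) \<Rightarrow>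
     ('m \<Rightarrow> 'm tvec \<Rightarrow> 'm tvec \<Rightarrow> real) \<Rightarrow> 'm conn \<Rightarrow> 'm conn" where
  "semi_symmetric_connection s \<xi> \<eta> g D = (\<lambda>X Y.
     D X Y + (\<Sum>j\<in>{1..s}. (\<lambda>p. \<eta> j p (Y p)) *\<^sub>F X) - (\<Sum>j\<in>{1..s}. (\<lambda>p. g p (X p) (Y p)) *\<^sub>F \<xi> j))"

definition curvature :: "'m conn \<Rightarrow> 'm vfield \<Rightarrow> 'm vfield \<Rightarrow> 'm vfield \<Rightarrow> 'm vfield" where
  "curvature D X Y Z = D X (D Y Z) - D Y (D X Z) - D (lie_bracket X Y) Z"

text \<open>The sectional curvature at \<open>p\<close> of the plane spanned by \<open>X p\<close> and \<open>Y p\<close>, meaningful when these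
  two vectors are orthonormal. It depends on the smooth fields \<open>X\<close>, \<open>Y\<close> only through their values
  at \<open>p\<close>, and every pair of tangent vectors at \<open>p\<close> is the value of such fields.\<close>

definition sect_curv ::
    "('m \<Rightarrow> 'm tvec \<Rightarrow> 'm tvec \<Rightarrow> real) \<Rightarrow> 'm conn \<Rightarrow> 'm vfield \<Rightarrow> 'm vfield \<Rightarrow> 'm \<Rightarrow> real" where
  "sect_curv g D X Y p = g p (curvature D X Y Y p) (X p)"

definition L_distribution ::
    "('m, 'e::euclidean_space) atlas \<Rightarrow> nat \<Rightarrow> (nat \<Rightarrow> 'm vfield) \<Rightarrow>
     ('m \<Rightarrow> 'm tvec \<Rightarrow> 'm tvec \<Rightarrow> real) \<Rightarrow> 'm \<Rightarrow> 'm tvec set" where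
  "L_distribution A s \<xi> g p = {v \<in> tangent_space A p. \<forall>\<alpha>\<in>{1..s}. g p v (\<xi> \<alpha> p) = 0}"

definition constant_L_sect_curv ::
    "('m, 'e::euclidean_space) atlas \<Rightarrow> nat \<Rightarrow> (nat \<Rightarrow> 'm vfield) \<Rightarrow>
     ('m \<Rightarrow> 'm tvec \<Rightarrow> 'm tvec \<Rightarrow> real) \<Rightarrow> 'm conn \<Rightarrow> real \<Rightarrow> bool" where
  "constant_L_sect_curv A s \<xi> g D c \<longleftrightarrow>
     (\<forall>p. \<forall>X\<in>vfields A. \<forall>Y\<in>vfields A.
        X p \<in> L_distribution A s \<xi> g p \<and> Y p \<in> L_distribution A s \<xi> g p \<and>
        g p (X p) (X p) = 1 \<and> g p (Y p) (Y p) = 1 \<and> g p (X p) (Y p) = 0 \<longrightarrow>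
        sect_curv g D X Y p = c)"

text \<open>Every smooth orthonormal frame defined near a point agrees, on a smaller neighbourhood \<open>U\<close> of
  that point, with globally defined smooth fields.\<close>

definition local_orthonormal_frame ::
    "('m::topological_space, 'e::euclidean_space) atlas \<Rightarrow> ('m \<Rightarrow> 'm tvec \<Rightarrow> 'm tvec \<Rightarrow> real) \<Rightarrow>
     'm set \<Rightarrow> (nat \<Rightarrow> 'm vfield) \<Rightarrow> bool" where
  "local_orthonormal_frame A g U e \<longleftrightarrow> open U \<and>
     (\<forall>i\<in>{1..DIM('e)}. e i \<in> vfields A) \<and>
     (\<forall>q\<in>U. \<forall>i\<in>{1..DIM('e)}. \<forall>j\<in>{1..DIM('e)}.
        g q (e i q) (e j q) = (if i = j then 1 else 0))"

definition frame_scalar_curv ::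
    "nat \<Rightarrow> ('m \<Rightarrow> 'm tvec \<Rightarrow> 'm tvec \<Rightarrow> real) \<Rightarrow> 'm conn \<Rightarrow> (nat \<Rightarrow> 'm vfield) \<Rightarrow> 'm \<Rightarrow> real" where
  "frame_scalar_curv N g D e p =
     1 / 2 * (\<Sum>i\<in>{1..N}. \<Sum>j\<in>{1..N}. if i = j then 0 else sect_curv g D (e i) (e j) p)"

end

theory Submission
  imports Defs
begin

text \<open>On an S-manifold the structure fields are Killing and satisfy \<open>\<nabla>\<^sub>X \<xi>\<^sub>\<alpha> = - f X\<close>, and normality determines
  \<open>\<nabla> f\<close>. For \<open>X, Y \<in> \<L>\<close> such that \<open>X, Y, f X, f Y\<close> are orthonormal the Ricci identity for \<open>f\<close> becomes
  \<open>K(X, Y) - g(R(X, Y) f Y, f X) = s\<close>. On \<open>\<L>\<close> the curvatures are related by \<open>K\<^sup>* = K - s\<close>, so if \<open>K\<^sup>* = c\<close> there,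
  polarisation makes \<open>R\<close> vanish on orthonormal quadruples of \<open>\<L>\<close>, which gives \<open>c + s = s\<close>. Such a
  quadruple exists because \<open>(d\<eta>)\<^sup>2 \<noteq> 0\<close> when \<open>n \<ge> 2\<close>.

  Then \<open>K\<^sup>*(X, Y)\<close> is an explicit expression in the horizontal parts and vertical coordinates of
  \<open>X\<close> and \<open>Y\<close>, and summing it over a frame uses only Parseval's identity for the \<open>\<xi>\<^sub>\<alpha>\<close>. That identity
  needs the space of derivations at a point to have dimension at most \<open>DIM('e)\<close>, which follows from
  Hadamard's lemma and bump functions.\<close>

section \<open>Calculus of smooth functions\<close>

text \<open>Curvatures are given through global fields that are orthonormal at one point
  \<open>p\<close> only. The computation therefore treats fields and the functions
  \<open>ip X Y\<close> as global objects, normalises only by constants (a field may vanish away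
  from \<open>p\<close>), and evaluates at \<open>p\<close> at the end.

  The structure fields enter through their sum \<open>E\<close>: the semi-symmetric connection is
  \<open>D X Y + ip Y E *\<^sub>F X - ip X Y *\<^sub>F E\<close>. This sum is the common source of
  the two occurrences of \<open>s\<close>. In \<open>K\<^sup>* = K - s\<close> the number is the
  squared length \<open>ip E E\<close>; in the Ricci identity for \<open>F\<close> it comes from
  \<open>D X E = - s F X\<close>. The first makes the Riemannian curvature of horizontal planes
  equal to \<open>c + s\<close>; the second, once the mixed term vanishes, makes it equal to
  \<open>s\<close>. So the two contributions cancel and leave \<open>c = 0\<close>.\<close>

lemma Ck_on_SucD:
  assumes "Ck_on (Suc k) h S" "x \<in> S"
  shows "(h has_derivative frechet_derivative h (at x)) (at x)"
  using assms by (auto simp: frechet_derivative_works)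

lemma Ck_on_cong:
  assumes "open S" "\<And>x. x \<in> S \<Longrightarrow> h x = h' x" "Ck_on k h S"
  shows "Ck_on k h' S"
  using assms(2,3)
proof (induction k arbitrary: h h')
  case 0
  then show ?case by (simp cong: continuous_on_cong)
next
  case (Suc k)
  have *: "(h' has_derivative frechet_derivative h (at x)) (at x)" if "x \<in> S" for x
    using has_derivative_transform_within_open[OF Ck_on_SucD[OF Suc.prems(2) that] \<open>open S\<close> that] Suc.prems(1)
    by auto
  have "Ck_on k (\<lambda>x. frechet_derivative h' (at x) v) S" for v
    by (rule Suc.IH[of "\<lambda>x. frechet_derivative h (at x) v"])
      (use Suc.prems(2) frechet_derivative_at[OF *] in auto)
  then show ?case
    using * by (auto simp: differentiable_def)
qed

lemma Ck_on_SucI: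
  assumes "open S" "\<And>x. x \<in> S \<Longrightarrow> (h has_derivative D x) (at x)" "\<And>v. Ck_on k (\<lambda>x. D x v) S"
  shows "Ck_on (Suc k) h S"
proof -
  have "Ck_on k (\<lambda>x. frechet_derivative h (at x) v) S" for v
    by (rule Ck_on_cong[OF \<open>open S\<close> _ assms(3)[of v]]) (use frechet_derivative_at[OF assms(2)] in auto)
  then show ?thesis
    using assms(2) by (auto simp: differentiable_def)
qed

lemma Ck_on_SucE: "Ck_on (Suc k) h S \<Longrightarrow> Ck_on k h S"
proof (induction k arbitrary: h)
  case 0
  then show ?case
    by (auto intro!: continuous_at_imp_continuous_on differentiable_imp_continuous_within)
qed simp

lemma Ck_on_imp_continuous_on: "Ck_on k h S \<Longrightarrow> continuous_on S h"
proof (induction k)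
  case (Suc k)
  then show ?case using Ck_on_SucE by blast
qed simp

lemma Ck_on_subset: "Ck_on k h S \<Longrightarrow> T \<subseteq> S \<Longrightarrow> Ck_on k h T"
  by (induction k arbitrary: h) (auto intro: continuous_on_subset)

lemma Ck_on_locally:
  assumes "\<And>x. x \<in> S \<Longrightarrow> \<exists>T. open T \<and> x \<in> T \<and> Ck_on k h T"
  shows "Ck_on k h S"
  using assms
proof (induction k arbitrary: h)
  case 0
  then show ?case
    by (simp add: continuous_at_imp_continuous_on) (metis continuous_at_imp_continuous_on continuous_on_eq_continuous_at)
next
  case (Suc k)
  show ?case
  proof (simp, intro conjI ballI allI)
    show "h differentiable at x" if "x \<in> S" for x
      using Suc.prems[OF that] by auto
    show "Ck_on k (\<lambda>x. frechet_derivative h (at x) v) S" for v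
    proof (rule Suc.IH)
      fix x assume "x \<in> S"
      then obtain T where "open T" "x \<in> T" "Ck_on (Suc k) h T" using Suc.prems by blast
      then show "\<exists>T. open T \<and> x \<in> T \<and> Ck_on k (\<lambda>x. frechet_derivative h (at x) v) T" by auto
    qed
  qed
qed

lemma Ck_on_const: "open S \<Longrightarrow> Ck_on k (\<lambda>x. c) S"
proof (induction k arbitrary: c)
  case (Suc k)
  show ?case
    by (rule Ck_on_SucI[OF Suc.prems, of _ "\<lambda>x v. 0"]) (auto intro: Suc)
qed simp

lemma Ck_on_bounded_linear:
  assumes "open S" "bounded_linear L" "Ck_on k h S"
  shows "Ck_on k (\<lambda>x. L (h x)) S"
  using assms(3)
proof (induction k arbitrary: h)
  case 0
  then show ?case using bounded_linear.continuous_on[OF assms(2)] by auto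
next
  case (Suc k)
  show ?case
    by (rule Ck_on_SucI[OF \<open>open S\<close> bounded_linear.has_derivative[OF assms(2) Ck_on_SucD[OF Suc.prems]]])
      (use Suc.prems in \<open>auto intro: Suc.IH\<close>)
qed

lemma Ck_on_linear:
  fixes L :: "'a::euclidean_space \<Rightarrow> 'b::real_normed_vector"
  assumes "open S" "bounded_linear L"
  shows "Ck_on k L S"
proof (cases k)
  case 0
  then show ?thesis using linear_continuous_on[OF assms(2)] by auto
next
  case (Suc j)
  show ?thesis unfolding Suc
    by (rule Ck_on_SucI[OF assms(1) bounded_linear.has_derivative[OF assms(2) has_derivative_ident]])
      (auto intro: Ck_on_const assms)
qed

lemma Ck_on_add:
  assumes "open S" "Ck_on k h S" "Ck_on k h' S"
  shows "Ck_on k (\<lambda>x. h x + h' x) S"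
  using assms(2,3)
proof (induction k arbitrary: h h')
  case 0
  then show ?case by (auto intro: continuous_intros)
next
  case (Suc k)
  show ?case
  proof (rule Ck_on_SucI[OF \<open>open S\<close> has_derivative_add[OF Ck_on_SucD[OF Suc.prems(1)] Ck_on_SucD[OF Suc.prems(2)]]])
    show "Ck_on k (\<lambda>x. frechet_derivative h (at x) v + frechet_derivative h' (at x) v) S" for v
      by (rule Suc.IH) (use Suc.prems in simp_all)
  qed
qed

lemma Ck_on_sum:
  assumes "open S" "\<And>i. i \<in> I \<Longrightarrow> Ck_on k (h i) S"
  shows "Ck_on k (\<lambda>x. \<Sum>i\<in>I. h i x) S"
  using assms(2)
  by (induction I rule: infinite_finite_induct) (auto intro: Ck_on_const Ck_on_add assms(1))

lemma Ck_on_mult: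
  fixes h h' :: "'e::euclidean_space \<Rightarrow> real"
  assumes "open S" "Ck_on k h S" "Ck_on k h' S"
  shows "Ck_on k (\<lambda>x. h x * h' x) S"
  using assms(2,3)
proof (induction k arbitrary: h h')
  case 0
  then show ?case by (auto intro: continuous_intros)
next
  case (Suc k)
  show ?case
  proof (rule Ck_on_SucI[OF \<open>open S\<close> has_derivative_mult[OF Ck_on_SucD[OF Suc.prems(1)] Ck_on_SucD[OF Suc.prems(2)]]])
    show "Ck_on k (\<lambda>x. h x * frechet_derivative h' (at x) v + frechet_derivative h (at x) v * h' x) S" for v
      by (intro Ck_on_add Suc.IH Ck_on_SucE[OF Suc.prems(1)] Ck_on_SucE[OF Suc.prems(2)] \<open>open S\<close>)
        (use Suc.prems in simp_all)
  qed
qed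

lemma linear_eq_sum_Basis:
  fixes L :: "'e::euclidean_space \<Rightarrow> real"
  assumes "linear L"
  shows "L v = (\<Sum>b\<in>Basis. (v \<bullet> b) * L b)"
proof -
  have "L v = L (\<Sum>b\<in>Basis. (v \<bullet> b) *\<^sub>R b)" by (simp add: euclidean_representation)
  then show ?thesis by (simp add: linear_sum[OF assms] linear_scale[OF assms])
qed

text \<open>In the chain rule the direction in which \<open>h\<close> is differentiated moves with
  the point. Expanding it in the basis leaves derivatives of \<open>h\<close> in fixed directions,
  to which the induction hypothesis applies, multiplied by coordinates of the derivative of
  \<open>\<gamma>\<close>.\<close>

lemma Ck_on_compose:
  fixes h :: "'e::euclidean_space \<Rightarrow> real" and \<gamma> :: "'d::euclidean_space \<Rightarrow> 'e"
  assumes "open S" "open T" "\<gamma> ` S \<subseteq> T" "Ck_on k \<gamma> S" "Ck_on k h T"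
  shows "Ck_on k (\<lambda>x. h (\<gamma> x)) S"
  using assms(4,5)
proof (induction k arbitrary: h)
  case 0
  then show ?case using continuous_on_compose2[of T h S \<gamma>] assms(3) by auto
next
  case (Suc k)
  let ?D = "\<lambda>x. frechet_derivative \<gamma> (at x)" and ?E = "\<lambda>y. frechet_derivative h (at y)"
  have der: "((\<lambda>x. h (\<gamma> x)) has_derivative (\<lambda>v. \<Sum>b\<in>Basis. (?D x v \<bullet> b) * ?E (\<gamma> x) b)) (at x)"
    if "x \<in> S" for x
  proof -
    have E: "(h has_derivative ?E (\<gamma> x)) (at (\<gamma> x))"
      using Ck_on_SucD[OF Suc.prems(2)] assms(3) that by auto
    have repr: "?E (\<gamma> x) w = (\<Sum>b\<in>Basis. (w \<bullet> b) * ?E (\<gamma> x) b)" for w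
      using E has_derivative_linear by (blast intro: linear_eq_sum_Basis)
    show ?thesis
      by (rule has_derivative_eq_rhs[OF has_derivative_compose[OF Ck_on_SucD[OF Suc.prems(1) that] E] ext[OF repr]])
  qed
  show ?case
  proof (rule Ck_on_SucI[OF \<open>open S\<close> der])
    fix v
    show "Ck_on k (\<lambda>x. \<Sum>b\<in>Basis. (?D x v \<bullet> b) * ?E (\<gamma> x) b) S"
    proof (intro Ck_on_sum Ck_on_mult \<open>open S\<close>)
      fix b
      show "Ck_on k (\<lambda>x. ?D x v \<bullet> b) S"
        by (rule Ck_on_bounded_linear[OF \<open>open S\<close> bounded_linear_inner_left]) (use Suc.prems in simp)
      show "Ck_on k (\<lambda>x. ?E (\<gamma> x) b) S"
        by (rule Suc.IH[OF Ck_on_SucE[OF Suc.prems(1)]]) (use Suc.prems in simp)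
    qed
  qed
qed

section \<open>Bump functions\<close>

definition flat :: "real poly \<Rightarrow> real \<Rightarrow> real" where
  "flat P t = (if t > 0 then poly P (1 / t) * exp (- (1 / t)) else 0)"

lemma poly_exp_decay: "((\<lambda>y. poly P y * exp (- y)) \<longlongrightarrow> (0::real)) at_top"
proof -
  have "((\<lambda>y. \<Sum>i\<le>degree P. coeff P i * (y ^ i / exp y)) \<longlongrightarrow> (0::real)) at_top"
    by (intro tendsto_null_sum tendsto_mult_right_zero tendsto_power_div_exp_0)
  then show ?thesis
    by (simp add: poly_altdef sum_distrib_right exp_minus divide_inverse mult.assoc)
qed

text \<open>For positive \<open>t\<close>, \<open>flat 1 t\<close> is the exponential of
  \<open>- 1/t\<close>. Its derivatives are polynomials in \<open>y = 1/t\<close> times the same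
  exponential, and the polynomial parameter makes the family closed under differentiation:
  \<open>dy/dt = - y^2\<close> turns \<open>P\<close> into \<open>y^2 (P - P')\<close>.\<close>

lemma flat_has_derivative:
  "(flat P has_field_derivative flat ([:0, 0, 1:] * (P - pderiv P)) t) (at t)"
proof -
  consider "t > 0" | "t < 0" | "t = 0" by linarith
  then show ?thesis
  proof cases
    case 1
    have inv: "((\<lambda>t. 1 / t) has_field_derivative - (1 / t\<^sup>2)) (at t)"
      using 1 by (auto intro!: derivative_eq_intros simp: power2_eq_square)
    have "((\<lambda>t. poly P (1 / t) * exp (- (1 / t))) has_field_derivative
        flat ([:0, 0, 1:] * (P - pderiv P)) t) (at t)"
      by (rule DERIV_cong[OF DERIV_mult[OF DERIV_chain2[OF poly_DERIV inv] DERIV_chain2[OF DERIV_exp DERIV_minus[OF inv]]]])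
        (use 1 in \<open>simp add: flat_def field_simps power2_eq_square\<close>)
    then show ?thesis
      by (rule has_field_derivative_transform_within_open[where S = "{0<..}"])
        (use 1 in \<open>auto simp: flat_def\<close>)
  next
    case 2
    then have "flat ([:0, 0, 1:] * (P - pderiv P)) t = 0" by (simp add: flat_def)
    moreover have "(flat P has_field_derivative 0) (at t)"
      by (rule has_field_derivative_transform_within_open[where S = "{..<0}" and f = "\<lambda>_. 0"])
        (use 2 in \<open>auto simp: flat_def\<close>)
    ultimately show ?thesis by simp
  next
    case 3
    have "((\<lambda>h. (flat P (0 + h) - flat P 0) / h) \<longlongrightarrow> 0) (at 0)"
      unfolding filterlim_at_split
    proof
      show "((\<lambda>h. (flat P (0 + h) - flat P 0) / h) \<longlongrightarrow> 0) (at_left 0)"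
        by (rule tendsto_eventually) (auto simp: eventually_at_filter flat_def)
      \<comment> \<open>The right difference quotient at 0 is \<open>y P(y) exp (- y)\<close> with
        \<open>y = 1/h\<close>, hence the extra factor \<open>[:0, 1:]\<close>.\<close>
      have "((\<lambda>h. poly ([:0, 1:] * P) (inverse h) * exp (- inverse h)) \<longlongrightarrow> 0) (at_right (0::real))"
        by (rule filterlim_compose[OF poly_exp_decay filterlim_inverse_at_top_right])
      then show "((\<lambda>h. (flat P (0 + h) - flat P 0) / h) \<longlongrightarrow> 0) (at_right 0)"
        by (rule Lim_transform_eventually) (auto simp: eventually_at_filter flat_def field_simps)
    qed
    then have "(flat P has_field_derivative 0) (at 0)" by (simp add: DERIV_def)
    then show ?thesis using 3 by (simp add: flat_def)
  qed
qed

lemma Ck_on_flat: "Ck_on k (flat P) UNIV"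
proof (induction k arbitrary: P)
  case 0
  show ?case
    using DERIV_continuous[OF flat_has_derivative] by (auto simp: continuous_on_eq_continuous_within)
next
  case (Suc k)
  show ?case
    by (rule Ck_on_SucI[OF open_UNIV flat_has_derivative[unfolded has_field_derivative_def]])
      (intro Ck_on_mult Ck_on_const Suc open_UNIV)
qed

definition bump :: "'e::euclidean_space \<Rightarrow> real \<Rightarrow> 'e \<Rightarrow> real" where
  "bump x0 r x = flat 1 (r\<^sup>2 - (x - x0) \<bullet> (x - x0)) / flat 1 (r\<^sup>2)"

lemma Ck_on_bump:
  fixes x0 :: "'e::euclidean_space"
  shows "Ck_on k (bump x0 r) UNIV"
proof -
  \<comment> \<open>Writing the squared distance as a polynomial in the coordinates reduces its
    smoothness to the closure rules for sums and products.\<close>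
  have "Ck_on k (\<lambda>x. r\<^sup>2 + (-1) * (\<Sum>b\<in>Basis. ((x \<bullet> b) + (- x0 \<bullet> b)) * ((x \<bullet> b) + (- x0 \<bullet> b)))) (UNIV :: 'e set)"
    by (intro Ck_on_add Ck_on_const Ck_on_mult Ck_on_sum Ck_on_linear bounded_linear_inner_left) auto
  moreover have "(\<lambda>x. r\<^sup>2 + (-1) * (\<Sum>b\<in>Basis. ((x \<bullet> b) + (- x0 \<bullet> b)) * ((x \<bullet> b) + (- x0 \<bullet> b))))
      = (\<lambda>x. r\<^sup>2 - (x - x0) \<bullet> (x - x0))"
    by (subst (3) euclidean_inner) (simp add: inner_diff_left)
  ultimately have "Ck_on k (\<lambda>x. r\<^sup>2 - (x - x0) \<bullet> (x - x0)) (UNIV :: 'e set)" by simp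
  from Ck_on_compose[OF open_UNIV open_UNIV _ this Ck_on_flat[of k 1]]
  have "Ck_on k (\<lambda>x. flat 1 (r\<^sup>2 - (x - x0) \<bullet> (x - x0)) * (1 / flat 1 (r\<^sup>2))) (UNIV :: 'e set)"
    by (intro Ck_on_mult Ck_on_const) auto
  then show ?thesis by (simp add: bump_def[abs_def])
qed

lemma bump_center: "r > 0 \<Longrightarrow> bump x0 r x0 = 1"
  by (simp add: bump_def flat_def)

lemma bump_outside:
  assumes "r > 0" "x \<notin> cball x0 r"
  shows "bump x0 r x = 0"
proof -
  have "r < norm (x - x0)" using assms by (simp add: dist_norm norm_minus_commute)
  then have "r\<^sup>2 < (norm (x - x0))\<^sup>2" using assms(1) by (intro power_strict_mono) auto
  then show ?thesis by (simp add: bump_def flat_def power2_norm_eq_inner)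
qed

section \<open>Hadamard's lemma\<close>

lemma ray_in_ball:
  fixes x :: "'e::real_normed_vector"
  assumes "x \<in> ball x0 r" "t \<in> cbox 0 (1::real)"
  shows "x0 + t *\<^sub>R (x - x0) \<in> ball x0 r"
proof -
  have "\<bar>t\<bar> * norm (x - x0) \<le> 1 * norm (x - x0)"
    using assms by (intro mult_right_mono) auto
  then show ?thesis using assms by (simp add: dist_norm norm_minus_commute)
qed

text \<open>The weight \<open>t ^ j\<close> makes the statement stable under differentiation in \<open>x\<close>.\<close>

lemma Ck_on_ray_integral:
  fixes w :: "'e::euclidean_space \<Rightarrow> real"
  assumes "Ck_on k w (ball x0 r)"
  shows "Ck_on k (\<lambda>x. integral (cbox 0 1) (\<lambda>t. t ^ j * w (x0 + t *\<^sub>R (x - x0)))) (ball x0 r)"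
  using assms
proof (induction k arbitrary: w j)
  let ?B = "ball x0 r"
  note ray = ray_in_ball[of _ x0 r]
  have cont: "continuous_on (?B \<times> cbox 0 1) (\<lambda>(x, t). t ^ i * u (x0 + t *\<^sub>R (x - x0)))"
    if "continuous_on ?B u" for u :: "'e \<Rightarrow> real" and i
  proof -
    have "continuous_on (?B \<times> cbox 0 1) (\<lambda>z. u (x0 + snd z *\<^sub>R (fst z - x0)))"
      by (rule continuous_on_compose2[OF that]) (use ray in \<open>auto intro!: continuous_intros\<close>)
    then show ?thesis
      unfolding case_prod_beta by (intro continuous_intros)
  qed
  {
    case 0
    then show ?case
      using integral_continuous_on_param[OF cont] by simp
  next
    case (Suc k)
    let ?D = "\<lambda>x. frechet_derivative w (at x)"
    have bl: "bounded_linear (\<lambda>v. t ^ Suc j * ?D (x0 + t *\<^sub>R (x - x0)) v)"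
      if "x \<in> ?B" "t \<in> cbox 0 1" for x t
      using Ck_on_SucD[OF Suc.prems ray[OF that]] has_derivative_bounded_linear bounded_linear_const_mult
      by blast
    \<comment> \<open>\<open>leibniz_rule\<close> wants the derivative as an operator-valued
      function that is jointly continuous in \<open>x\<close> and \<open>t\<close>; by
      \<open>continuous_on_blinfun_componentwise\<close> it is enough to check each basis
      direction.\<close>
    define fx where "fx x t = Blinfun (\<lambda>v. t ^ Suc j * ?D (x0 + t *\<^sub>R (x - x0)) v)" for x t
    have fx: "blinfun_apply (fx x t) v = t ^ Suc j * ?D (x0 + t *\<^sub>R (x - x0)) v"
      if "x \<in> ?B" "t \<in> cbox 0 1" for x t v
      unfolding fx_def bounded_linear_Blinfun_apply[OF bl[OF that]] ..
    have cont_w: "continuous_on ?B w"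
      by (rule Ck_on_imp_continuous_on[OF Suc.prems])
    have contD: "continuous_on ?B (\<lambda>x. ?D x v)" for v
      by (rule Ck_on_imp_continuous_on[of k]) (use Suc.prems in simp)
    have cont_fx: "continuous_on (?B \<times> cbox 0 1) (\<lambda>(x, t). fx x t)"
    proof (rule continuous_on_blinfun_componentwise)
      fix i :: 'e
      show "continuous_on (?B \<times> cbox 0 1) (\<lambda>z. blinfun_apply (case z of (x, t) \<Rightarrow> fx x t) i)"
        by (rule continuous_on_cong[THEN iffD1, OF refl _ cont[OF contD[of i], of "Suc j"]])
          (use fx in auto)
    qed
    have int_w: "(\<lambda>t. t ^ j * w (x0 + t *\<^sub>R (x - x0))) integrable_on cbox 0 1" if "x \<in> ?B" for x
    proof (rule integrable_continuous)
      have "continuous_on (cbox 0 1) ((\<lambda>(x, t). t ^ j * w (x0 + t *\<^sub>R (x - x0))) \<circ> (\<lambda>t. (x, t)))"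
        by (rule continuous_on_compose[OF _ continuous_on_subset[OF cont[OF cont_w]]])
          (use that in \<open>auto intro!: continuous_intros\<close>)
      then show "continuous_on (cbox 0 1) (\<lambda>t. t ^ j * w (x0 + t *\<^sub>R (x - x0)))" by (simp add: o_def)
    qed
    have int_fx: "fx x integrable_on cbox 0 1" if "x \<in> ?B" for x
    proof (rule integrable_continuous)
      have "continuous_on (cbox 0 1) ((\<lambda>(x, t). fx x t) \<circ> (\<lambda>t. (x, t)))"
        by (rule continuous_on_compose[OF _ continuous_on_subset[OF cont_fx]])
          (use that in \<open>auto intro!: continuous_intros\<close>)
      then show "continuous_on (cbox 0 1) (fx x)" by (simp add: o_def)
    qed
    have "((\<lambda>x. t ^ j * w (x0 + t *\<^sub>R (x - x0))) has_derivative blinfun_apply (fx x t)) (at x within ?B)"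
      if "x \<in> ?B" "t \<in> cbox 0 1" for x t
    proof -
      interpret D: bounded_linear "?D (x0 + t *\<^sub>R (x - x0))"
        using Ck_on_SucD[OF Suc.prems ray[OF that]] has_derivative_bounded_linear by blast
      have "((\<lambda>x. x0 + t *\<^sub>R (x - x0)) has_derivative (\<lambda>v. t *\<^sub>R v)) (at x)"
        by (auto intro!: derivative_eq_intros)
      from has_derivative_compose[OF this Ck_on_SucD[OF Suc.prems ray[OF that]]]
      have "((\<lambda>x. t ^ j * w (x0 + t *\<^sub>R (x - x0))) has_derivative
          (\<lambda>v. t ^ j * ?D (x0 + t *\<^sub>R (x - x0)) (t *\<^sub>R v))) (at x)"
        by (rule has_derivative_mult_right)
      moreover have "(\<lambda>v. t ^ j * ?D (x0 + t *\<^sub>R (x - x0)) (t *\<^sub>R v)) = blinfun_apply (fx x t)"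
        using fx[OF that] by (auto simp: D.scaleR)
      ultimately show ?thesis by (simp only: has_derivative_at_withinI)
    qed
    note leibniz = leibniz_rule[OF this int_w cont_fx _ convex_ball]
    show ?case
    proof (rule Ck_on_SucI[OF open_ball])
      fix x assume "x \<in> ?B"
      then show "((\<lambda>x. integral (cbox 0 1) (\<lambda>t. t ^ j * w (x0 + t *\<^sub>R (x - x0)))) has_derivative
          blinfun_apply (integral (cbox 0 1) (fx x))) (at x)"
        using leibniz by (simp only: at_within_open[OF _ open_ball])
    next
      fix v
      show "Ck_on k (\<lambda>x. blinfun_apply (integral (cbox 0 1) (fx x)) v) ?B"
      proof (rule Ck_on_cong[OF open_ball])
        show "Ck_on k (\<lambda>x. integral (cbox 0 1) (\<lambda>t. t ^ Suc j * ?D (x0 + t *\<^sub>R (x - x0)) v)) ?B"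
          by (rule Suc.IH) (use Suc.prems in simp)
        show "integral (cbox 0 1) (\<lambda>t. t ^ Suc j * ?D (x0 + t *\<^sub>R (x - x0)) v)
            = blinfun_apply (integral (cbox 0 1) (fx x)) v" if "x \<in> ?B" for x
          unfolding blinfun_apply_integral[OF int_fx[OF that]]
          by (rule integral_cong) (use fx[OF that] in auto)
      qed
    qed
  }
qed

text \<open>The difference \<open>w x - w x0\<close> is the integral over \<open>t\<close> of the
  derivative of \<open>w\<close> at \<open>x0 + t (x - x0)\<close> in the direction
  \<open>x - x0\<close>. Once that direction is expanded in the basis, \<open>h b\<close> is the
  average over the segment of the partial derivative along \<open>b\<close>.\<close>

lemma hadamard:
  fixes w :: "'e::euclidean_space \<Rightarrow> real"
  assumes "smooth_on w (ball x0 r)"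
  obtains h where "\<And>b. smooth_on (h b) (ball x0 r)"
    "\<And>x. x \<in> ball x0 r \<Longrightarrow> w x = w x0 + (\<Sum>b\<in>Basis. ((x - x0) \<bullet> b) * h b x)"
proof
  let ?B = "ball x0 r"
  let ?D = "\<lambda>x. frechet_derivative w (at x)"
  \<comment> \<open>The factor \<open>t ^ 0\<close> matches the form of
    \<open>Ck_on_ray_integral\<close> for \<open>j = 0\<close>.\<close>
  let ?h = "\<lambda>b x. integral (cbox 0 1) (\<lambda>t. t ^ 0 * ?D (x0 + t *\<^sub>R (x - x0)) b)"
  have C: "Ck_on (Suc k) w ?B" for k using assms by (simp only: smooth_on_def)
  show "smooth_on (?h b) ?B" for b
    unfolding smooth_on_def
    by (intro allI Ck_on_ray_integral) (use C in simp)
  fix x assume x: "x \<in> ?B"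
  note ray = ray_in_ball[OF x]
  have D: "?D y v = (\<Sum>b\<in>Basis. (v \<bullet> b) * ?D y b)" if "y \<in> ?B" for y v
    using Ck_on_SucD[OF C that] has_derivative_linear by (blast intro: linear_eq_sum_Basis)
  have "((\<lambda>t. w (x0 + t *\<^sub>R (x - x0))) has_vector_derivative ?D (x0 + t *\<^sub>R (x - x0)) (x - x0))
      (at t within {0..1})" if "t \<in> {0..1}" for t
  proof -
    have r: "x0 + t *\<^sub>R (x - x0) \<in> ?B" using ray that by simp
    have lin: "linear (?D (x0 + t *\<^sub>R (x - x0)))" using Ck_on_SucD[OF C r] has_derivative_linear by blast
    have "((\<lambda>t. x0 + t *\<^sub>R (x - x0)) has_derivative (\<lambda>h. h *\<^sub>R (x - x0))) (at t)"
      by (auto intro!: derivative_eq_intros)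
    from has_derivative_compose[OF this Ck_on_SucD[OF C r]] show ?thesis
      unfolding has_vector_derivative_def linear_scale[OF lin] by (rule has_derivative_at_withinI)
  qed
  from fundamental_theorem_of_calculus[OF _ this]
  have "((\<lambda>t. ?D (x0 + t *\<^sub>R (x - x0)) (x - x0)) has_integral (w x - w x0)) (cbox 0 1)" by simp
  then have "w x - w x0 = integral (cbox 0 1) (\<lambda>t. ?D (x0 + t *\<^sub>R (x - x0)) (x - x0))"
    by (simp add: integral_unique)
  also have "\<dots> = integral (cbox 0 1) (\<lambda>t. \<Sum>b\<in>Basis. ((x - x0) \<bullet> b) * ?D (x0 + t *\<^sub>R (x - x0)) b)"
    by (intro integral_cong D ray) simp
  also have "\<dots> = (\<Sum>b\<in>Basis. integral (cbox 0 1) (\<lambda>t. ((x - x0) \<bullet> b) * ?D (x0 + t *\<^sub>R (x - x0)) b))"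
  proof (rule integral_sum)
    fix b
    have "continuous_on ?B (\<lambda>y. ?D y b)" using C[of 0] by simp
    then have "continuous_on (cbox 0 1) (\<lambda>t. ?D (x0 + t *\<^sub>R (x - x0)) b)"
      by (rule continuous_on_compose2) (use ray in \<open>auto intro!: continuous_intros\<close>)
    then show "(\<lambda>t. ((x - x0) \<bullet> b) * ?D (x0 + t *\<^sub>R (x - x0)) b) integrable_on cbox 0 1"
      by (intro integrable_continuous continuous_intros)
  qed simp
  finally show "w x = w x0 + (\<Sum>b\<in>Basis. ((x - x0) \<bullet> b) * ?h b x)" by simp
qed

section \<open>Tangent spaces\<close>

locale manifold =
  fixes A :: "('m::{t2_space, second_countable_topology}, 'e::euclidean_space) atlas"
  assumes smooth_manifold: "smooth_manifold A"
begin

lemma chart: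
  assumes "(U, \<phi>) \<in> A"
  shows "open U" "open (\<phi> ` U)" "homeomorphism U (\<phi> ` U) \<phi> (inv_into U \<phi>)"
  using smooth_manifold assms unfolding smooth_manifold_def by blast+

lemma transition:
  assumes "(U, \<phi>) \<in> A" "(V, \<psi>) \<in> A"
  shows "smooth_on (\<psi> \<circ> inv_into U \<phi>) (\<phi> ` (U \<inter> V))"
proof -
  have "\<forall>(U, \<phi>)\<in>A. \<forall>(V, \<psi>)\<in>A. smooth_on (\<psi> \<circ> inv_into U \<phi>) (\<phi> ` (U \<inter> V))"
    using smooth_manifold by (simp add: smooth_manifold_def)
  from bspec[OF this assms(1)] have "\<forall>(V, \<psi>)\<in>A. smooth_on (\<psi> \<circ> inv_into U \<phi>) (\<phi> ` (U \<inter> V))"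
    by (simp only: prod.case)
  from bspec[OF this assms(2)] show ?thesis by (simp only: prod.case)
qed

lemma chart_at: obtains U \<phi> where "(U, \<phi>) \<in> A" "p \<in> U"
proof -
  have "p \<in> (\<Union>(U, \<phi>)\<in>A. U)" using smooth_manifold by (simp add: smooth_manifold_def)
  then show ?thesis using that by auto
qed

lemma open_chart_image:
  assumes "(U, \<phi>) \<in> A" "open W"
  shows "open (\<phi> ` (U \<inter> W))"
proof -
  have "openin (top_of_set (\<phi> ` U)) (\<phi> ` (U \<inter> W))"
    using homeomorphism_imp_open_map[OF chart(3)[OF assms(1)]] assms(2) by blast
  then show ?thesis using openin_open_eq[OF chart(2)[OF assms(1)]] by simp
qed

lemma smooth_funs_Ck:
  "u \<in> smooth_funs A \<longleftrightarrow> (\<forall>(U, \<phi>)\<in>A. \<forall>k. Ck_on k (\<lambda>x. u (inv_into U \<phi> x)) (\<phi> ` U))"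
  by (simp add: smooth_funs_def smooth_on_def o_def)

lemma smooth_const: "(\<lambda>q. c) \<in> smooth_funs A"
  unfolding smooth_funs_Ck using chart(2) by (auto intro!: Ck_on_const)

lemma smooth_add: "u \<in> smooth_funs A \<Longrightarrow> w \<in> smooth_funs A \<Longrightarrow> (\<lambda>q. u q + w q) \<in> smooth_funs A"
  unfolding smooth_funs_Ck split_beta by (intro ballI allI Ck_on_add) (use chart(2) in auto)

lemma smooth_mult: "u \<in> smooth_funs A \<Longrightarrow> w \<in> smooth_funs A \<Longrightarrow> (\<lambda>q. u q * w q) \<in> smooth_funs A"
  unfolding smooth_funs_Ck split_beta by (intro ballI allI Ck_on_mult) (use chart(2) in auto)

lemma smooth_cmult: "u \<in> smooth_funs A \<Longrightarrow> (\<lambda>q. c * u q) \<in> smooth_funs A"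
  by (rule smooth_mult[OF smooth_const])

lemma smooth_minus: "u \<in> smooth_funs A \<Longrightarrow> (\<lambda>q. - u q) \<in> smooth_funs A"
  using smooth_cmult[of u "-1"] by simp

lemma smooth_diff: "u \<in> smooth_funs A \<Longrightarrow> w \<in> smooth_funs A \<Longrightarrow> (\<lambda>q. u q - w q) \<in> smooth_funs A"
  using smooth_add[OF _ smooth_minus, of u w] by simp

lemma smooth_sum: "(\<And>i. i \<in> I \<Longrightarrow> u i \<in> smooth_funs A) \<Longrightarrow> (\<lambda>q. \<Sum>i\<in>I. u i q) \<in> smooth_funs A"
  by (induction I rule: infinite_finite_induct) (auto intro: smooth_const smooth_add)

text \<open>A smooth function on a coordinate ball extends by zero if its support lies in a smaller
  closed ball: that ball is compact, hence closed in the Hausdorff manifold.\<close>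

lemma smooth_extend_zero:
  assumes ch: "(U, \<phi>) \<in> A" and ball: "ball x0 R \<subseteq> \<phi> ` U" and "r < R"
    and w: "smooth_on w (ball x0 R)" and supp: "\<And>x. x \<notin> cball x0 r \<Longrightarrow> w x = 0"
  shows "(\<lambda>q. if q \<in> U then w (\<phi> q) else 0) \<in> smooth_funs A" (is "?F \<in> _")
proof -
  have "Ck_on k (\<lambda>x. ?F (inv_into V \<psi> x)) (\<psi> ` V)" if ch': "(V, \<psi>) \<in> A" for V \<psi> k
  proof -
    let ?i = "inv_into V \<psi>"
    have inv: "?i (\<psi> q) = q" if "q \<in> V" for q
      using chart(3)[OF ch'] that by (simp add: homeomorphism_def)
    define O' where "O' = U \<inter> \<phi> -` ball x0 R"
    define K where "K = inv_into U \<phi> ` cball x0 r"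
    have "continuous_on U \<phi>" and conti: "continuous_on (\<phi> ` U) (inv_into U \<phi>)"
      and invU: "\<And>q. q \<in> U \<Longrightarrow> inv_into U \<phi> (\<phi> q) = q"
      using chart(3)[OF ch] by (auto simp: homeomorphism_def)
    then have "open O'" unfolding O'_def
      by (intro continuous_open_preimage chart(1)[OF ch]) auto
    have "compact K" unfolding K_def
      by (rule compact_continuous_image[OF continuous_on_subset[OF conti]])
        (use ball \<open>r < R\<close> in auto)
    then have "open (- K)" by (simp add: compact_imp_closed open_Compl)
    show ?thesis
    proof (rule Ck_on_locally)
      fix y assume "y \<in> \<psi> ` V"
      then obtain q where q: "q \<in> V" "y = \<psi> q" by auto
      show "\<exists>T. open T \<and> y \<in> T \<and> Ck_on k (\<lambda>x. ?F (?i x)) T"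
      \<comment> \<open>The open sets \<open>O'\<close> and \<open>- K\<close> cover the manifold
        because \<open>K\<close> lies in \<open>O'\<close>. On the first the function is
        \<open>w\<close> in coordinates, on the second it is 0.\<close>
      proof (cases "q \<in> O'")
        case True
        let ?T = "\<psi> ` (V \<inter> O')"
        have op: "open ?T" by (rule open_chart_image[OF ch' \<open>open O'\<close>])
        have "Ck_on k (\<lambda>x. w ((\<phi> \<circ> ?i) x)) ?T"
        proof (rule Ck_on_compose[where \<gamma> = "\<phi> \<circ> ?i" and T = "ball x0 R", OF op open_ball])
          show "(\<phi> \<circ> ?i) ` ?T \<subseteq> ball x0 R" using inv by (auto simp: O'_def)
          have "Ck_on k (\<phi> \<circ> ?i) (\<psi> ` (V \<inter> U))"
            using transition[OF ch' ch] by (simp add: smooth_on_def)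
          then show "Ck_on k (\<phi> \<circ> ?i) ?T"
            by (rule Ck_on_subset) (auto simp: O'_def)
          show "Ck_on k w (ball x0 R)" using w by (simp add: smooth_on_def)
        qed
        then have "Ck_on k (\<lambda>x. ?F (?i x)) ?T"
          by (rule Ck_on_cong[OF op, rotated]) (use inv in \<open>auto simp: O'_def\<close>)
        then show ?thesis using op q True by blast
      next
        case False
        have "q \<notin> K"
        proof
          assume "q \<in> K"
          then obtain x where x: "x \<in> cball x0 r" "q = inv_into U \<phi> x" by (auto simp: K_def)
          then have "x \<in> ball x0 R" using \<open>r < R\<close> by auto
          then obtain q' where q': "q' \<in> U" "x = \<phi> q'" using ball by auto
          then show False using False x invU \<open>x \<in> ball x0 R\<close> by (auto simp: O'_def)
        qed
        let ?T = "\<psi> ` (V \<inter> - K)"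
        have op: "open ?T" by (rule open_chart_image[OF ch' \<open>open (- K)\<close>])
        have zero: "w (\<phi> q') = 0" if "q' \<in> U" "q' \<notin> K" for q'
          using that supp invU unfolding K_def by (metis image_eqI)
        have "Ck_on k (\<lambda>x. ?F (?i x)) ?T"
          by (rule Ck_on_cong[OF op _ Ck_on_const[OF op, of _ 0]]) (use zero inv in auto)
        then show ?thesis using op q \<open>q \<notin> K\<close> by blast
      qed
    qed
  qed
  then show ?thesis unfolding smooth_funs_Ck by blast
qed

lemma tangent_not_smooth: "v \<in> tangent_space A p \<Longrightarrow> u \<notin> smooth_funs A \<Longrightarrow> v u = 0"
  and tangent_lincomb: "v \<in> tangent_space A p \<Longrightarrow> u \<in> smooth_funs A \<Longrightarrow> w \<in> smooth_funs A \<Longrightarrow>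
    v (\<lambda>x. a * u x + b * w x) = a * v u + b * v w"
  and tangent_mult: "v \<in> tangent_space A p \<Longrightarrow> u \<in> smooth_funs A \<Longrightarrow> w \<in> smooth_funs A \<Longrightarrow>
    v (\<lambda>x. u x * w x) = u p * v w + w p * v u"
  by (auto simp: tangent_space_def)

text \<open>The product rule for \<open>1 * 1\<close> gives \<open>v 1 = 2 * v 1\<close>; linearity
  carries this over to the other constants.\<close>

lemma tangent_const: "v \<in> tangent_space A p \<Longrightarrow> v (\<lambda>x. c) = 0"
  using tangent_mult[OF _ smooth_const smooth_const, of v p 1 1]
    tangent_lincomb[OF _ smooth_const smooth_const, of v p c 1 0 1] by simp

lemma tangent_add: "v \<in> tangent_space A p \<Longrightarrow> u \<in> smooth_funs A \<Longrightarrow> w \<in> smooth_funs A \<Longrightarrow>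
    v (\<lambda>x. u x + w x) = v u + v w"
  using tangent_lincomb[of v p u w 1 1] by simp

lemma tangent_diff: "v \<in> tangent_space A p \<Longrightarrow> u \<in> smooth_funs A \<Longrightarrow> w \<in> smooth_funs A \<Longrightarrow>
    v (\<lambda>x. u x - w x) = v u - v w"
  using tangent_lincomb[of v p u w 1 "-1"] by simp

lemma tangent_sum_fun:
  assumes "v \<in> tangent_space A p" "\<And>i. i \<in> I \<Longrightarrow> u i \<in> smooth_funs A"
  shows "v (\<lambda>x. \<Sum>i\<in>I. u i x) = (\<Sum>i\<in>I. v (u i))"
  using assms(2)
  by (induction I rule: infinite_finite_induct)
    (auto simp: tangent_const[OF assms(1)] tangent_add[OF assms(1)] smooth_sum)

lemma tangent_space_add: "v \<in> tangent_space A p \<Longrightarrow> w \<in> tangent_space A p \<Longrightarrow> v + w \<in> tangent_space A p"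
  by (auto simp: tangent_space_def algebra_simps)

lemma tangent_space_scale: "v \<in> tangent_space A p \<Longrightarrow> c *\<^sub>T v \<in> tangent_space A p"
  by (auto simp: tangent_space_def tscale_def algebra_simps)

lemma tangent_space_zero: "0 \<in> tangent_space A p"
  by (auto simp: tangent_space_def)

lemma tangent_space_minus: "v \<in> tangent_space A p \<Longrightarrow> - v \<in> tangent_space A p"
  by (auto simp: tangent_space_def algebra_simps)

lemma tangent_space_diff: "v \<in> tangent_space A p \<Longrightarrow> w \<in> tangent_space A p \<Longrightarrow> v - w \<in> tangent_space A p"
  using tangent_space_add[OF _ tangent_space_minus, of v p w] by simp

lemma tangent_space_sum: "(\<And>i. i \<in> I \<Longrightarrow> v i \<in> tangent_space A p) \<Longrightarrow> (\<Sum>i\<in>I. v i) \<in> tangent_space A p"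
  by (induction I rule: infinite_finite_induct) (auto intro: tangent_space_zero tangent_space_add)

text \<open>By Hadamard's lemma, a cut-off smooth function is, up to a constant, a combination of the cut-off
  coordinates, which vanish at \<open>p\<close>; so a derivation at \<open>p\<close> is determined by its values on them.\<close>

lemma tangent_coordinates:
  obtains x :: "'e \<Rightarrow> 'm \<Rightarrow> real"
  where "\<And>b. x b \<in> smooth_funs A"
    "\<And>v. v \<in> tangent_space A p \<Longrightarrow> (\<And>b. b \<in> Basis \<Longrightarrow> v (x b) = 0) \<Longrightarrow> v = 0"
proof -
  obtain U \<phi> where ch: "(U, \<phi>) \<in> A" "p \<in> U" by (rule chart_at)
  let ?x0 = "\<phi> p"
  obtain R where R: "R > 0" "ball ?x0 R \<subseteq> \<phi> ` U"
    using chart(2)[OF ch(1)] ch(2) open_contains_ball by blast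
  define r where "r = R / 2"
  have r: "0 < r" "r < R" using R by (auto simp: r_def)
  have inv: "inv_into U \<phi> (\<phi> q) = q" if "q \<in> U" for q
    using chart(3)[OF ch(1)] that by (simp add: homeomorphism_def)
  define G where "G w q = (if q \<in> U then bump ?x0 r (\<phi> q) * w (\<phi> q) else 0)" for w q
  have G: "G w \<in> smooth_funs A" if "smooth_on w (ball ?x0 R)" for w
    unfolding G_def
    by (rule smooth_extend_zero[OF ch(1) R(2) r(2)])
      (use that r in \<open>auto simp: smooth_on_def bump_outside intro: Ck_on_mult Ck_on_subset[OF Ck_on_bump]\<close>)
  have Gp: "G w p = w ?x0" for w
    using ch(2) bump_center[OF r(1), of ?x0] by (simp add: G_def)
  define c where "c b y = (y - ?x0) \<bullet> b" for b y
  have c: "smooth_on (c b) (ball ?x0 R)" for b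
  proof -
    have "Ck_on k (\<lambda>y. y \<bullet> b + - (?x0 \<bullet> b)) (ball ?x0 R)" for k
      by (intro Ck_on_add Ck_on_const Ck_on_linear bounded_linear_inner_left open_ball)
    then show ?thesis by (simp add: smooth_on_def c_def[abs_def] inner_diff_left)
  qed
  have one: "smooth_on (\<lambda>y. 1 :: real) (ball ?x0 R)" by (simp add: smooth_on_def Ck_on_const)
  show thesis
  proof (rule that)
    show "G (c b) \<in> smooth_funs A" for b by (rule G[OF c])
    fix v assume v: "v \<in> tangent_space A p" and v0: "\<And>b. b \<in> Basis \<Longrightarrow> v (G (c b)) = 0"
    have "v u = 0" if u: "u \<in> smooth_funs A" for u
    proof -
      let ?w = "\<lambda>y. u (inv_into U \<phi> y)"
      have "smooth_on ?w (\<phi> ` U)" using u ch by (auto simp: smooth_funs_def o_def)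
      then have "smooth_on ?w (ball ?x0 R)" using R(2) by (auto simp: smooth_on_def intro: Ck_on_subset)
      then obtain h where h: "\<And>b. smooth_on (h b) (ball ?x0 R)"
        and eq: "\<And>y. y \<in> ball ?x0 R \<Longrightarrow> ?w y = ?w ?x0 + (\<Sum>b\<in>Basis. ((y - ?x0) \<bullet> b) * h b y)"
        by (rule hadamard) blast
      \<comment> \<open>The squared cut-off supplies one factor for \<open>c b\<close> and one for
        \<open>h b\<close>, so that both become global smooth functions. On the left
        \<open>v\<close> still yields \<open>v u\<close>, since the cut-off is 1 at \<open>p\<close>
        and \<open>u - u p\<close> vanishes there; on the right each \<open>G (c b)\<close> vanishes
        at \<open>p\<close> and is killed by \<open>v\<close>.\<close>
      let ?\<beta> = "G (\<lambda>y. 1)"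
      have "(\<lambda>q. (?\<beta> q * ?\<beta> q) * (u q - u p)) = (\<lambda>q. \<Sum>b\<in>Basis. G (c b) q * G (h b) q)"
      proof
        fix q
        show "(?\<beta> q * ?\<beta> q) * (u q - u p) = (\<Sum>b\<in>Basis. G (c b) q * G (h b) q)"
        proof (cases "q \<in> U \<and> \<phi> q \<in> ball ?x0 R")
          case True
          then have "u q - u p = (\<Sum>b\<in>Basis. c b (\<phi> q) * h b (\<phi> q))"
            using eq[of "\<phi> q"] inv ch(2) by (simp add: c_def)
          then show ?thesis
            using True by (simp add: G_def sum_distrib_left mult_ac)
        next
          case False
          then have "G w q = 0" for w using bump_outside[OF r(1), of "\<phi> q"] r(2)
            by (auto simp: G_def)
          then show ?thesis by simp
        qed
      qed
      then have "v (\<lambda>q. (?\<beta> q * ?\<beta> q) * (u q - u p)) = v (\<lambda>q. \<Sum>b\<in>Basis. G (c b) q * G (h b) q)"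
        by simp
      also have "\<dots> = (\<Sum>b\<in>Basis. v (\<lambda>q. G (c b) q * G (h b) q))"
        by (rule tangent_sum_fun[OF v smooth_mult[OF G[OF c] G[OF h]]])
      also have "\<dots> = 0"
        using tangent_mult[OF v G[OF c] G[OF h]] v0 by (simp add: Gp c_def)
      finally have "v (\<lambda>q. (?\<beta> q * ?\<beta> q) * (u q - u p)) = 0" .
      moreover have "v (\<lambda>q. (?\<beta> q * ?\<beta> q) * (u q - u p)) = v u"
        by (simp add: tangent_mult[OF v smooth_mult[OF G[OF one] G[OF one]] smooth_diff[OF u smooth_const]]
            tangent_diff[OF v u smooth_const] tangent_const[OF v] Gp)
      ultimately show ?thesis by simp
    qed
    then show "v = 0" using tangent_not_smooth[OF v] by (metis ext zero_fun_apply)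
  qed
qed

end

section \<open>Riemannian metrics and orthonormal bases\<close>

locale riemannian = manifold A for A :: "('m::{t2_space, second_countable_topology}, 'e::euclidean_space) atlas" +
  fixes g :: "'m \<Rightarrow> 'm tvec \<Rightarrow> 'm tvec \<Rightarrow> real"
  assumes metric: "riemannian_metric A g"
begin

lemma g_sym: "v \<in> tangent_space A p \<Longrightarrow> w \<in> tangent_space A p \<Longrightarrow> g p v w = g p w v"
  and g_pos: "v \<in> tangent_space A p \<Longrightarrow> v \<noteq> 0 \<Longrightarrow> g p v v > 0"
  and g_lincomb: "v \<in> tangent_space A p \<Longrightarrow> w \<in> tangent_space A p \<Longrightarrow> z \<in> tangent_space A p \<Longrightarrow>
    g p (a *\<^sub>T v + b *\<^sub>T w) z = a * g p v z + b * g p w z"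
  using metric by (auto simp: riemannian_metric_def)

lemma g_add_left: "v \<in> tangent_space A p \<Longrightarrow> w \<in> tangent_space A p \<Longrightarrow> z \<in> tangent_space A p \<Longrightarrow>
    g p (v + w) z = g p v z + g p w z"
  using g_lincomb[of v p w z 1 1] by (simp add: tscale_def)

lemma g_scale_left: "v \<in> tangent_space A p \<Longrightarrow> z \<in> tangent_space A p \<Longrightarrow> g p (a *\<^sub>T v) z = a * g p v z"
  using g_lincomb[of v p v z a 0] by (simp add: tscale_def plus_fun_def)

lemma g_minus_left: "v \<in> tangent_space A p \<Longrightarrow> z \<in> tangent_space A p \<Longrightarrow> g p (- v) z = - g p v z"
  using g_scale_left[of v p z "-1"] by (simp add: tscale_def fun_Compl_def)

lemma g_zero_left: "z \<in> tangent_space A p \<Longrightarrow> g p 0 z = 0"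
  using g_add_left[OF tangent_space_zero tangent_space_zero] by simp

lemma g_diff_left: "v \<in> tangent_space A p \<Longrightarrow> w \<in> tangent_space A p \<Longrightarrow> z \<in> tangent_space A p \<Longrightarrow>
    g p (v - w) z = g p v z - g p w z"
  using g_add_left[OF _ tangent_space_minus, of v p w z] by (simp add: g_minus_left)

lemma g_sum_left: "(\<And>i. i \<in> I \<Longrightarrow> v i \<in> tangent_space A p) \<Longrightarrow> z \<in> tangent_space A p \<Longrightarrow>
    g p (\<Sum>i\<in>I. v i) z = (\<Sum>i\<in>I. g p (v i) z)"
  by (induction I rule: infinite_finite_induct) (auto simp: g_zero_left g_add_left tangent_space_sum)

lemma g_right:
  assumes "v \<in> tangent_space A p" "z \<in> tangent_space A p"
  shows "w \<in> tangent_space A p \<Longrightarrow> g p z (v + w) = g p z v + g p z w"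
    "w \<in> tangent_space A p \<Longrightarrow> g p z (v - w) = g p z v - g p z w"
    "g p z (- v) = - g p z v" "g p z (a *\<^sub>T v) = a * g p z v"
  using assms g_sym[of z p]
  by (simp_all add: tangent_space_add tangent_space_diff tangent_space_minus tangent_space_scale
      g_add_left g_diff_left g_minus_left g_scale_left)

lemma g_zero_right: "z \<in> tangent_space A p \<Longrightarrow> g p z 0 = 0"
  using g_sym[OF _ tangent_space_zero] g_zero_left by simp

text \<open>The coordinates of \<open>tangent_coordinates\<close> embed the tangent space into \<open>'e\<close>, so an orthonormal
  system of \<open>DIM('e)\<close> vectors spans it.\<close>

lemma orthonormal_expansion:
  assumes e: "\<And>i. i \<in> {1..DIM('e)} \<Longrightarrow> e i \<in> tangent_space A p"
    and on: "\<And>i j. i \<in> {1..DIM('e)} \<Longrightarrow> j \<in> {1..DIM('e)} \<Longrightarrow> g p (e i) (e j) = (if i = j then 1 else 0)"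
    and v: "v \<in> tangent_space A p"
  shows "v = (\<Sum>i\<in>{1..DIM('e)}. g p v (e i) *\<^sub>T e i)"
proof -
  obtain x :: "'e \<Rightarrow> 'm \<Rightarrow> real" where
    x: "\<And>w. w \<in> tangent_space A p \<Longrightarrow> (\<And>b. b \<in> Basis \<Longrightarrow> w (x b) = 0) \<Longrightarrow> w = 0"
    by (rule tangent_coordinates[of p]) blast
  obtain \<beta> where \<beta>: "bij_betw \<beta> {1..DIM('e)} (Basis :: 'e set)"
    using finite_same_card_bij[of "{1..DIM('e)}" "Basis :: 'e set"] by auto
  have \<beta>B: "\<beta> i \<in> Basis" if "i \<in> {1..DIM('e)}" for i using \<beta> that bij_betwE by blast
  define \<Lambda> where "\<Lambda> w = (\<Sum>b\<in>Basis. w (x b) *\<^sub>R b)" for w :: "'m tvec"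
  define comb where "comb y = (\<Sum>i\<in>{1..DIM('e)}. (y \<bullet> \<beta> i) *\<^sub>T e i)" for y
  have comb_in: "comb y \<in> tangent_space A p" for y
    unfolding comb_def by (intro tangent_space_sum tangent_space_scale e)
  have comb_apply: "comb y u = (\<Sum>i\<in>{1..DIM('e)}. (y \<bullet> \<beta> i) * e i u)" for y u
  proof -
    have "(\<Sum>i\<in>I. (y \<bullet> \<beta> i) *\<^sub>T e i) u = (\<Sum>i\<in>I. (y \<bullet> \<beta> i) * e i u)" for I
      by (induction I rule: infinite_finite_induct) (auto simp: tscale_def)
    then show ?thesis by (simp add: comb_def)
  qed
  have \<Lambda>0: "w = 0" if "w \<in> tangent_space A p" "\<Lambda> w = 0" for w
  proof (rule x[OF that(1)])
    fix b :: 'e assume "b \<in> Basis"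
    then have "\<Lambda> w \<bullet> b = w (x b)" unfolding \<Lambda>_def by (rule inner_sum_left_Basis)
    then show "w (x b) = 0" using that(2) by simp
  qed
  have coeff: "g p (comb y) (e j) = y \<bullet> \<beta> j" if j: "j \<in> {1..DIM('e)}" for y j
  proof -
    have "g p (comb y) (e j) = (\<Sum>i\<in>{1..DIM('e)}. g p ((y \<bullet> \<beta> i) *\<^sub>T e i) (e j))"
      unfolding comb_def by (intro g_sum_left tangent_space_scale e j)
    also have "\<dots> = (\<Sum>i\<in>{1..DIM('e)}. if i = j then y \<bullet> \<beta> i else 0)"
      by (intro sum.cong refl) (simp add: g_scale_left[OF e e[OF j]] on[OF _ j] del: atLeastAtMost_iff)
    finally show ?thesis using j by simp
  qed
  have lin: "linear (\<lambda>y. \<Lambda> (comb y))"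
    by (rule linearI)
      (simp_all add: \<Lambda>_def comb_apply inner_add_left scaleR_left.sum algebra_simps
        sum.distrib sum_distrib_left scaleR_right.sum)
  \<comment> \<open>The composite is a linear endomorphism of \<open>'e\<close>, so injectivity
    makes it surjective. Hence \<open>\<Lambda> v\<close> is attained on some \<open>comb y\<close>,
    and \<open>\<Lambda>0\<close> identifies \<open>v\<close> with it.\<close>
  have "inj (\<lambda>y. \<Lambda> (comb y))"
  proof (subst linear_injective_0[OF lin], intro allI impI)
    fix y assume "\<Lambda> (comb y) = 0"
    then have "comb y = 0" using \<Lambda>0 comb_in by blast
    then have "y \<bullet> \<beta> j = 0" if "j \<in> {1..DIM('e)}" for j
      using coeff[OF that, of y] g_zero_left[OF e[OF that]] by simp
    then have "y \<bullet> b = 0" if "b \<in> Basis" for b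
      using \<beta> that unfolding bij_betw_def by (metis imageE)
    then show "y = 0" by (simp add: euclidean_eq_iff[of y 0])
  qed
  then have "surj (\<lambda>y. \<Lambda> (comb y))" using lin linear_injective_imp_surjective by blast
  then obtain y where y: "\<Lambda> v = \<Lambda> (comb y)" by (metis surjD)
  have "v - comb y = 0"
  proof (rule \<Lambda>0)
    show "v - comb y \<in> tangent_space A p" by (intro tangent_space_diff v comb_in)
    show "\<Lambda> (v - comb y) = 0"
      using y by (simp add: \<Lambda>_def scaleR_diff_left sum_subtractf)
  qed
  then have "v = comb y" by simp
  moreover have "comb y = (\<Sum>i\<in>{1..DIM('e)}. g p (comb y) (e i) *\<^sub>T e i)"
    by (subst comb_def) (rule sum.cong, auto simp: coeff)
  ultimately show ?thesis by simp
qed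

end

section \<open>Vector fields and curvature\<close>

text \<open>With the point as last argument, the Leibniz rules become equations between elements of
  the commutative ring of functions and can serve as rewrite rules.\<close>

definition der :: "'m vfield \<Rightarrow> ('m \<Rightarrow> real) \<Rightarrow> 'm \<Rightarrow> real" where
  "der X u = (\<lambda>p. X p u)"

lemma fscale_apply: "(h *\<^sub>F X) p = h p *\<^sub>T X p"
  by (simp add: fscale_def)

lemma tscale_apply: "(a *\<^sub>T v) u = a * v u"
  by (simp add: tscale_def)

lemma lie_bracket_der: "der (lie_bracket X Y) u = der X (der Y u) - der Y (der X u)"
  by (simp add: der_def lie_bracket_def fun_eq_iff)

lemma der_field_add: "der (X + Y) u = der X u + der Y u"
  and der_field_diff: "der (X - Y) u = der X u - der Y u"
  and der_field_minus: "der (- X) u = - der X u"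
  and der_fscale: "der (h *\<^sub>F X) u = h * der X u"
  by (simp_all add: der_def fun_eq_iff fscale_def tscale_def)

context manifold
begin

lemma smooth_fun_add [simp]: "u \<in> smooth_funs A \<Longrightarrow> w \<in> smooth_funs A \<Longrightarrow> u + w \<in> smooth_funs A"
  using smooth_add by (simp add: plus_fun_def)

lemma smooth_fun_diff [simp]: "u \<in> smooth_funs A \<Longrightarrow> w \<in> smooth_funs A \<Longrightarrow> u - w \<in> smooth_funs A"
  using smooth_diff by (simp add: fun_diff_def)

lemma smooth_fun_mult [simp]: "u \<in> smooth_funs A \<Longrightarrow> w \<in> smooth_funs A \<Longrightarrow> u * w \<in> smooth_funs A"
  using smooth_mult by (simp add: times_fun_def)

lemma smooth_fun_minus [simp]: "u \<in> smooth_funs A \<Longrightarrow> - u \<in> smooth_funs A"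
  using smooth_minus by (simp add: fun_Compl_def)

lemma smooth_fun_zero [simp]: "0 \<in> smooth_funs A"
  using smooth_const[of 0] by (simp add: zero_fun_def)

lemma smooth_fun_sum [simp]: "(\<And>i. i \<in> I \<Longrightarrow> u i \<in> smooth_funs A) \<Longrightarrow> (\<Sum>i\<in>I. u i) \<in> smooth_funs A"
  by (induction I rule: infinite_finite_induct) auto

lemma smooth_fun_const [simp]: "(\<lambda>_. c) \<in> smooth_funs A"
  by (rule smooth_const)

lemma vf_tangent: "X \<in> vfields A \<Longrightarrow> X p \<in> tangent_space A p"
  unfolding vfields_def by blast

lemma der_smooth [simp]: "X \<in> vfields A \<Longrightarrow> u \<in> smooth_funs A \<Longrightarrow> der X u \<in> smooth_funs A"
  unfolding vfields_def der_def by blast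

lemma vfieldsI:
  "(\<And>p. X p \<in> tangent_space A p) \<Longrightarrow> (\<And>u. u \<in> smooth_funs A \<Longrightarrow> der X u \<in> smooth_funs A) \<Longrightarrow> X \<in> vfields A"
  unfolding vfields_def der_def by blast

lemma vf_eqI:
  assumes "X \<in> vfields A" "Y \<in> vfields A" "\<And>u. u \<in> smooth_funs A \<Longrightarrow> der X u = der Y u"
  shows "X = Y"
proof (intro ext)
  fix p u
  show "X p u = Y p u"
  proof (cases "u \<in> smooth_funs A")
    case True
    then show ?thesis using fun_cong[OF assms(3)[OF True], of p] by (simp add: der_def)
  next
    case False
    show ?thesis
      using tangent_not_smooth[OF vf_tangent[OF assms(1)] False] tangent_not_smooth[OF vf_tangent[OF assms(2)] False]
      by simp
  qed
qed

lemma vf_add [simp]: "X \<in> vfields A \<Longrightarrow> Y \<in> vfields A \<Longrightarrow> X + Y \<in> vfields A"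
  by (rule vfieldsI) (auto intro: vf_tangent tangent_space_add simp: der_field_add)

lemma vf_diff [simp]: "X \<in> vfields A \<Longrightarrow> Y \<in> vfields A \<Longrightarrow> X - Y \<in> vfields A"
  by (rule vfieldsI) (auto intro: vf_tangent tangent_space_diff simp: der_field_diff)

lemma vf_minus [simp]: "X \<in> vfields A \<Longrightarrow> - X \<in> vfields A"
  by (rule vfieldsI) (auto intro: vf_tangent tangent_space_minus simp: der_field_minus)

lemma vf_fscale [simp]: "h \<in> smooth_funs A \<Longrightarrow> X \<in> vfields A \<Longrightarrow> h *\<^sub>F X \<in> vfields A"
  by (rule vfieldsI) (auto intro: vf_tangent tangent_space_scale simp: der_fscale fscale_apply)

lemma vf_zero [simp]: "0 \<in> vfields A"
  by (rule vfieldsI) (auto simp: tangent_space_zero der_def intro: smooth_const)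

lemma vf_sum [simp]: "(\<And>i. i \<in> I \<Longrightarrow> X i \<in> vfields A) \<Longrightarrow> (\<Sum>i\<in>I. X i) \<in> vfields A"
  by (induction I rule: infinite_finite_induct) auto

lemma der_add:
  "X \<in> vfields A \<Longrightarrow> u \<in> smooth_funs A \<Longrightarrow> w \<in> smooth_funs A \<Longrightarrow> der X (u + w) = der X u + der X w"
  using tangent_add[OF vf_tangent] by (simp add: der_def plus_fun_def)

lemma der_diff:
  "X \<in> vfields A \<Longrightarrow> u \<in> smooth_funs A \<Longrightarrow> w \<in> smooth_funs A \<Longrightarrow> der X (u - w) = der X u - der X w"
  using tangent_diff[OF vf_tangent] by (simp add: der_def fun_diff_def)

lemma der_const: "X \<in> vfields A \<Longrightarrow> der X (\<lambda>_. c) = 0"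
  using tangent_const[OF vf_tangent] by (simp add: der_def fun_eq_iff)

lemma der_zero: "X \<in> vfields A \<Longrightarrow> der X 0 = 0"
  using der_const[of X 0] by (simp add: zero_fun_def)

lemma der_minus:
  "X \<in> vfields A \<Longrightarrow> u \<in> smooth_funs A \<Longrightarrow> der X (- u) = - der X u"
  using der_diff[of X 0 u] by (simp add: der_zero)

lemma der_mult:
  "X \<in> vfields A \<Longrightarrow> u \<in> smooth_funs A \<Longrightarrow> w \<in> smooth_funs A \<Longrightarrow> der X (u * w) = u * der X w + w * der X u"
  using tangent_mult[OF vf_tangent] by (simp add: der_def times_fun_def plus_fun_def)

lemma der_sum:
  "X \<in> vfields A \<Longrightarrow> (\<And>i. i \<in> I \<Longrightarrow> u i \<in> smooth_funs A) \<Longrightarrow> der X (\<Sum>i\<in>I. u i) = (\<Sum>i\<in>I. der X (u i))"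
  by (induction I rule: infinite_finite_induct) (auto simp: der_zero der_add)

lemmas der_simps = der_field_add der_field_diff der_field_minus der_fscale der_add der_diff der_minus der_mult
  der_zero lie_bracket_der

lemma lie_bracket_vf [simp]:
  assumes X: "X \<in> vfields A" and Y: "Y \<in> vfields A"
  shows "lie_bracket X Y \<in> vfields A"
proof (rule vfieldsI)
  show "der (lie_bracket X Y) u \<in> smooth_funs A" if "u \<in> smooth_funs A" for u
    using that X Y by (simp add: lie_bracket_der)
  fix p
  have app: "lie_bracket X Y p u = der (lie_bracket X Y) u p" for u by (simp add: der_def)
  have "lie_bracket X Y p u = 0" if "u \<notin> smooth_funs A" for u
  proof -
    have "der X u = 0" "der Y u = 0"
      unfolding der_def zero_fun_def
      by (rule ext tangent_not_smooth[OF vf_tangent[OF X] that] tangent_not_smooth[OF vf_tangent[OF Y] that])+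
    then show ?thesis using X Y by (simp add: app lie_bracket_der der_zero)
  qed
  moreover have "lie_bracket X Y p (\<lambda>x. a * u x + b * w x)
      = a * lie_bracket X Y p u + b * lie_bracket X Y p w"
    if "u \<in> smooth_funs A" "w \<in> smooth_funs A" for u w a b
  proof -
    have "(\<lambda>x. a * u x + b * w x) = (\<lambda>_. a) * u + (\<lambda>_. b) * w" by (simp add: fun_eq_iff)
    then show ?thesis
      using that X Y by (simp add: app der_simps der_const algebra_simps)
  qed
  moreover have "lie_bracket X Y p (\<lambda>x. u x * w x) = u p * lie_bracket X Y p w + w p * lie_bracket X Y p u"
    if "u \<in> smooth_funs A" "w \<in> smooth_funs A" for u w
  proof -
    have "(\<lambda>x. u x * w x) = u * w" by (simp add: fun_eq_iff)
    then show ?thesis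
      using that X Y by (simp add: app der_simps algebra_simps)
  qed
  ultimately show "lie_bracket X Y p \<in> tangent_space A p"
    unfolding tangent_space_def by blast
qed

lemma lie_bracket_antisym: "lie_bracket Y X = - lie_bracket X Y"
  by (simp add: lie_bracket_def fun_eq_iff)

lemma lie_bracket_add_left:
  "X \<in> vfields A \<Longrightarrow> X' \<in> vfields A \<Longrightarrow> Y \<in> vfields A \<Longrightarrow>
    lie_bracket (X + X') Y = lie_bracket X Y + lie_bracket X' Y"
  by (rule vf_eqI) (simp_all add: der_simps)

lemma lie_bracket_fscale_left:
  "h \<in> smooth_funs A \<Longrightarrow> X \<in> vfields A \<Longrightarrow> Y \<in> vfields A \<Longrightarrow>
    lie_bracket (h *\<^sub>F X) Y = h *\<^sub>F lie_bracket X Y - der Y h *\<^sub>F X"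
  by (rule vf_eqI) (simp_all add: der_simps algebra_simps)

lemma jacobi:
  assumes "X \<in> vfields A" "Y \<in> vfields A" "Z \<in> vfields A"
  shows "lie_bracket X (lie_bracket Y Z) = lie_bracket (lie_bracket X Y) Z + lie_bracket Y (lie_bracket X Z)"
  by (rule vf_eqI) (simp_all add: der_simps assms)

end

context riemannian
begin

definition ip :: "'m vfield \<Rightarrow> 'm vfield \<Rightarrow> 'm \<Rightarrow> real" where
  "ip X Y = (\<lambda>p. g p (X p) (Y p))"

lemma ip_smooth [simp]: "X \<in> vfields A \<Longrightarrow> Y \<in> vfields A \<Longrightarrow> ip X Y \<in> smooth_funs A"
  using metric unfolding riemannian_metric_def ip_def by blast

lemma ip_sym: "X \<in> vfields A \<Longrightarrow> Y \<in> vfields A \<Longrightarrow> ip X Y = ip Y X"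
  by (simp add: ip_def g_sym vf_tangent)

lemma ip_left:
  assumes "X \<in> vfields A" "Z \<in> vfields A"
  shows "Y \<in> vfields A \<Longrightarrow> ip (X + Y) Z = ip X Z + ip Y Z"
    "Y \<in> vfields A \<Longrightarrow> ip (X - Y) Z = ip X Z - ip Y Z"
    "ip (- X) Z = - ip X Z" "ip (h *\<^sub>F X) Z = h * ip X Z"
  using assms
  by (simp_all add: ip_def fun_eq_iff g_add_left g_diff_left g_minus_left fscale_apply
      g_scale_left vf_tangent)

lemma ip_right:
  assumes "X \<in> vfields A" "Z \<in> vfields A"
  shows "Y \<in> vfields A \<Longrightarrow> ip Z (X + Y) = ip Z X + ip Z Y"
    "Y \<in> vfields A \<Longrightarrow> ip Z (X - Y) = ip Z X - ip Z Y"
    "ip Z (- X) = - ip Z X" "ip Z (h *\<^sub>F X) = h * ip Z X"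
  using assms
  by (simp_all add: ip_def fun_eq_iff g_right fscale_apply vf_tangent)

lemma ip_zero: "X \<in> vfields A \<Longrightarrow> ip 0 X = 0" "X \<in> vfields A \<Longrightarrow> ip X 0 = 0"
  by (simp_all add: ip_def fun_eq_iff g_zero_left g_zero_right vf_tangent)

lemma ip_sum_left:
  "(\<And>i. i \<in> I \<Longrightarrow> X i \<in> vfields A) \<Longrightarrow> Z \<in> vfields A \<Longrightarrow> ip (\<Sum>i\<in>I. X i) Z = (\<Sum>i\<in>I. ip (X i) Z)"
  by (induction I rule: infinite_finite_induct) (auto simp: ip_left ip_zero)

lemma ip_sum_right:
  "(\<And>i. i \<in> I \<Longrightarrow> X i \<in> vfields A) \<Longrightarrow> Z \<in> vfields A \<Longrightarrow> ip Z (\<Sum>i\<in>I. X i) = (\<Sum>i\<in>I. ip Z (X i))"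
  by (induction I rule: infinite_finite_induct) (auto simp: ip_right ip_zero)

lemmas ip_simps = ip_left ip_right ip_zero

lemma ip_nonneg: "X \<in> vfields A \<Longrightarrow> 0 \<le> ip X X p"
  using g_pos[OF vf_tangent, of X p] g_zero_left[OF tangent_space_zero, of p]
  by (cases "X p = 0") (auto simp: ip_def intro: less_imp_le)

lemma ip_self_eq_0:
  assumes "X \<in> vfields A" "ip X X p = 0"
  shows "X p = 0"
  using g_pos[OF vf_tangent[OF assms(1)], of p] assms(2) by (force simp: ip_def)

lemma ip_at_zero:
  assumes "X p = 0" "Y \<in> vfields A"
  shows "ip X Y p = 0"
  using assms by (simp add: ip_def g_zero_left vf_tangent)

lemma ip_eqI:
  assumes "X \<in> vfields A" "Y \<in> vfields A" "\<And>Z. Z \<in> vfields A \<Longrightarrow> ip X Z = ip Y Z"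
  shows "X = Y"
proof
  fix p
  have "ip (X - Y) (X - Y) p = 0" using assms(3)[of "X - Y"] assms(1,2) by (simp add: ip_left)
  then have "(X - Y) p = 0" using ip_self_eq_0[of "X - Y" p] assms(1,2) by simp
  then show "X p = Y p" by simp
qed

end

section \<open>The Levi-Civita connection and the symmetries of its curvature\<close>

locale levi_civita_connection = riemannian A g
  for A :: "('m::{t2_space, second_countable_topology}, 'e::euclidean_space) atlas" and g +
  fixes D :: "'m conn"
  assumes levi_civita: "levi_civita A g D"
begin

lemma D_vf [simp]: "X \<in> vfields A \<Longrightarrow> Y \<in> vfields A \<Longrightarrow> D X Y \<in> vfields A"
  and D_add_left: "X \<in> vfields A \<Longrightarrow> X' \<in> vfields A \<Longrightarrow> Y \<in> vfields A \<Longrightarrow> D (X + X') Y = D X Y + D X' Y"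
  and D_fscale_left: "h \<in> smooth_funs A \<Longrightarrow> X \<in> vfields A \<Longrightarrow> Y \<in> vfields A \<Longrightarrow> D (h *\<^sub>F X) Y = h *\<^sub>F D X Y"
  and D_add_right: "X \<in> vfields A \<Longrightarrow> Y \<in> vfields A \<Longrightarrow> Y' \<in> vfields A \<Longrightarrow> D X (Y + Y') = D X Y + D X Y'"
  and D_fscale_right: "h \<in> smooth_funs A \<Longrightarrow> X \<in> vfields A \<Longrightarrow> Y \<in> vfields A \<Longrightarrow>
    D X (h *\<^sub>F Y) = h *\<^sub>F D X Y + der X h *\<^sub>F Y"
  using levi_civita by (auto simp: levi_civita_def affine_connection_def der_def)

lemma torsion_free: "X \<in> vfields A \<Longrightarrow> Y \<in> vfields A \<Longrightarrow> lie_bracket X Y = D X Y - D Y X"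
  using levi_civita by (simp add: levi_civita_def)

lemma metric_compatible:
  "X \<in> vfields A \<Longrightarrow> Y \<in> vfields A \<Longrightarrow> Z \<in> vfields A \<Longrightarrow> der X (ip Y Z) = ip (D X Y) Z + ip Y (D X Z)"
  using levi_civita by (simp add: levi_civita_def der_def ip_def fun_eq_iff)

lemma D_zero_right: "X \<in> vfields A \<Longrightarrow> D X 0 = 0"
  using D_add_right[of X 0 0] by simp

lemma D_zero_left: "X \<in> vfields A \<Longrightarrow> D 0 X = 0"
  using D_add_left[of 0 0 X] by simp

lemma D_minus_right: "X \<in> vfields A \<Longrightarrow> Y \<in> vfields A \<Longrightarrow> D X (- Y) = - D X Y"
  using D_add_right[of X Y "- Y"] by (simp add: D_zero_right eq_neg_iff_add_eq_0 add.commute)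

lemma D_minus_left: "X \<in> vfields A \<Longrightarrow> Y \<in> vfields A \<Longrightarrow> D (- X) Y = - D X Y"
  using D_add_left[of X "- X" Y] by (simp add: D_zero_left eq_neg_iff_add_eq_0 add.commute)

lemma D_diff_right: "X \<in> vfields A \<Longrightarrow> Y \<in> vfields A \<Longrightarrow> Z \<in> vfields A \<Longrightarrow> D X (Y - Z) = D X Y - D X Z"
  using D_add_right[of X Y "- Z"] by (simp add: D_minus_right)

lemma D_diff_left: "X \<in> vfields A \<Longrightarrow> Y \<in> vfields A \<Longrightarrow> Z \<in> vfields A \<Longrightarrow> D (X - Y) Z = D X Z - D Y Z"
  using D_add_left[of X "- Y" Z] by (simp add: D_minus_left)

lemmas D_simps = D_add_left D_add_right D_diff_left D_diff_right D_minus_left D_minus_right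
  D_fscale_left D_fscale_right D_zero_right D_zero_left

lemma curvature_vf [simp]:
  "X \<in> vfields A \<Longrightarrow> Y \<in> vfields A \<Longrightarrow> Z \<in> vfields A \<Longrightarrow> curvature D X Y Z \<in> vfields A"
  by (simp add: curvature_def)

definition Rm :: "'m vfield \<Rightarrow> 'm vfield \<Rightarrow> 'm vfield \<Rightarrow> 'm vfield \<Rightarrow> 'm \<Rightarrow> real" where
  "Rm X Y Z W = ip (curvature D X Y Z) W"

lemma curvature_antisym:
  "X \<in> vfields A \<Longrightarrow> Y \<in> vfields A \<Longrightarrow> Z \<in> vfields A \<Longrightarrow> curvature D Y X Z = - curvature D X Y Z"
  by (simp add: curvature_def lie_bracket_antisym[of Y X] D_minus_left)

lemma Rm_antisym12:
  "X \<in> vfields A \<Longrightarrow> Y \<in> vfields A \<Longrightarrow> Z \<in> vfields A \<Longrightarrow> W \<in> vfields A \<Longrightarrow> Rm Y X Z W = - Rm X Y Z W"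
  by (simp add: Rm_def curvature_antisym[of X Y] ip_simps)

text \<open>Metric compatibility is applied twice to \<open>ip Z W\<close>; the mixed first-order
  terms are symmetric in \<open>X\<close> and \<open>Y\<close> and drop out of the
  commutator.\<close>

lemma Rm_antisym34:
  assumes "X \<in> vfields A" "Y \<in> vfields A" "Z \<in> vfields A" "W \<in> vfields A"
  shows "Rm X Y W Z = - Rm X Y Z W"
proof -
  have "der (lie_bracket X Y) (ip Z W) = der X (der Y (ip Z W)) - der Y (der X (ip Z W))"
    by (rule lie_bracket_der)
  then have "Rm X Y Z W + ip Z (curvature D X Y W) = 0"
    using assms by (simp add: metric_compatible der_add Rm_def curvature_def ip_simps algebra_simps)
  then show ?thesis
    using assms ip_sym[of Z "curvature D X Y W"] by (simp add: Rm_def eq_neg_iff_add_eq_0 add.commute)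
qed

text \<open>Vanishing torsion expresses the brackets by covariant derivatives, which turns the
  Jacobi identity into the first Bianchi identity.\<close>

lemma bianchi:
  assumes "X \<in> vfields A" "Y \<in> vfields A" "Z \<in> vfields A"
  shows "curvature D X Y Z + curvature D Y Z X + curvature D Z X Y = 0"
proof -
  let ?b = lie_bracket
  have b: "?b X (?b Y Z) = D X (D Y Z) - D X (D Z Y) - D (?b Y Z) X"
    "?b Y (?b X Z) = D Y (D X Z) - D Y (D Z X) - D (?b X Z) Y"
    "?b (?b X Y) Z = D (?b X Y) Z - (D Z (D X Y) - D Z (D Y X))"
    using assms by (simp_all add: torsion_free D_diff_right)
  from jacobi[OF assms, unfolded b]
  have "D X (D Y Z) - D X (D Z Y) - D (?b Y Z) X
      = D (?b X Y) Z - (D Z (D X Y) - D Z (D Y X)) + (D Y (D X Z) - D Y (D Z X) - D (?b X Z) Y)" .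
  moreover have "D (?b Z X) Y = - D (?b X Z) Y"
    using assms by (simp add: lie_bracket_antisym[of Z X] D_minus_left)
  ultimately show ?thesis by (simp add: curvature_def algebra_simps)
qed

lemma Rm_bianchi:
  assumes "X \<in> vfields A" "Y \<in> vfields A" "Z \<in> vfields A" "W \<in> vfields A"
  shows "Rm X Y Z W + Rm Y Z X W + Rm Z X Y W = 0"
proof -
  have "ip (curvature D X Y Z + curvature D Y Z X + curvature D Z X Y) W = 0"
    unfolding bianchi[OF assms(1-3)] by (rule ip_zero(1)[OF assms(4)])
  then show ?thesis using assms by (simp add: ip_simps Rm_def)
qed

text \<open>A linear combination of the Bianchi identities for the four cyclic rotations of the
  arguments, after the two antisymmetries have identified their terms.\<close>

lemma Rm_pair_sym:
  assumes "X \<in> vfields A" "Y \<in> vfields A" "Z \<in> vfields A" "W \<in> vfields A"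
  shows "Rm X Y Z W = Rm Z W X Y"
proof
  fix p
  define q where "q X Y Z W = Rm X Y Z W p" for X Y Z W
  have s: "q Y X Z W = - q X Y Z W" "q X Y W Z = - q X Y Z W"
    and b: "q X Y Z W + q Y Z X W + q Z X Y W = 0"
    if "X \<in> vfields A" "Y \<in> vfields A" "Z \<in> vfields A" "W \<in> vfields A" for X Y Z W
    using fun_cong[OF Rm_antisym12[OF that], of p] fun_cong[OF Rm_antisym34[OF that], of p]
      fun_cong[OF Rm_bianchi[OF that], of p]
    by (simp_all add: q_def)
  have "q X Y Z W = q Z W X Y"
    using b[OF assms(1,2,3,4)] b[OF assms(2,3,4,1)]
      b[OF assms(3,4,1,2)] b[OF assms(4,1,2,3)]
      s[OF assms(1,2,3,4)] s[OF assms(2,3,1,4)] s[OF assms(3,1,2,4)]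
      s[OF assms(2,3,4,1)] s[OF assms(3,4,2,1)] s[OF assms(4,2,3,1)]
      s[OF assms(3,4,1,2)] s[OF assms(4,1,3,2)] s[OF assms(1,3,4,2)]
      s[OF assms(4,1,2,3)] s[OF assms(1,2,4,3)] s[OF assms(2,4,1,3)]
      s[OF assms(3,1,4,2)] s[OF assms(1,3,2,4)] s[OF assms(2,4,3,1)]
      s[OF assms(4,2,1,3)]
    by linarith
  then show "Rm X Y Z W p = Rm Z W X Y p" by (simp add: q_def)
qed

text \<open>Only the first and the last slot are expanded from the definition; the second and the
  third are carried back to the first by antisymmetry and pair symmetry.\<close>

lemma Rm_add1:
  assumes "X \<in> vfields A" "X' \<in> vfields A" "Y \<in> vfields A" "Z \<in> vfields A" "W \<in> vfields A"
  shows "Rm (X + X') Y Z W = Rm X Y Z W + Rm X' Y Z W"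
  using assms by (simp add: Rm_def curvature_def lie_bracket_add_left D_simps ip_simps)

lemma Rm_fscale1:
  assumes "h \<in> smooth_funs A" "X \<in> vfields A" "Y \<in> vfields A" "Z \<in> vfields A" "W \<in> vfields A"
  shows "Rm (h *\<^sub>F X) Y Z W = h * Rm X Y Z W"
  using assms by (simp add: Rm_def curvature_def lie_bracket_fscale_left D_simps ip_simps algebra_simps)

lemma Rm_add2:
  assumes "X \<in> vfields A" "Y \<in> vfields A" "Y' \<in> vfields A" "Z \<in> vfields A" "W \<in> vfields A"
  shows "Rm X (Y + Y') Z W = Rm X Y Z W + Rm X Y' Z W"
  using assms Rm_add1[of Y Y' X Z W] by (simp add: Rm_antisym12[of Y X] Rm_antisym12[of Y' X] Rm_antisym12[of "Y + Y'" X])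

lemma Rm_fscale2:
  assumes "h \<in> smooth_funs A" "X \<in> vfields A" "Y \<in> vfields A" "Z \<in> vfields A" "W \<in> vfields A"
  shows "Rm X (h *\<^sub>F Y) Z W = h * Rm X Y Z W"
  using assms Rm_fscale1[of h Y X Z W] by (simp add: Rm_antisym12[of Y X] Rm_antisym12[of "h *\<^sub>F Y" X])

lemma Rm_add3:
  assumes "X \<in> vfields A" "Y \<in> vfields A" "Z \<in> vfields A" "Z' \<in> vfields A" "W \<in> vfields A"
  shows "Rm X Y (Z + Z') W = Rm X Y Z W + Rm X Y Z' W"
  using assms Rm_add1[of Z Z' W X Y] by (simp add: Rm_pair_sym[of X Y])

lemma Rm_fscale3:
  assumes "h \<in> smooth_funs A" "X \<in> vfields A" "Y \<in> vfields A" "Z \<in> vfields A" "W \<in> vfields A"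
  shows "Rm X Y (h *\<^sub>F Z) W = h * Rm X Y Z W"
  using assms Rm_fscale1[of h Z W X Y] by (simp add: Rm_pair_sym[of X Y])

lemma Rm_add4:
  assumes "X \<in> vfields A" "Y \<in> vfields A" "Z \<in> vfields A" "W \<in> vfields A" "W' \<in> vfields A"
  shows "Rm X Y Z (W + W') = Rm X Y Z W + Rm X Y Z W'"
  using assms by (simp add: Rm_def ip_simps)

lemma Rm_fscale4:
  assumes "h \<in> smooth_funs A" "X \<in> vfields A" "Y \<in> vfields A" "Z \<in> vfields A" "W \<in> vfields A"
  shows "Rm X Y Z (h *\<^sub>F W) = h * Rm X Y Z W"
  using assms by (simp add: Rm_def ip_simps)

lemmas Rm_simps = Rm_add1 Rm_add2 Rm_add3 Rm_add4 Rm_fscale1 Rm_fscale2 Rm_fscale3 Rm_fscale4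

end

section \<open>S-structures\<close>

lemma sum_fun_at: "(\<Sum>i\<in>I. h i) x = (\<Sum>i\<in>I. h i x)"
  by (induction I rule: infinite_finite_induct) auto

context levi_civita_connection
begin

lemma D_sum_right:
  "X \<in> vfields A \<Longrightarrow> (\<And>i. i \<in> I \<Longrightarrow> Y i \<in> vfields A) \<Longrightarrow> D X (\<Sum>i\<in>I. Y i) = (\<Sum>i\<in>I. D X (Y i))"
  by (induction I rule: infinite_finite_induct) (auto simp: D_zero_right D_add_right)

end

locale S_manifold_connection = levi_civita_connection A g D
  for A :: "('m::{t2_space, second_countable_topology}, 'e::euclidean_space) atlas" and g D +
  fixes n s :: nat
    and f :: "'m \<Rightarrow> 'm tvec \<Rightarrow> 'm tvec"
    and \<xi> :: "nat \<Rightarrow> 'm vfield"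
    and \<eta> :: "nat \<Rightarrow> 'm \<Rightarrow> 'm tvec \<Rightarrow> real"
  assumes S_manifold: "S_manifold A n s f \<xi> \<eta> g"
begin

lemma metric_f: "metric_f_manifold A n s f \<xi> \<eta> g"
  using S_manifold by (simp add: S_manifold_def)

lemma s_pos: "s \<ge> 1" and dimension: "DIM('e) = 2 * n + s"
  using metric_f by (simp_all add: metric_f_manifold_def)

lemma tensor_f: "tensor11 A f"
  using metric_f by (simp add: metric_f_manifold_def)

text \<open>A constant of its own, because the simplifier would rewrite membership in \<open>{1..s}\<close>.\<close>

definition Ix :: "nat set" where
  "Ix = {1..s}"

lemma finite_Ix [simp]: "finite Ix"
  by (simp add: Ix_def)

lemma card_Ix: "card Ix = s"
  by (simp add: Ix_def)

lemma xi_vf [simp]: "\<alpha> \<in> Ix \<Longrightarrow> \<xi> \<alpha> \<in> vfields A"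
  using metric_f by (simp add: metric_f_manifold_def Ix_def)

definition F :: "'m vfield \<Rightarrow> 'm vfield" where
  "F = apply_field f"

lemma F_apply: "F X p = f p (X p)"
  by (simp add: F_def apply_field_def)

lemma F_vf [simp]: "X \<in> vfields A \<Longrightarrow> F X \<in> vfields A"
  using tensor_f unfolding tensor11_def F_def apply_field_def by blast

lemma f_lincomb: "v \<in> tangent_space A p \<Longrightarrow> w \<in> tangent_space A p \<Longrightarrow>
    f p (a *\<^sub>T v + b *\<^sub>T w) = a *\<^sub>T f p v + b *\<^sub>T f p w"
  using tensor_f unfolding tensor11_def by blast

lemma F_add: "X \<in> vfields A \<Longrightarrow> Y \<in> vfields A \<Longrightarrow> F (X + Y) = F X + F Y"
  using f_lincomb[OF vf_tangent vf_tangent, of X Y _ 1 1] by (simp add: F_apply tscale_def fun_eq_iff plus_fun_def)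

lemma F_fscale: "X \<in> vfields A \<Longrightarrow> F (h *\<^sub>F X) = h *\<^sub>F F X"
proof
  fix p assume "X \<in> vfields A"
  then show "F (h *\<^sub>F X) p = (h *\<^sub>F F X) p"
    using f_lincomb[OF vf_tangent vf_tangent, of X X p "h p" 0]
    by (simp add: F_apply fscale_apply tscale_def plus_fun_def)
qed

lemma F_minus: "X \<in> vfields A \<Longrightarrow> F (- X) = - F X"
proof -
  assume "X \<in> vfields A"
  moreover have "(\<lambda>_. - 1) *\<^sub>F Y = - Y" for Y :: "'m vfield"
    by (simp add: fscale_def tscale_def fun_eq_iff)
  ultimately show ?thesis using F_fscale[of X "\<lambda>_. - 1"] by simp
qed

lemma F_diff: "X \<in> vfields A \<Longrightarrow> Y \<in> vfields A \<Longrightarrow> F (X - Y) = F X - F Y"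
  using F_add[of X "- Y"] by (simp add: F_minus)

lemmas F_simps = F_add F_diff F_minus F_fscale

lemma eta_eq: "\<alpha> \<in> Ix \<Longrightarrow> X \<in> vfields A \<Longrightarrow> \<eta> \<alpha> p (X p) = ip X (\<xi> \<alpha>) p"
  using metric_f vf_tangent[of X p] unfolding metric_f_manifold_def ip_def Ix_def by blast

lemma F_F:
  assumes "X \<in> vfields A"
  shows "F (F X) = - X + (\<Sum>\<alpha>\<in>Ix. ip X (\<xi> \<alpha>) *\<^sub>F \<xi> \<alpha>)"
proof
  fix p
  have "f p (f p (X p)) = - X p + (\<Sum>\<alpha>\<in>Ix. \<eta> \<alpha> p (X p) *\<^sub>T \<xi> \<alpha> p)"
    using metric_f vf_tangent[OF assms, of p] unfolding metric_f_manifold_def Ix_def by blast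
  then show "F (F X) p = (- X + (\<Sum>\<alpha>\<in>Ix. ip X (\<xi> \<alpha>) *\<^sub>F \<xi> \<alpha>)) p"
    by (simp add: F_apply sum_fun_at[of _ _ p] fscale_apply eta_eq assms)
qed

lemma ip_xi_xi:
  assumes "\<alpha> \<in> Ix" "\<beta> \<in> Ix"
  shows "ip (\<xi> \<beta>) (\<xi> \<alpha>) = (\<lambda>_. if \<alpha> = \<beta> then 1 else 0)"
proof
  fix p
  have "\<eta> \<alpha> p (\<xi> \<beta> p) = (if \<alpha> = \<beta> then 1 else 0)"
    using metric_f assms unfolding metric_f_manifold_def Ix_def by blast
  then show "ip (\<xi> \<beta>) (\<xi> \<alpha>) p = (if \<alpha> = \<beta> then 1 else 0)"
    using eta_eq[of \<alpha> "\<xi> \<beta>" p] assms by simp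
qed

lemma F_xi: "\<alpha> \<in> Ix \<Longrightarrow> F (\<xi> \<alpha>) = 0"
  using metric_f unfolding metric_f_manifold_def Ix_def by (auto simp: F_apply fun_eq_iff)

lemma ip_F_xi:
  assumes "\<alpha> \<in> Ix" "X \<in> vfields A"
  shows "ip (F X) (\<xi> \<alpha>) = 0"
proof
  fix p
  have "\<eta> \<alpha> p (f p (X p)) = 0"
    using metric_f assms vf_tangent[OF assms(2), of p] unfolding metric_f_manifold_def Ix_def by blast
  then show "ip (F X) (\<xi> \<alpha>) p = 0 p"
    using eta_eq[OF assms(1) F_vf[OF assms(2)], of p] by (simp add: F_apply)
qed

lemma ip_F_F:
  assumes "X \<in> vfields A" "Y \<in> vfields A"
  shows "ip (F X) (F Y) = ip X Y - (\<Sum>\<alpha>\<in>Ix. ip X (\<xi> \<alpha>) * ip Y (\<xi> \<alpha>))"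
proof
  fix p
  have "g p (f p (X p)) (f p (Y p)) = g p (X p) (Y p) - (\<Sum>\<alpha>\<in>Ix. \<eta> \<alpha> p (X p) * \<eta> \<alpha> p (Y p))"
    using metric_f vf_tangent[OF assms(1), of p] vf_tangent[OF assms(2), of p]
    unfolding metric_f_manifold_def Ix_def by blast
  then show "ip (F X) (F Y) p = (ip X Y - (\<Sum>\<alpha>\<in>Ix. ip X (\<xi> \<alpha>) * ip Y (\<xi> \<alpha>))) p"
    by (simp add: sum_fun_at eta_eq assms) (simp add: ip_def F_apply)
qed

lemma ip_F_right:
  assumes "X \<in> vfields A" "Y \<in> vfields A"
  shows "ip X (F Y) = - ip (F X) Y"
proof
  fix p
  have "g p (X p) (f p (Y p)) = - g p (f p (X p)) (Y p)"
    using metric_f vf_tangent[OF assms(1), of p] vf_tangent[OF assms(2), of p]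
    unfolding metric_f_manifold_def Ix_def by blast
  then show "ip X (F Y) p = (- ip (F X) Y) p" by (simp add: ip_def F_apply)
qed

lemma ext_deriv_eq:
  assumes "\<alpha> \<in> Ix" "X \<in> vfields A" "Y \<in> vfields A"
  shows "ext_deriv (\<eta> \<alpha>) X Y = ip X (F Y)"
proof -
  have "fundamental_form f g X Y = ext_deriv (\<eta> \<alpha>) X Y"
    using S_manifold assms unfolding S_manifold_def Ix_def by blast
  then show ?thesis by (simp add: fundamental_form_def ip_def F_apply)
qed

lemma d_eta:
  assumes "\<alpha> \<in> Ix" "X \<in> vfields A" "Y \<in> vfields A"
  shows "der X (ip Y (\<xi> \<alpha>)) - der Y (ip X (\<xi> \<alpha>)) - ip (lie_bracket X Y) (\<xi> \<alpha>) = ip X (F Y) + ip X (F Y)"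
proof
  fix p
  have e: "(\<lambda>q. \<eta> \<alpha> q (Z q)) = ip Z (\<xi> \<alpha>)" if "Z \<in> vfields A" for Z
    using eta_eq[OF assms(1) that] by auto
  show "(der X (ip Y (\<xi> \<alpha>)) - der Y (ip X (\<xi> \<alpha>)) - ip (lie_bracket X Y) (\<xi> \<alpha>)) p = (ip X (F Y) + ip X (F Y)) p"
    using fun_cong[OF ext_deriv_eq[OF assms], of p] assms
    by (simp add: ext_deriv_def e eta_eq der_def)
qed

lemma normality:
  assumes "X \<in> vfields A" "Y \<in> vfields A"
  shows "F (F (lie_bracket X Y)) + lie_bracket (F X) (F Y) - F (lie_bracket (F X) Y) - F (lie_bracket X (F Y))
    + (\<Sum>\<alpha>\<in>Ix. (ip X (F Y) + ip X (F Y)) *\<^sub>F \<xi> \<alpha>) = 0"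
proof -
  have "nijenhuis f X Y + (\<Sum>\<alpha>\<in>Ix. (\<lambda>p. 2 * ext_deriv (\<eta> \<alpha>) X Y p) *\<^sub>F \<xi> \<alpha>) = 0"
    using S_manifold assms unfolding S_manifold_def normal_structure_def Ix_def by blast
  moreover have "(\<Sum>\<alpha>\<in>Ix. (\<lambda>p. 2 * ext_deriv (\<eta> \<alpha>) X Y p) *\<^sub>F \<xi> \<alpha>)
      = (\<Sum>\<alpha>\<in>Ix. (ip X (F Y) + ip X (F Y)) *\<^sub>F \<xi> \<alpha>)"
    by (rule sum.cong) (simp_all add: ext_deriv_eq assms plus_fun_def)
  ultimately show ?thesis by (simp add: nijenhuis_def F_def)
qed

subsection \<open>The structure vector fields are Killing\<close>

lemma der_xi_eta:
  assumes "\<alpha> \<in> Ix" "\<beta> \<in> Ix" "Y \<in> vfields A"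
  shows "der (\<xi> \<beta>) (ip Y (\<xi> \<alpha>)) = ip (lie_bracket (\<xi> \<beta>) Y) (\<xi> \<alpha>)"
proof -
  have "ip (\<xi> \<beta>) (F Y) = 0"
    using assms by (simp add: ip_F_right F_xi ip_zero)
  then show ?thesis
    using d_eta[OF assms(1) xi_vf[OF assms(2)] assms(3)] assms
    by (simp add: ip_xi_xi der_const)
qed

text \<open>Normality with a structure field as first argument shows that \<open>F\<close> kills the
  difference \<open>?W\<close> of both sides. By \<open>der_xi_eta\<close> this difference has no
  component along the structure fields, and a field with both properties is 0.\<close>

lemma lie_xi_F:
  assumes "\<beta> \<in> Ix" "Y \<in> vfields A"
  shows "lie_bracket (\<xi> \<beta>) (F Y) = F (lie_bracket (\<xi> \<beta>) Y)"
proof -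
  let ?W = "lie_bracket (\<xi> \<beta>) (F Y) - F (lie_bracket (\<xi> \<beta>) Y)"
  have W: "?W \<in> vfields A" using assms by simp
  have zero: "lie_bracket 0 Z = 0" if "Z \<in> vfields A" for Z :: "'m vfield"
    using lie_bracket_add_left[of 0 0 Z] that by simp
  have "ip (\<xi> \<beta>) (F Y) = 0"
    using assms by (simp add: ip_F_right F_xi ip_zero)
  then have "F (F (lie_bracket (\<xi> \<beta>) Y)) - F (lie_bracket (\<xi> \<beta>) (F Y)) = 0"
    using normality[OF xi_vf[OF assms(1)] assms(2)] assms F_diff[of 0 0]
    by (simp add: F_xi zero fscale_def tscale_def zero_fun_def[symmetric])
  then have "F ?W = 0" using assms by (simp add: F_diff)
  moreover have "ip ?W (\<xi> \<alpha>) = 0" if "\<alpha> \<in> Ix" for \<alpha>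
  proof -
    have "ip (lie_bracket (\<xi> \<beta>) (F Y)) (\<xi> \<alpha>) = 0"
      using der_xi_eta[OF that assms(1) F_vf[OF assms(2)]] that assms by (simp add: ip_F_xi der_zero)
    then show ?thesis using that assms by (simp add: ip_simps ip_F_xi)
  qed
  ultimately have "ip (F ?W) (F Z) = ip ?W Z" "F ?W = 0" if "Z \<in> vfields A" for Z
    unfolding ip_F_F[OF W that] by simp_all
  then have "ip ?W Z = ip 0 Z" if "Z \<in> vfields A" for Z
    using that by (metis F_vf ip_zero(1))
  then have "?W = 0" using W ip_eqI vf_zero by blast
  then show ?thesis by simp
qed

text \<open>The 2-form in question is the exterior derivative of \<open>\<eta> \<beta>\<close>,
  which is invariant under \<open>\<xi> \<beta>\<close> by \<open>der_xi_eta\<close>. The Lie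
  derivative commutes with the exterior derivative; for 1-forms this is the Jacobi identity.\<close>

lemma lie_xi_Phi:
  assumes b: "\<beta> \<in> Ix" and X: "X \<in> vfields A" and Y: "Y \<in> vfields A"
  shows "der (\<xi> \<beta>) (ip X (F Y)) = ip (lie_bracket (\<xi> \<beta>) X) (F Y) + ip X (F (lie_bracket (\<xi> \<beta>) Y))"
proof
  fix p
  let ?b = lie_bracket and ?x = "\<xi> \<beta>"
  have x: "?x \<in> vfields A" using b by simp
  note d = d_eta[OF b]
  have "der ?x (ip X (F Y)) + der ?x (ip X (F Y)) = der ?x (ip X (F Y) + ip X (F Y))"
    by (rule der_add[symmetric]) (use x X Y in simp_all)
  also have "\<dots> = der ?x (der X (ip Y ?x)) - der ?x (der Y (ip X ?x)) - ip (?b ?x (?b X Y)) ?x"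
    using d[OF X Y, symmetric] x X Y by (simp add: der_diff der_xi_eta[OF b b])
  finally have 1: "der ?x (ip X (F Y)) + der ?x (ip X (F Y)) = \<dots>" .
  have 2: "ip (?b ?x X) (F Y) + ip (?b ?x X) (F Y)
      = der ?x (der X (ip Y ?x)) - der X (der ?x (ip Y ?x)) - der Y (der ?x (ip X ?x)) - ip (?b (?b ?x X) Y) ?x"
    using d[OF lie_bracket_vf[OF x X] Y, symmetric] x X Y by (simp add: lie_bracket_der der_xi_eta[OF b b])
  have 3: "ip X (F (?b ?x Y)) + ip X (F (?b ?x Y))
      = der X (der ?x (ip Y ?x)) - der ?x (der Y (ip X ?x)) + der Y (der ?x (ip X ?x)) - ip (?b X (?b ?x Y)) ?x"
    using d[OF X lie_bracket_vf[OF x Y], symmetric] x X Y by (simp add: lie_bracket_der der_xi_eta[OF b b])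
  have "?b ?x (?b X Y) = ?b (?b ?x X) Y + ?b X (?b ?x Y)" by (rule jacobi[OF x X Y])
  then have 4: "ip (?b ?x (?b X Y)) ?x = ip (?b (?b ?x X) Y) ?x + ip (?b X (?b ?x Y)) ?x"
    using x X Y by (simp add: ip_simps)
  show "der ?x (ip X (F Y)) p = (ip (?b ?x X) (F Y) + ip X (F (?b ?x Y))) p"
    using fun_cong[OF 1, of p] fun_cong[OF 2, of p] fun_cong[OF 3, of p] fun_cong[OF 4, of p]
    by simp
qed

text \<open>The metric is the sum of \<open>ip (F X) (F Y)\<close> and the squares of the 1-forms.
  The first part is invariant because \<open>F\<close> and the fundamental form are, the second by
  \<open>der_xi_eta\<close>.\<close>

lemma lie_xi_metric:
  assumes b: "\<beta> \<in> Ix" and X: "X \<in> vfields A" and Y: "Y \<in> vfields A"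
  shows "der (\<xi> \<beta>) (ip X Y) = ip (lie_bracket (\<xi> \<beta>) X) Y + ip X (lie_bracket (\<xi> \<beta>) Y)"
proof -
  let ?L = "lie_bracket (\<xi> \<beta>)" and ?x = "\<xi> \<beta>"
  have x: "?x \<in> vfields A" using b by simp
  have split: "ip U V = ip (F U) (F V) + (\<Sum>\<alpha>\<in>Ix. ip U (\<xi> \<alpha>) * ip V (\<xi> \<alpha>))"
    if "U \<in> vfields A" "V \<in> vfields A" for U V
    using ip_F_F[OF that] by simp
  have "der ?x (\<Sum>\<alpha>\<in>Ix. ip X (\<xi> \<alpha>) * ip Y (\<xi> \<alpha>))
      = (\<Sum>\<alpha>\<in>Ix. ip (?L X) (\<xi> \<alpha>) * ip Y (\<xi> \<alpha>)) + (\<Sum>\<alpha>\<in>Ix. ip X (\<xi> \<alpha>) * ip (?L Y) (\<xi> \<alpha>))"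
    using b x X Y
    by (simp add: der_sum der_mult der_xi_eta sum.distrib[symmetric] algebra_simps)
  moreover have "der ?x (ip (F X) (F Y)) = ip (F (?L X)) (F Y) + ip (F X) (F (?L Y))"
    using lie_xi_Phi[OF b F_vf[OF X] Y] lie_xi_F[OF b X] by simp
  ultimately have "der ?x (ip (F X) (F Y) + (\<Sum>\<alpha>\<in>Ix. ip X (\<xi> \<alpha>) * ip Y (\<xi> \<alpha>)))
      = (ip (F (?L X)) (F Y) + (\<Sum>\<alpha>\<in>Ix. ip (?L X) (\<xi> \<alpha>) * ip Y (\<xi> \<alpha>)))
      + (ip (F X) (F (?L Y)) + (\<Sum>\<alpha>\<in>Ix. ip X (\<xi> \<alpha>) * ip (?L Y) (\<xi> \<alpha>)))"
    using x X Y by (simp add: der_add algebra_simps)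
  then show ?thesis
    unfolding split[OF X Y, symmetric] split[OF lie_bracket_vf[OF x X] Y, symmetric]
      split[OF X lie_bracket_vf[OF x Y], symmetric] .
qed

text \<open>The Killing equation removes the symmetric part of the covariant derivative of
  \<open>\<xi> \<alpha>\<close>; the antisymmetric part is the exterior derivative of
  \<open>\<eta> \<alpha>\<close>, that is, the fundamental form.\<close>

lemma D_xi:
  assumes a: "\<alpha> \<in> Ix" and X: "X \<in> vfields A"
  shows "D X (\<xi> \<alpha>) = - F X"
proof (rule ip_eqI)
  let ?x = "\<xi> \<alpha>"
  have x: "?x \<in> vfields A" using a by simp
  show "D X ?x \<in> vfields A" "- F X \<in> vfields A" using x X by simp_all
  fix Y assume Y: "Y \<in> vfields A"
  have 1: "ip (D X ?x) Y + ip X (D Y ?x) = 0"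
    using lie_xi_metric[OF a X Y] x X Y
    by (simp add: metric_compatible torsion_free ip_simps algebra_simps)
  have 2: "ip Y (D X ?x) - ip X (D Y ?x) = ip X (F Y) + ip X (F Y)"
    using d_eta[OF a X Y] x X Y
    by (simp add: metric_compatible torsion_free ip_simps algebra_simps)
  show "ip (D X ?x) Y = ip (- F X) Y"
  proof
    fix p
    show "ip (D X ?x) Y p = ip (- F X) Y p"
      using fun_cong[OF 1, of p] fun_cong[OF 2, of p] ip_sym[of Y "D X ?x"] x X Y
      by (simp add: ip_simps ip_F_right)
  qed
qed

subsection \<open>The covariant derivative of the structure tensor\<close>

lemma smooth_numeral [simp]: "numeral k \<in> smooth_funs A"
  by (simp add: numeral_fun)

definition E :: "'m vfield" where
  "E = (\<Sum>\<alpha>\<in>Ix. \<xi> \<alpha>)"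

lemma E_vf [simp]: "E \<in> vfields A"
  by (simp add: E_def)

lemma ip_E: "X \<in> vfields A \<Longrightarrow> ip X E = (\<Sum>\<alpha>\<in>Ix. ip X (\<xi> \<alpha>))"
  by (simp add: E_def ip_sum_right)

lemma ip_F_E: "X \<in> vfields A \<Longrightarrow> ip (F X) E = 0"
  by (simp add: ip_E ip_F_xi)

lemma D_E: "X \<in> vfields A \<Longrightarrow> D X E = (\<lambda>_. - real s) *\<^sub>F F X"
proof -
  assume X: "X \<in> vfields A"
  have c: "(\<Sum>\<alpha>\<in>J. Z) = (\<lambda>_. real (card J)) *\<^sub>F Z" if "finite J" for J :: "nat set" and Z :: "'m vfield"
    using that by (induction J) (auto simp: fun_eq_iff fscale_def tscale_def algebra_simps)
  have "D X E = (\<Sum>\<alpha>\<in>Ix. - F X)"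
    unfolding E_def using X by (simp add: D_sum_right D_xi)
  also have "\<dots> = (\<lambda>_. - real s) *\<^sub>F F X"
    unfolding c[OF finite_Ix] card_Ix by (simp add: fun_eq_iff fscale_def tscale_def)
  finally show ?thesis .
qed

lemma F_zero: "F 0 = 0"
  using F_diff[of 0 0] by simp

lemma F_sum: "(\<And>i. i \<in> I \<Longrightarrow> X i \<in> vfields A) \<Longrightarrow> F (\<Sum>i\<in>I. X i) = (\<Sum>i\<in>I. F (X i))"
  by (induction I rule: infinite_finite_induct) (auto simp: F_zero F_add)

lemma ip_FF_F:
  assumes "X \<in> vfields A" "Y \<in> vfields A"
  shows "ip (F (F X)) (F Y) = - ip X (F Y)"
  using ip_F_F[OF F_vf[OF assms(1)] assms(2)] assms
  by (simp add: ip_F_xi ip_F_right)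

definition nabla_F :: "'m vfield \<Rightarrow> 'm vfield \<Rightarrow> 'm vfield" where
  "nabla_F X Y = D X (F Y) - F (D X Y)"

lemma nabla_F_vf [simp]: "X \<in> vfields A \<Longrightarrow> Y \<in> vfields A \<Longrightarrow> nabla_F X Y \<in> vfields A"
  by (simp add: nabla_F_def)

text \<open>The covariant derivative of the relation
  \<open>ip (F Y) Z = - ip Y (F Z)\<close>.\<close>

lemma nabla_F_skew:
  assumes "X \<in> vfields A" "Y \<in> vfields A" "Z \<in> vfields A"
  shows "ip (nabla_F X Y) Z = - ip (nabla_F X Z) Y"
proof -
  have "ip (F Y) Z + ip Y (F Z) = 0" using assms by (simp add: ip_F_right)
  then have "der X (ip (F Y) Z + ip Y (F Z)) = 0"
    using assms(1) by (simp only: der_zero)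
  then have 1: "ip (D X (F Y)) Z + ip (F Y) (D X Z) + (ip (D X Y) (F Z) + ip Y (D X (F Z))) = 0"
    using assms by (simp only: der_add metric_compatible F_vf ip_smooth)
  have 2: "ip Y (D X (F Z)) = ip (D X (F Z)) Y" using assms by (intro ip_sym) simp_all
  have 3: "ip (F Y) (D X Z) = - ip (F (D X Z)) Y"
    using assms ip_F_right[of "D X Z" Y] ip_sym[of "F Y" "D X Z"] by simp
  have 4: "ip (D X Y) (F Z) = - ip (F (D X Y)) Z" using assms by (simp add: ip_F_right)
  have "ip (nabla_F X U) W = ip (D X (F U)) W - ip (F (D X U)) W" if "U \<in> vfields A" "W \<in> vfields A" for U W
    using assms that by (simp add: nabla_F_def ip_left)
  note 5 = this[OF assms(2,3)] this[OF assms(3,2)]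
  show ?thesis
  proof
    fix p
    show "ip (nabla_F X Y) Z p = (- ip (nabla_F X Z) Y) p"
      using fun_cong[OF 1[unfolded 2 3 4], of p] unfolding 5 by simp
  qed
qed

lemma curvature_xi:
  assumes "\<alpha> \<in> Ix" "X \<in> vfields A" "Y \<in> vfields A"
  shows "curvature D X Y (\<xi> \<alpha>) = nabla_F Y X - nabla_F X Y"
  using assms by (simp add: curvature_def nabla_F_def D_xi D_simps torsion_free F_simps)

text \<open>This says that the fundamental form is closed, as it must be for an exterior derivative.
  Here it is read off from the Bianchi identity, since by \<open>curvature_xi\<close> the curvature
  paired with a structure field is a combination of values of \<open>nabla_F\<close>.\<close>

lemma nabla_F_cyclic:
  assumes "X \<in> vfields A" "Y \<in> vfields A" "Z \<in> vfields A"
  shows "ip (nabla_F X Y) Z + ip (nabla_F Y Z) X + ip (nabla_F Z X) Y = 0"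
proof
  fix p
  obtain \<alpha> where a: "\<alpha> \<in> Ix" using s_pos by (auto simp: Ix_def)
  then have x: "\<xi> \<alpha> \<in> vfields A" by simp
  have R: "Rm U V W (\<xi> \<alpha>) p = ip (nabla_F U V) W p - ip (nabla_F V U) W p"
    if "U \<in> vfields A" "V \<in> vfields A" "W \<in> vfields A" for U V W
    using that fun_cong[OF Rm_antisym34[OF that x], of p] by (simp add: Rm_def curvature_xi[OF a] ip_simps)
  have sk: "ip (nabla_F U V) W p = - ip (nabla_F U W) V p"
    if "U \<in> vfields A" "V \<in> vfields A" "W \<in> vfields A" for U V W
    using fun_cong[OF nabla_F_skew[OF that], of p] by simp
  have "Rm X Y Z (\<xi> \<alpha>) p + Rm Y Z X (\<xi> \<alpha>) p + Rm Z X Y (\<xi> \<alpha>) p = 0"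
    using fun_cong[OF Rm_bianchi[OF assms x], of p] by simp
  then have "ip (nabla_F X Y) Z p + ip (nabla_F Y Z) X p + ip (nabla_F Z X) Y p = 0"
    unfolding R[OF assms] R[OF assms(2,3,1)] R[OF assms(3,1,2)]
    using sk[OF assms(2,1,3)] sk[OF assms(3,2,1)] sk[OF assms(1,3,2)] by simp
  then show "(ip (nabla_F X Y) Z + ip (nabla_F Y Z) X + ip (nabla_F Z X) Y) p = 0 p" by simp
qed

text \<open>The covariant derivative of \<open>F_F\<close>, the formula for the square of
  \<open>F\<close>; the right-hand side stems from differentiating the structure fields with
  \<open>D_xi\<close>.\<close>

lemma nabla_F_F:
  assumes X: "X \<in> vfields A" and Y: "Y \<in> vfields A" and Z: "Z \<in> vfields A"
  shows "ip (nabla_F X (F Y)) Z - ip (nabla_F X Y) (F Z) = - (ip Y E * ip (F X) Z) - ip Y (F X) * ip Z E"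
proof -
  have sx: "ip (\<xi> \<alpha>) Z = ip Z (\<xi> \<alpha>)" if "\<alpha> \<in> Ix" for \<alpha>
    by (rule ip_sym[OF xi_vf[OF that] Z])
  have 1: "ip (nabla_F X (F Y)) Z - ip (nabla_F X Y) (F Z) = ip (D X (F (F Y))) Z + ip (F (D X Y)) (F Z)"
    using X Y Z by (simp add: nabla_F_def F_diff ip_simps ip_F_right)
  have 2: "D X (F (F Y)) = - D X Y + (\<Sum>\<alpha>\<in>Ix. ip Y (\<xi> \<alpha>) *\<^sub>F (- F X) + der X (ip Y (\<xi> \<alpha>)) *\<^sub>F \<xi> \<alpha>)"
  proof -
    have "D X (ip Y (\<xi> \<alpha>) *\<^sub>F \<xi> \<alpha>) = ip Y (\<xi> \<alpha>) *\<^sub>F (- F X) + der X (ip Y (\<xi> \<alpha>)) *\<^sub>F \<xi> \<alpha>" if "\<alpha> \<in> Ix" for \<alpha>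
      using D_fscale_right[OF ip_smooth[OF Y xi_vf[OF that]] X xi_vf[OF that]] D_xi[OF that X] by simp
    then have "D X (\<Sum>\<alpha>\<in>Ix. ip Y (\<xi> \<alpha>) *\<^sub>F \<xi> \<alpha>)
        = (\<Sum>\<alpha>\<in>Ix. ip Y (\<xi> \<alpha>) *\<^sub>F (- F X) + der X (ip Y (\<xi> \<alpha>)) *\<^sub>F \<xi> \<alpha>)"
      using X Y by (subst D_sum_right) (simp_all cong: sum.cong)
    then show ?thesis
      unfolding F_F[OF Y] using X Y by (subst D_add_right) (simp_all add: D_minus_right)
  qed
  have 3: "ip (D X (F (F Y))) Z = - ip (D X Y) Z + (\<Sum>\<alpha>\<in>Ix. - (ip Y (\<xi> \<alpha>) * ip (F X) Z)
      + (ip (D X Y) (\<xi> \<alpha>) - ip Y (F X)) * ip Z (\<xi> \<alpha>))"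
    unfolding 2 using X Y Z by (simp add: ip_simps ip_sum_left metric_compatible D_xi sx)
  have 4: "ip (F (D X Y)) (F Z) = ip (D X Y) Z - (\<Sum>\<alpha>\<in>Ix. ip (D X Y) (\<xi> \<alpha>) * ip Z (\<xi> \<alpha>))"
    using X Y Z by (simp add: ip_F_F)
  have 5: "(\<Sum>\<alpha>\<in>Ix. - (ip Y (\<xi> \<alpha>) * ip (F X) Z) + (ip (D X Y) (\<xi> \<alpha>) - ip Y (F X)) * ip Z (\<xi> \<alpha>))
      = - (ip Y E * ip (F X) Z) + ((\<Sum>\<alpha>\<in>Ix. ip (D X Y) (\<xi> \<alpha>) * ip Z (\<xi> \<alpha>)) - ip Y (F X) * ip Z E)"
    by (simp only: ip_E[OF Y] ip_E[OF Z] sum.distrib sum_negf left_diff_distrib sum_subtractf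
        sum_distrib_left[symmetric] sum_distrib_right[symmetric])
  show ?thesis unfolding 1 3 4 5 by simp
qed

text \<open>Writing brackets as differences of covariant derivatives, the Nijenhuis tensor of
  \<open>F\<close> retains only derivatives of \<open>F\<close> itself.\<close>

lemma nabla_F_normality:
  assumes X: "X \<in> vfields A" and Y: "Y \<in> vfields A" and Z: "Z \<in> vfields A"
  shows "ip (nabla_F (F X) Y) Z - ip (nabla_F (F Y) X) Z - ip (nabla_F Y X) (F Z) + ip (nabla_F X Y) (F Z)
    = - ((ip X (F Y) + ip X (F Y)) * ip Z E)"
proof -
  have sx: "ip (\<xi> \<alpha>) Z = ip Z (\<xi> \<alpha>)" if "\<alpha> \<in> Ix" for \<alpha>
    by (rule ip_sym[OF xi_vf[OF that] Z])
  have "nabla_F (F X) Y - nabla_F (F Y) X + F (nabla_F Y X) - F (nabla_F X Y)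
      + (\<Sum>\<alpha>\<in>Ix. (ip X (F Y) + ip X (F Y)) *\<^sub>F \<xi> \<alpha>) = 0"
    using normality[OF X Y] X Y by (simp add: nabla_F_def torsion_free F_simps algebra_simps)
  then have "ip (nabla_F (F X) Y - nabla_F (F Y) X + F (nabla_F Y X) - F (nabla_F X Y)
      + (\<Sum>\<alpha>\<in>Ix. (ip X (F Y) + ip X (F Y)) *\<^sub>F \<xi> \<alpha>)) Z = 0"
    using Z by (simp add: ip_zero)
  then show ?thesis
    using X Y Z
    by (simp add: ip_simps ip_sum_left ip_E ip_F_right sx sum_distrib_left eq_neg_iff_add_eq_0)
qed

text \<open>The difference of both sides is a 3-tensor with the symmetries of the covariant derivative of an
  integrable almost Kaehler structure; these force it to vanish.\<close>

lemma nabla_F_eq: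
  assumes X: "X \<in> vfields A" and Y: "Y \<in> vfields A" and Z: "Z \<in> vfields A"
  shows "ip (nabla_F X Y) Z = ip (F X) (F Y) * ip Z E - ip Y E * ip (F X) (F Z)"
proof
  fix p
  define q where "q X Y Z = ip (nabla_F X Y) Z p - (ip (F X) (F Y) p * ip Z E p - ip Y E p * ip (F X) (F Z) p)" for X Y Z
  have sk: "q X Y Z = - q X Z Y" and cyc: "q X Y Z + q Y Z X + q Z X Y = 0"
    and sh: "q X (F Y) Z = q X Y (F Z)"
    and nn: "q (F X) Y Z - q (F Y) X Z - q Y X (F Z) + q X Y (F Z) = 0"
    if "X \<in> vfields A" "Y \<in> vfields A" "Z \<in> vfields A" for X Y Z
  proof -
    note sym = ip_sym[of "F Y" "F X"] ip_sym[of "F Z" "F X"] ip_sym[of "F Z" "F Y"] ip_sym[of E]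
    show "q X Y Z = - q X Z Y"
      using fun_cong[OF nabla_F_skew[OF that], of p] by (simp add: q_def algebra_simps)
    show "q X Y Z + q Y Z X + q Z X Y = 0"
      using fun_cong[OF nabla_F_cyclic[OF that], of p] that by (simp add: q_def sym algebra_simps)
    have *: "ip (F X) (F (F W)) = - ip (F X) W" if "W \<in> vfields A" for W
      using ip_F_F[OF \<open>X \<in> vfields A\<close> F_vf[OF that]] ip_F_right[OF \<open>X \<in> vfields A\<close> that] that
        \<open>X \<in> vfields A\<close> by (simp add: ip_F_xi)
    show "q X (F Y) Z = q X Y (F Z)"
      using fun_cong[OF nabla_F_F[OF that], of p] that ip_sym[of Y "F X"]
      by (simp add: q_def * ip_F_E algebra_simps)
    have **: "ip (F Y) (F (F Z)) = ip Y (F Z)" "ip (F X) (F (F Z)) = ip X (F Z)"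
      "ip (F (F X)) (F Y) = - ip X (F Y)" "ip (F (F Y)) (F X) = ip X (F Y)"
      "ip (F (F X)) (F Z) = - ip X (F Z)" "ip (F (F Y)) (F Z) = - ip Y (F Z)"
      using that ip_sym[of Y "F X"] ip_F_right[of "F Y" "F Z"] ip_F_right[of "F X" "F Z"]
      by (simp_all add: ip_FF_F) (simp_all add: ip_F_right)
    show "q (F X) Y Z - q (F Y) X Z - q Y X (F Z) + q X Y (F Z) = 0"
      using fun_cong[OF nabla_F_normality[OF that], of p] that
      by (simp add: q_def ** ip_F_E algebra_simps)
  qed
  \<comment> \<open>Linear elimination among the four symmetries: \<open>q\<close> vanishes as soon
    as its middle argument lies in the image of \<open>F\<close>.\<close>
  have im: "q Z (F X) Y = 0" if "X \<in> vfields A" "Y \<in> vfields A" "Z \<in> vfields A" for X Y Z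
    using nn[OF that] cyc[OF F_vf[OF that(1)] that(2,3)] cyc[OF F_vf[OF that(2)] that(1,3)]
      sh[OF that(2,3,1)] sh[OF that(1,3,2)] sh[OF that(3,1,2)]
      sk[OF that(2) F_vf[OF that(3)] that(1)] sk[OF that(1) F_vf[OF that(3)] that(2)]
      sk[OF that(3) F_vf[OF that(2)] that(1)]
    by linarith
  have hor: "ip (nabla_F X (F (F Y))) Z p = ip (F X) (F (F (F Y))) p * ip Z E p"
    using im[OF F_vf[OF Y] Z X] Y by (simp add: q_def ip_F_E)
  show "ip (nabla_F X Y) Z p = (ip (F X) (F Y) * ip Z E - ip Y E * ip (F X) (F Z)) p"
  proof -
    \<comment> \<open>\<open>Y\<close> is the vertical field \<open>V\<close> minus
      \<open>F (F Y)\<close>. The latter lies in the image of \<open>F\<close>, which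
      \<open>hor\<close> covers; for \<open>V\<close> the relation \<open>F V = 0\<close> reduces
      \<open>nabla_F\<close> to a term in \<open>D X V\<close>, which is computed directly.\<close>
    define V where "V = (\<Sum>\<alpha>\<in>Ix. ip Y (\<xi> \<alpha>) *\<^sub>F \<xi> \<alpha>)"
    have V: "V \<in> vfields A" using Y by (simp add: V_def)
    have YV: "F (F Y) = - Y + V" using Y by (simp add: F_F V_def)
    have FV: "F V = 0"
    proof -
      have "h *\<^sub>F 0 = (0 :: 'm vfield)" for h by (simp add: fun_eq_iff fscale_apply tscale_apply)
      then show ?thesis using Y by (simp add: V_def F_sum F_fscale F_xi)
    qed
    have DV: "D X V = (\<Sum>\<alpha>\<in>Ix. ip Y (\<xi> \<alpha>) *\<^sub>F (- F X) + der X (ip Y (\<xi> \<alpha>)) *\<^sub>F \<xi> \<alpha>)"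
      unfolding V_def using X Y by (simp add: D_sum_right D_fscale_right D_xi)
    have "ip (nabla_F X V) Z = ip (D X V) (F Z)"
      using X V Z by (simp add: nabla_F_def FV D_zero_right ip_simps ip_F_right)
    also have "\<dots> = - (ip Y E * ip (F X) (F Z))"
    proof -
      have "ip (\<xi> \<alpha>) (F Z) = 0" if "\<alpha> \<in> Ix" for \<alpha>
        using that Z by (simp add: ip_F_right F_xi ip_zero)
      then show ?thesis
        unfolding DV using X Y Z by (simp add: ip_sum_left ip_simps ip_E sum_negf sum_distrib_right)
    qed
    finally have 1: "ip (nabla_F X V) Z = - (ip Y E * ip (F X) (F Z))" .
    have "nabla_F X (F (F Y)) = - nabla_F X Y + nabla_F X V"
      unfolding YV using X Y V by (simp add: nabla_F_def F_simps D_simps)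
    then have 2: "ip (nabla_F X (F (F Y))) Z = - ip (nabla_F X Y) Z + ip (nabla_F X V) Z"
      using X Y Z V by (simp add: ip_simps)
    have 3: "ip (F X) (F (F (F Y))) = - ip (F X) (F Y)"
      unfolding YV using X Y V FV by (simp add: F_simps ip_simps)
    show ?thesis
      using hor fun_cong[OF 1, of p] fun_cong[OF 2, of p] fun_cong[OF 3, of p] by (simp add: algebra_simps)
  qed
qed

subsection \<open>Curvature\<close>

lemma ip_E_E: "ip E E = (\<lambda>_. real s)"
proof
  fix p
  have "ip E E p = (\<Sum>\<alpha>\<in>Ix. \<Sum>\<beta>\<in>Ix. ip (\<xi> \<beta>) (\<xi> \<alpha>) p)"
    unfolding ip_E[OF E_vf] by (simp add: E_def ip_sum_left sum_fun_at[of _ _ p])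
  also have "\<dots> = real s" by (simp add: ip_xi_xi card_Ix)
  finally show "ip E E p = real s" .
qed

definition horizontal :: "'m vfield \<Rightarrow> bool" where
  "horizontal X \<longleftrightarrow> X \<in> vfields A \<and> (\<forall>\<alpha>\<in>Ix. ip X (\<xi> \<alpha>) = 0)"

lemma horizontal_vf: "horizontal X \<Longrightarrow> X \<in> vfields A"
  by (simp add: horizontal_def)

lemma horizontal_ip_E: "horizontal X \<Longrightarrow> ip X E = 0" "horizontal X \<Longrightarrow> ip E X = 0"
  using ip_sym[OF E_vf horizontal_vf] by (simp_all add: horizontal_def ip_E)

lemma horizontal_F: "X \<in> vfields A \<Longrightarrow> horizontal (F X)"
  by (simp add: horizontal_def ip_F_xi)

lemma horizontal_FF: "horizontal X \<Longrightarrow> F (F X) = - X"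
proof -
  assume h: "horizontal X"
  have "(\<Sum>\<alpha>\<in>Ix. ip X (\<xi> \<alpha>) *\<^sub>F \<xi> \<alpha>) = 0"
    by (rule sum.neutral) (use h in \<open>auto simp: horizontal_def fscale_def tscale_def fun_eq_iff\<close>)
  then show ?thesis using F_F[OF horizontal_vf[OF h]] by simp
qed

lemma horizontal_ip_F_F: "horizontal X \<Longrightarrow> Y \<in> vfields A \<Longrightarrow> ip (F X) (F Y) = ip X Y"
  by (subst ip_F_F) (simp_all add: horizontal_vf, simp add: horizontal_def)

lemma horizontal_ip_F_F': "horizontal X \<Longrightarrow> Y \<in> vfields A \<Longrightarrow> ip (F Y) (F X) = ip Y X"
  using horizontal_ip_F_F[of X Y] ip_sym[of "F Y" "F X"] ip_sym[of Y X] horizontal_vf[of X] by simp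

lemma horizontal_fscale: "horizontal X \<Longrightarrow> h \<in> smooth_funs A \<Longrightarrow> horizontal (h *\<^sub>F X)"
  by (simp add: horizontal_def ip_left)

lemma horizontal_add: "horizontal X \<Longrightarrow> horizontal Y \<Longrightarrow> horizontal (X + Y)"
  by (simp add: horizontal_def ip_left)

lemma horizontal_diff: "horizontal X \<Longrightarrow> horizontal Y \<Longrightarrow> horizontal (X - Y)"
  by (simp add: horizontal_def ip_left)

lemma ip_F_self: "X \<in> vfields A \<Longrightarrow> ip (F X) X = 0"
proof
  fix p assume "X \<in> vfields A"
  then show "ip (F X) X p = 0 p"
    using fun_cong[OF ip_F_right[of X X], of p] fun_cong[OF ip_sym[of X "F X"], of p] by simp
qed

lemma Rm_xi:
  assumes "\<alpha> \<in> Ix" "X \<in> vfields A" "Y \<in> vfields A" "W \<in> vfields A"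
  shows "Rm X Y (\<xi> \<alpha>) W = ip Y E * ip (F X) (F W) - ip X E * ip (F Y) (F W)"
proof -
  have "ip (F Y) (F X) = ip (F X) (F Y)" using assms by (intro ip_sym) simp_all
  then show ?thesis
    using assms by (simp add: Rm_def curvature_xi ip_left nabla_F_eq)
qed

definition ver :: "'m vfield \<Rightarrow> 'm vfield" where
  "ver X = (\<Sum>\<alpha>\<in>Ix. ip X (\<xi> \<alpha>) *\<^sub>F \<xi> \<alpha>)"

text \<open>\<open>F\<close> squares to -1 on horizontal fields and kills the structure fields, so
  this is the orthogonal projection onto the horizontal distribution.\<close>

definition hor :: "'m vfield \<Rightarrow> 'm vfield" where
  "hor X = - F (F X)"

lemma ver_vf [simp]: "X \<in> vfields A \<Longrightarrow> ver X \<in> vfields A"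
  by (simp add: ver_def)

lemma hor_vf [simp]: "X \<in> vfields A \<Longrightarrow> hor X \<in> vfields A"
  by (simp add: hor_def)

lemma hor_ver: "X \<in> vfields A \<Longrightarrow> X = hor X + ver X"
  using F_F[of X] by (simp add: hor_def ver_def)

lemma horizontal_hor: "X \<in> vfields A \<Longrightarrow> horizontal (hor X)"
  by (simp add: hor_def horizontal_def ip_left ip_F_xi)

lemma F_hor: "X \<in> vfields A \<Longrightarrow> F (hor X) = F X"
  using horizontal_FF[OF horizontal_F[of X]] by (simp add: hor_def F_minus)

lemma ip_hor: "X \<in> vfields A \<Longrightarrow> horizontal Y \<Longrightarrow> ip (hor X) Y = ip X Y"
  using horizontal_ip_F_F'[of Y "hor X"] horizontal_ip_F_F'[of Y X] by (simp add: F_hor)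

lemma ip_hor_hor: "X \<in> vfields A \<Longrightarrow> Y \<in> vfields A \<Longrightarrow> ip (hor X) (hor Y) = ip (F X) (F Y)"
  using horizontal_ip_F_F[OF horizontal_hor[of X] hor_vf[of Y]] by (simp add: F_hor)

lemma Rm_sum3:
  assumes "X \<in> vfields A" "Y \<in> vfields A" "W \<in> vfields A" "\<And>i. i \<in> I \<Longrightarrow> Z i \<in> vfields A"
  shows "Rm X Y (\<Sum>i\<in>I. Z i) W = (\<Sum>i\<in>I. Rm X Y (Z i) W)"
proof -
  have "Rm X Y 0 W = 0"
    using Rm_add3[of X Y 0 0 W] assms by simp
  with assms show ?thesis
    by (induction I rule: infinite_finite_induct) (auto simp: Rm_add3)
qed

lemma Rm_ver:
  assumes "X \<in> vfields A" "Y \<in> vfields A" "Z \<in> vfields A" "W \<in> vfields A"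
  shows "Rm X Y (ver Z) W = ip Z E * (ip Y E * ip (F X) (F W) - ip X E * ip (F Y) (F W))"
proof -
  have "Rm X Y (ver Z) W = (\<Sum>\<alpha>\<in>Ix. ip Z (\<xi> \<alpha>) * (ip Y E * ip (F X) (F W) - ip X E * ip (F Y) (F W)))"
    unfolding ver_def using assms by (subst Rm_sum3) (auto simp: Rm_fscale3 Rm_xi cong: sum.cong)
  then show ?thesis using assms by (simp add: ip_E sum_distrib_right)
qed

text \<open>\<open>Rm_ver\<close> evaluates the curvature once the third slot is vertical. The
  symmetries of \<open>Rm\<close> bring each slot there in turn, so the four arguments are replaced
  one by one by their horizontal parts; the last two replacements are free because horizontal fields
  are orthogonal to \<open>E\<close>.\<close>

lemma Rm_hor_decomposition:
  assumes X: "X \<in> vfields A" and Y: "Y \<in> vfields A"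
  shows "Rm X Y Y X p = Rm (hor X) (hor Y) (hor Y) (hor X) p + (ip Y E p)\<^sup>2 * ip (F X) (F X) p
    - 2 * ip X E p * ip Y E p * ip (F X) (F Y) p + (ip X E p)\<^sup>2 * ip (F Y) (F Y) p"
proof -
  have d: "Rm U V Z W p = Rm U V (hor Z) W p
      + ip Z E p * (ip V E p * ip (F U) (F W) p - ip U E p * ip (F V) (F W) p)"
    if "U \<in> vfields A" "V \<in> vfields A" "Z \<in> vfields A" "W \<in> vfields A" for U V Z W
  proof -
    have "Rm U V Z W = Rm U V (hor Z) W + Rm U V (ver Z) W"
      using Rm_add3[OF that(1,2) hor_vf[OF that(3)] ver_vf[OF that(3)] that(4)] hor_ver[OF that(3)] by simp
    then show ?thesis using Rm_ver[OF that] by simp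
  qed
  have a: "Rm U V Z W p = - Rm U V W Z p"
    if "U \<in> vfields A" "V \<in> vfields A" "Z \<in> vfields A" "W \<in> vfields A" for U V Z W
    using fun_cong[OF Rm_antisym34[OF that(1,2,4,3)], of p] by simp
  let ?X = "hor X" and ?Y = "hor Y"
  have X': "?X \<in> vfields A" and Y': "?Y \<in> vfields A" using X Y by simp_all
  have e: "ip ?X E p = 0" "ip ?Y E p = 0"
    using horizontal_ip_E(1)[OF horizontal_hor[OF X]] horizontal_ip_E(1)[OF horizontal_hor[OF Y]] by simp_all
  have "ip (F Y) (F X) p = ip (F X) (F Y) p" using X Y by (simp add: ip_sym)
  then show ?thesis
    using d[OF X Y Y X] a[OF X Y Y' X] d[OF X Y X Y'] a[OF X' Y' X Y] fun_cong[OF Rm_pair_sym[OF X Y X' Y'], of p]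
      d[OF X' Y' X Y] a[OF X' Y' X' Y] d[OF X' Y' Y X'] e
    by (simp add: F_hor[OF X] F_hor[OF Y] power2_eq_square algebra_simps)
qed

section \<open>The Ricci identity for the structure tensor\<close>

lemma nabla_F_horizontal:
  assumes "X \<in> vfields A" "horizontal Z"
  shows "nabla_F X Z = ip X Z *\<^sub>F E"
proof (rule ip_eqI)
  have Z: "Z \<in> vfields A" by (rule horizontal_vf[OF assms(2)])
  show "nabla_F X Z \<in> vfields A" "ip X Z *\<^sub>F E \<in> vfields A" using assms(1) Z by simp_all
  show "ip (nabla_F X Z) U = ip (ip X Z *\<^sub>F E) U" if "U \<in> vfields A" for U
    using assms that Z ip_sym[OF that E_vf]
    by (simp add: nabla_F_eq horizontal_ip_E horizontal_ip_F_F' ip_left)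
qed

lemma ip_D_E:
  assumes "X \<in> vfields A" "horizontal Z"
  shows "ip (D X Z) E = (\<lambda>_. real s) * ip Z (F X)"
proof
  fix p
  have Z: "Z \<in> vfields A" by (rule horizontal_vf[OF assms(2)])
  have "der X (ip Z E) = 0" using assms by (simp add: horizontal_ip_E der_zero)
  then have "ip (D X Z) E + ip Z (D X E) = 0" using assms Z by (simp add: metric_compatible)
  then have "ip (D X Z) E p + ip Z (D X E) p = 0" by (metis plus_fun_apply zero_fun_apply)
  then show "ip (D X Z) E p = ((\<lambda>_. real s) * ip Z (F X)) p"
    using assms Z by (simp add: D_E ip_right)
qed

text \<open>Commuting \<open>F\<close> past both derivatives leaves components along
  \<open>E\<close>, which the horizontal \<open>W\<close> does not see, and two terms with factor
  \<open>s\<close>: one from the \<open>E\<close>-component of \<open>D Y Z\<close>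
  (\<open>ip_D_E\<close>), one from differentiating \<open>E\<close> (\<open>D_E\<close>).\<close>

lemma D_D_F:
  assumes X: "horizontal X" and Y: "horizontal Y" and Z: "horizontal Z" and W: "horizontal W"
  shows "ip (D X (D Y (F Z))) W p = ip (F (D X (D Y Z))) W p
    - real s * ip Z (F Y) p * ip X W p - real s * ip Y Z p * ip (F X) W p"
proof -
  note vf = X[THEN horizontal_vf] Y[THEN horizontal_vf] Z[THEN horizontal_vf] W[THEN horizontal_vf]
  have "D Y (F Z) = F (D Y Z) + ip Y Z *\<^sub>F E"
    using nabla_F_horizontal[OF vf(2) Z] by (simp add: nabla_F_def algebra_simps)
  then have "D X (D Y (F Z)) = D X (F (D Y Z)) + D X (ip Y Z *\<^sub>F E)"
    using vf by (simp add: D_add_right)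
  also have "D X (F (D Y Z)) = F (D X (D Y Z)) + nabla_F X (D Y Z)"
    by (simp add: nabla_F_def)
  also have "D X (ip Y Z *\<^sub>F E) = ip Y Z *\<^sub>F ((\<lambda>_. - real s) *\<^sub>F F X) + der X (ip Y Z) *\<^sub>F E"
    using vf by (simp add: D_fscale_right D_E)
  finally have *: "D X (D Y (F Z)) = F (D X (D Y Z)) + nabla_F X (D Y Z)
      + (ip Y Z *\<^sub>F ((\<lambda>_. - real s) *\<^sub>F F X) + der X (ip Y Z) *\<^sub>F E)" .
  show ?thesis
    unfolding * using vf
    by (simp add: ip_left nabla_F_eq horizontal_ip_E[OF W] ip_D_E[OF vf(2) Z] horizontal_ip_F_F[OF X])
qed

text \<open>The Ricci identity, obtained by antisymmetrising \<open>D_D_F\<close> in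
  \<open>X\<close> and \<open>Y\<close>; the bracket term differs from its commuted form only along
  \<open>E\<close>.\<close>

lemma Rm_F:
  assumes X: "horizontal X" and Y: "horizontal Y" and Z: "horizontal Z" and W: "horizontal W"
  shows "Rm X Y (F Z) W p = ip (F (curvature D X Y Z)) W p
    + real s * (ip Z (F X) p * ip Y W p - ip Z (F Y) p * ip X W p + ip X Z p * ip (F Y) W p - ip Y Z p * ip (F X) W p)"
proof -
  note vf = X[THEN horizontal_vf] Y[THEN horizontal_vf] Z[THEN horizontal_vf] W[THEN horizontal_vf]
  have "D (lie_bracket X Y) (F Z) = F (D (lie_bracket X Y) Z) + ip (lie_bracket X Y) Z *\<^sub>F E"
    using nabla_F_horizontal[OF lie_bracket_vf[OF vf(1,2)] Z] by (simp add: nabla_F_def algebra_simps)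
  then have b: "ip (D (lie_bracket X Y) (F Z)) W = ip (F (D (lie_bracket X Y) Z)) W"
    using vf by (simp add: ip_left horizontal_ip_E[OF W])
  have 1: "Rm X Y (F Z) W p
      = ip (D X (D Y (F Z))) W p - ip (D Y (D X (F Z))) W p - ip (D (lie_bracket X Y) (F Z)) W p"
    using vf by (simp add: Rm_def curvature_def ip_left)
  have 2: "ip (F (curvature D X Y Z)) W p
      = ip (F (D X (D Y Z))) W p - ip (F (D Y (D X Z))) W p - ip (F (D (lie_bracket X Y) Z)) W p"
    using vf by (simp add: curvature_def ip_left F_diff)
  show ?thesis
    unfolding 1 2 D_D_F[OF X Y Z W] D_D_F[OF Y X Z W] b by (simp add: algebra_simps)
qed

text \<open>Of the four correction terms in \<open>Rm_F\<close> only the one with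
  \<open>ip Y Y\<close> and \<open>ip (F X) (F X)\<close> survives orthonormality.\<close>

lemma Rm_orthonormal_F:
  assumes X: "horizontal X" and Y: "horizontal Y"
    and on: "ip X X p = 1" "ip Y Y p = 1" "ip X Y p = 0" "ip X (F Y) p = 0"
  shows "Rm X Y (F Y) (F X) p = Rm X Y Y X p - real s"
proof -
  note vf = X[THEN horizontal_vf] Y[THEN horizontal_vf]
  have "ip (F (curvature D X Y Y)) (F X) = Rm X Y Y X"
    using horizontal_ip_F_F'[OF X curvature_vf[OF vf vf(2)]] by (simp add: Rm_def)
  moreover have "ip Y (F Y) p = 0" "ip (F X) (F X) p = 1" "ip Y (F X) p = 0"
    using on fun_cong[OF ip_F_right[OF vf(2,2)], of p] ip_F_self[OF vf(2)] horizontal_ip_F_F[OF X vf(1)]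
      fun_cong[OF ip_F_right[OF vf(2,1)], of p] fun_cong[OF ip_sym[OF vf(1) F_vf[OF vf(2)]], of p] by simp_all
  ultimately show ?thesis
    using Rm_F[OF X Y Y horizontal_F[OF vf(1)], of p] on by simp
qed

end

subsection \<open>The fundamental form has rank at least four\<close>

lemma wedge_nonzero:
  assumes "wedge k l \<omega> \<theta> X p \<noteq> 0"
  obtains \<sigma> where "\<omega> (\<lambda>i. X (\<sigma> i)) p \<noteq> 0" "\<theta> (\<lambda>i. X (\<sigma> (k + i))) p \<noteq> 0"
proof -
  have "(\<Sum>\<sigma> | \<sigma> permutes {..<k + l}.
      of_int (sign \<sigma>) * \<omega> (\<lambda>i. X (\<sigma> i)) p * \<theta> (\<lambda>i. X (\<sigma> (k + i))) p) \<noteq> 0"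
    using assms by (auto simp: wedge_def)
  then obtain \<sigma> where "of_int (sign \<sigma>) * \<omega> (\<lambda>i. X (\<sigma> i)) p * \<theta> (\<lambda>i. X (\<sigma> (k + i))) p \<noteq> 0"
    by (rule sum.not_neutral_contains_not_neutral)
  then show thesis using that by auto
qed

lemma wedge_power_nonzero_le:
  assumes "m \<le> n" "wedge_power k \<omega> n X p \<noteq> 0" "\<And>i. X i \<in> V"
  shows "\<exists>Y. (\<forall>i. Y i \<in> V) \<and> wedge_power k \<omega> m Y p \<noteq> 0"
  using assms
proof (induction n arbitrary: X rule: dec_induct)
  case (step n)
  from step.prems(1) obtain \<sigma> where "wedge_power k \<omega> n (\<lambda>i. X (\<sigma> i)) p \<noteq> 0"
    by (auto elim: wedge_nonzero)
  then show ?case using step.IH[of "\<lambda>i. X (\<sigma> i)"] step.prems(2) by blast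
qed auto

text \<open>Composition with the transposition pairs off permutations of opposite sign with the same
  summand.\<close>

lemma signed_sum_swap_invariant:
  fixes h :: "('a \<Rightarrow> 'a) \<Rightarrow> real"
  assumes "finite S" "i \<in> S" "j \<in> S" "i \<noteq> j" "\<And>\<sigma>. h (\<sigma> \<circ> Transposition.transpose i j) = h \<sigma>"
  shows "(\<Sum>\<sigma> | \<sigma> permutes S. of_int (sign \<sigma>) * h \<sigma>) = 0"
proof -
  let ?t = "Transposition.transpose i j"
  have t: "?t permutes S" using assms by (simp add: permutes_swap_id)
  have "(\<Sum>\<sigma> | \<sigma> permutes S. of_int (sign \<sigma>) * h \<sigma>) = (\<Sum>\<sigma> | \<sigma> permutes S. - (of_int (sign \<sigma>) * h \<sigma>))"
  proof (rule sum.reindex_bij_witness[of _ "\<lambda>\<sigma>. \<sigma> \<circ> ?t" "\<lambda>\<sigma>. \<sigma> \<circ> ?t"])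
    fix \<sigma> assume "\<sigma> \<in> {\<sigma>. \<sigma> permutes S}"
    then have s: "\<sigma> permutes S" by simp
    show "\<sigma> \<circ> ?t \<circ> ?t = \<sigma>" "\<sigma> \<circ> ?t \<circ> ?t = \<sigma>" by (simp_all add: o_assoc[symmetric])
    show "\<sigma> \<circ> ?t \<in> {\<sigma>. \<sigma> permutes S}" "\<sigma> \<circ> ?t \<in> {\<sigma>. \<sigma> permutes S}"
      using permutes_compose[OF t s] by simp_all
    have "sign (\<sigma> \<circ> ?t) = - sign \<sigma>"
      using sign_compose[of \<sigma> ?t] permutes_imp_permutation[OF assms(1) s]
        permutes_imp_permutation[OF assms(1) t] assms(4) by (simp add: sign_swap_id)
    then show "- (of_int (sign (\<sigma> \<circ> ?t)) * h (\<sigma> \<circ> ?t)) = of_int (sign \<sigma>) * h \<sigma>"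
      using assms(5) by simp
  qed
  then show ?thesis by (simp add: sum_negf)
qed

text \<open>The square of a product of two 1-forms is 0: after expansion each of the four products
  contains \<open>a\<close> at two positions, and exchanging these is odd but leaves the product
  unchanged.\<close>

lemma wedge_square_decomposable:
  assumes "\<And>X. (\<And>i. X i \<in> V) \<Longrightarrow> \<omega> X p = a (X 0) * b (X 1) - a (X 1) * b (X 0)" "\<And>i. X i \<in> V"
  shows "wedge_power 2 \<omega> 2 X p = 0"
proof -
  \<comment> \<open>The first power is the antisymmetrisation of \<open>\<omega>\<close>. With the
    normalisation in \<open>wedge\<close> it returns a form that is already antisymmetric.\<close>
  have inner: "wedge_power 2 \<omega> 1 Y p = a (Y 0) * b (Y 1) - a (Y 1) * b (Y 0)" if "\<And>i. Y i \<in> V" for Y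
  proof -
    have two: "{..<2::nat} = insert 0 (insert 1 {})" by auto
    have "wedge_power 2 \<omega> 1 Y p = (\<Sum>\<sigma> | \<sigma> permutes {..<2}.
        of_int (sign \<sigma>) * (a (Y (\<sigma> 0)) * b (Y (\<sigma> 1)) - a (Y (\<sigma> 1)) * b (Y (\<sigma> 0)))) / 2"
      using assms(1) that by (simp add: wedge_def numeral_2_eq_2)
    also have "\<dots> = a (Y 0) * b (Y 1) - a (Y 1) * b (Y 0)"
      unfolding two by (simp add: sum_over_permutations_insert permutes_sing sign_swap_id sign_id)
    finally show ?thesis .
  qed
  let ?S = "\<lambda>h. \<Sum>\<sigma> | \<sigma> permutes {..<4::nat}. of_int (sign \<sigma>) * (h (\<sigma> 0) (\<sigma> 1) (\<sigma> 2) (\<sigma> 3) :: real)"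
  let ?a = "\<lambda>i. a (X i)" and ?b = "\<lambda>i. b (X i)"
  have "wedge_power 2 \<omega> 2 X p = (\<Sum>\<sigma> | \<sigma> permutes {..<4}.
      of_int (sign \<sigma>) * (?a (\<sigma> 0) * ?b (\<sigma> 1) - ?a (\<sigma> 1) * ?b (\<sigma> 0))
        * (?a (\<sigma> 2) * ?b (\<sigma> 3) - ?a (\<sigma> 3) * ?b (\<sigma> 2))) / 24"
  proof -
    define W where "W = wedge_power 2 \<omega> 1"
    have "wedge_power 2 \<omega> 2 = wedge 2 2 W \<omega>"
      using wedge_power.simps(2)[of 2 \<omega> 1] by (simp only: Suc_1 mult_1_right W_def)
    moreover have "W (\<lambda>i. X (\<sigma> i)) p = ?a (\<sigma> 0) * ?b (\<sigma> 1) - ?a (\<sigma> 1) * ?b (\<sigma> 0)" for \<sigma>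
      unfolding W_def by (rule inner) (rule assms(2))
    moreover have "\<omega> (\<lambda>i. X (\<sigma> (2 + i))) p = ?a (\<sigma> 2) * ?b (\<sigma> 3) - ?a (\<sigma> 3) * ?b (\<sigma> 2)" for \<sigma>
      using assms(1)[of "\<lambda>i. X (\<sigma> (2 + i))"] assms(2) by (simp add: numeral_3_eq_3)
    ultimately show ?thesis by (simp add: wedge_def fact_numeral)
  qed
  also have "\<dots> = (?S (\<lambda>i j k l. ?a i * ?b j * ?a k * ?b l) - ?S (\<lambda>i j k l. ?a i * ?b j * ?a l * ?b k)
      - ?S (\<lambda>i j k l. ?a j * ?b i * ?a k * ?b l) + ?S (\<lambda>i j k l. ?a j * ?b i * ?a l * ?b k)) / 24"
    by (simp add: sum_subtractf[symmetric] sum.distrib[symmetric] algebra_simps)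
  \<comment> \<open>In this term and the next three, \<open>i\<close> and \<open>j\<close> are the
    two positions occupied by \<open>a\<close>.\<close>
  also have "?S (\<lambda>i j k l. ?a i * ?b j * ?a k * ?b l) = 0"
    by (rule signed_sum_swap_invariant[where i = 0 and j = 2]) (auto simp: Transposition.transpose_def)
  also have "?S (\<lambda>i j k l. ?a i * ?b j * ?a l * ?b k) = 0"
    by (rule signed_sum_swap_invariant[where i = 0 and j = 3]) (auto simp: Transposition.transpose_def)
  also have "?S (\<lambda>i j k l. ?a j * ?b i * ?a k * ?b l) = 0"
    by (rule signed_sum_swap_invariant[where i = 1 and j = 2]) (auto simp: Transposition.transpose_def)
  also have "?S (\<lambda>i j k l. ?a j * ?b i * ?a l * ?b k) = 0"
    by (rule signed_sum_swap_invariant[where i = 1 and j = 3]) (auto simp: Transposition.transpose_def)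
  finally show ?thesis by simp
qed

context S_manifold_connection
begin

abbreviation cscale :: "real \<Rightarrow> 'm vfield \<Rightarrow> 'm vfield"  (infixr "*\<^sub>C" 75) where
  "c *\<^sub>C X \<equiv> (\<lambda>_. c) *\<^sub>F X"

lemma horizontal_normalize:
  assumes "horizontal X" "ip X X p > 0"
  shows "horizontal ((1 / sqrt (ip X X p)) *\<^sub>C X)"
    "ip ((1 / sqrt (ip X X p)) *\<^sub>C X) ((1 / sqrt (ip X X p)) *\<^sub>C X) p = 1"
  using assms horizontal_vf[OF assms(1)]
  by (simp_all add: horizontal_fscale ip_simps)

text \<open>If all fields were at \<open>p\<close> combinations of the structure fields, \<open>X\<close> and \<open>F X\<close>, then the
  fundamental form would be decomposable at \<open>p\<close> and its square would vanish there.\<close>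

lemma horizontal_pair:
  assumes "n \<ge> 2"
  obtains X Y where "horizontal X" "horizontal Y" "ip X X p = 1" "ip Y Y p = 1" "ip X Y p = 0" "ip X (F Y) p = 0"
proof (rule ccontr)
  assume contr: "\<not> thesis"
  note pair = that
  obtain \<alpha> where a: "\<alpha> \<in> Ix" using s_pos by (auto simp: Ix_def)
  define \<omega> :: "'m form" where "\<omega> = (\<lambda>X. ext_deriv (\<eta> \<alpha>) (X 0) (X 1))"
  have \<omega>: "\<omega> X p = ip (X 0) (F (X 1)) p" if "\<And>i. X i \<in> vfields A" for X
    using that by (simp add: \<omega>_def ext_deriv_eq[OF a])
  have "nonvanishing A (wedge s (2 * n) (wedge_one_forms \<eta> s) (wedge_power 2 \<omega> n))"
    using S_manifold a unfolding S_manifold_def Ix_def \<omega>_def by blast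
  then obtain X where X: "\<And>i. X i \<in> vfields A" "wedge s (2 * n) (wedge_one_forms \<eta> s) (wedge_power 2 \<omega> n) X p \<noteq> 0"
    unfolding nonvanishing_def by blast
  \<comment> \<open>A factor of a nonzero product is nonzero at some fields; since
    \<open>2 \<le> n\<close>, this descends from the \<open>n\<close>-th power of
    \<open>\<omega>\<close> to its square.\<close>
  obtain \<sigma> where "wedge_power 2 \<omega> n (\<lambda>i. X (\<sigma> (s + i))) p \<noteq> 0"
    by (rule wedge_nonzero[OF X(2)])
  from wedge_power_nonzero_le[OF assms this, of "vfields A"] X(1)
  obtain Y where Y: "\<And>i. Y i \<in> vfields A" "wedge_power 2 \<omega> 2 Y p \<noteq> 0" by blast
  show False
  \<comment> \<open>If \<open>F\<close> vanishes at \<open>p\<close>, so does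
    \<open>\<omega>\<close>, which is then decomposable with both 1-forms 0.\<close>
  proof (cases "\<forall>Z\<in>vfields A. ip (F Z) (F Z) p = 0")
    case True
    have "\<omega> X p = 0 * 0 - 0 * 0" if "\<And>i. X i \<in> vfields A" for X
    proof -
      have "F (X 1) p = 0" using ip_self_eq_0[of "F (X 1)" p] True that by simp
      then have "ip (F (X 1)) (X 0) p = 0" using ip_at_zero that by blast
      then show ?thesis using \<omega>[OF that] ip_sym[of "X 0" "F (X 1)"] that by simp
    qed
    then have "wedge_power 2 \<omega> 2 Y p = 0"
      using wedge_square_decomposable[of "vfields A" \<omega> p "\<lambda>_. 0" "\<lambda>_. 0" Y] Y(1) by blast
    then show False using Y(2) by simp
  next
    case False
    then obtain Z where Z: "Z \<in> vfields A" "ip (F Z) (F Z) p > 0"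
      using ip_nonneg by (metis F_vf less_eq_real_def)
    define V where "V = (1 / sqrt (ip (F Z) (F Z) p)) *\<^sub>C F Z"
    have V: "horizontal V" "ip V V p = 1"
      using horizontal_normalize[OF horizontal_F[OF Z(1)] Z(2)] by (simp_all add: V_def)
    have Vv: "V \<in> vfields A" by (rule horizontal_vf[OF V(1)])
    have FVV: "ip (F V) V p = 0" "ip V (F V) p = 0" "ip (F V) (F V) p = 1"
      using ip_F_self[OF Vv] ip_F_right[OF Vv Vv] horizontal_ip_F_F[OF V(1) Vv] V(2) by simp_all
    have dec: "ip U (F W) p = ip U (F V) p * ip W V p - ip W (F V) p * ip U V p"
      if U: "U \<in> vfields A" and W: "W \<in> vfields A" for U W
    proof -
      define a where "a = ip U V p"
      define b where "b = ip U (F V) p"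
      \<comment> \<open>The rest of \<open>U\<close> after projecting onto the horizontal
        distribution and removing the components along \<open>V\<close> and \<open>F V\<close>. If
        \<open>T\<close> were nonzero at \<open>p\<close>, then \<open>V\<close> and the normalised
        \<open>T\<close> would be the pair excluded by \<open>contr\<close>.\<close>
      define T where "T = hor U - (a *\<^sub>C V + b *\<^sub>C F V)"
      have hT: "horizontal T"
        unfolding T_def
        by (intro horizontal_diff horizontal_add horizontal_fscale horizontal_hor U V(1) horizontal_F Vv) simp_all
      have T: "T \<in> vfields A" by (rule horizontal_vf[OF hT])
      have ipT: "ip T Q p = ip U Q p - (a * ip V Q p + b * ip (F V) Q p)" if "horizontal Q" for Q
        using U Vv horizontal_vf[OF that] by (simp add: T_def ip_left ip_hor[OF U that])
      have TV: "ip T V p = 0" "ip T (F V) p = 0"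
        using ipT[OF V(1)] ipT[OF horizontal_F[OF Vv]] FVV V(2) by (simp_all add: a_def b_def)
      have "ip T T p = 0"
      proof (rule ccontr)
        assume "ip T T p \<noteq> 0"
        then have pos: "ip T T p > 0" using ip_nonneg[OF T, of p] by simp
        let ?T = "(1 / sqrt (ip T T p)) *\<^sub>C T"
        have "ip V ?T p = 0" "ip V (F ?T) p = 0"
          using TV T Vv ip_sym[OF Vv T] ip_F_right[OF Vv T] ip_sym[OF F_vf[OF Vv] T]
          by (simp_all add: ip_simps F_fscale)
        then show False
          using contr pair[OF V(1) horizontal_normalize(1)[OF hT pos] V(2) horizontal_normalize(2)[OF hT pos]]
          by blast
      qed
      then have "T p = 0" by (rule ip_self_eq_0[OF T])
      then have "ip T (F W) p = 0" using ip_at_zero W by simp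
      then have "ip U (F W) p = a * ip V (F W) p + b * ip (F V) (F W) p"
        using ipT[OF horizontal_F[OF W]] by simp
      moreover have "ip V (F W) p = - ip W (F V) p" "ip (F V) (F W) p = ip W V p"
        using ip_F_right[OF Vv W] ip_sym[OF F_vf[OF Vv] W] horizontal_ip_F_F[OF V(1) W] ip_sym[OF Vv W] by simp_all
      ultimately show ?thesis by (simp add: a_def b_def)
    qed
    have "\<omega> X p = ip (X 0) (F V) p * ip (X 1) V p - ip (X 1) (F V) p * ip (X 0) V p"
      if "\<And>i. X i \<in> vfields A" for X
      unfolding \<omega>[OF that] by (rule dec[OF that that])
    then have "wedge_power 2 \<omega> 2 Y p = 0"
      using wedge_square_decomposable[of "vfields A" \<omega> p "\<lambda>U. ip U (F V) p" "\<lambda>U. ip U V p" Y] Y(1) by blast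
    then show False using Y(2) by simp
  qed
qed

subsection \<open>Constant sectional curvature on horizontal planes\<close>

definition orthonormal_pair :: "'m \<Rightarrow> 'm vfield \<Rightarrow> 'm vfield \<Rightarrow> bool" where
  "orthonormal_pair p X Y \<longleftrightarrow> horizontal X \<and> horizontal Y \<and> ip X X p = 1 \<and> ip Y Y p = 1 \<and> ip X Y p = 0"

definition horizontal_curvature_const :: "'m \<Rightarrow> real \<Rightarrow> bool" where
  "horizontal_curvature_const p k \<longleftrightarrow> (\<forall>X Y. orthonormal_pair p X Y \<longrightarrow> Rm X Y Y X p = k)"

lemma orthonormal_pair_vf:
  "orthonormal_pair p X Y \<Longrightarrow> X \<in> vfields A" "orthonormal_pair p X Y \<Longrightarrow> Y \<in> vfields A"
  by (simp_all add: orthonormal_pair_def horizontal_vf)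

lemma orthonormal_pair_sym: "orthonormal_pair p X Y \<Longrightarrow> orthonormal_pair p Y X"
  using ip_sym[of X Y] orthonormal_pair_vf[of p X Y] by (simp add: orthonormal_pair_def)

lemma orthonormal_pair_midpoint:
  assumes "orthonormal_pair p X Y" "orthonormal_pair p W Y" "orthonormal_pair p X W"
  shows "orthonormal_pair p ((1 / sqrt 2) *\<^sub>C (X + W)) Y"
proof -
  have vf: "X \<in> vfields A" "Y \<in> vfields A" "W \<in> vfields A"
    using assms orthonormal_pair_vf by blast+
  have "ip W X p = 0" using orthonormal_pair_sym[OF assms(3)] by (simp add: orthonormal_pair_def)
  then show ?thesis
    using assms vf
    by (simp add: orthonormal_pair_def horizontal_fscale horizontal_add ip_simps field_simps real_sqrt_mult_self)
qed

text \<open>Polarisation in the outer slots: the unit vector \<open>(X + W) / sqrt 2\<close> has the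
  same curvature with \<open>Y\<close> as \<open>X\<close> and \<open>W\<close>, so the cross term
  must vanish.\<close>

lemma Rm_two_equal_orthonormal:
  assumes K: "horizontal_curvature_const p k"
    and on: "orthonormal_pair p X Y" "orthonormal_pair p W Y" "orthonormal_pair p X W"
  shows "Rm X Y Y W p = 0"
proof -
  have vf: "X \<in> vfields A" "Y \<in> vfields A" "W \<in> vfields A"
    using on orthonormal_pair_vf by blast+
  let ?U = "(1 / sqrt 2) *\<^sub>C (X + W)"
  have "Rm ?U Y Y ?U p = k" "Rm X Y Y X p = k" "Rm W Y Y W p = k"
    using K orthonormal_pair_midpoint[OF on] on(1,2) by (auto simp: horizontal_curvature_const_def)
  moreover have "Rm ?U Y Y ?U p = (Rm X Y Y X p + Rm X Y Y W p + (Rm W Y Y X p + Rm W Y Y W p)) / 2"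
    using vf by (simp add: Rm_simps field_simps)
  moreover have "Rm W Y Y X p = Rm X Y Y W p"
    using fun_cong[OF Rm_pair_sym[OF vf(3,2,2,1)], of p] fun_cong[OF Rm_antisym12[OF vf(1,2,3,2)], of p]
      fun_cong[OF Rm_antisym34[OF vf(1,2,2,3)], of p] by simp
  ultimately show ?thesis by simp
qed

text \<open>Polarising once more, in the two middle slots, makes \<open>Rm\<close> antisymmetric in
  them. Together with the antisymmetry of the first pair this makes the three terms of the Bianchi
  identity equal, so each is 0.\<close>

lemma Rm_orthonormal:
  assumes K: "horizontal_curvature_const p k"
    and on: "orthonormal_pair p X Y" "orthonormal_pair p X Z" "orthonormal_pair p X W"
      "orthonormal_pair p Y Z" "orthonormal_pair p Y W" "orthonormal_pair p Z W"
  shows "Rm X Y Z W p = 0"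
proof -
  have swap: "Rm X Y Z W p = - Rm X Z Y W p"
    if o: "orthonormal_pair p X Y" "orthonormal_pair p X Z" "orthonormal_pair p X W"
      "orthonormal_pair p Y Z" "orthonormal_pair p Y W" "orthonormal_pair p Z W" for X Y Z W
  proof -
    have vf: "X \<in> vfields A" "Y \<in> vfields A" "Z \<in> vfields A" "W \<in> vfields A"
      using o orthonormal_pair_vf by blast+
    let ?U = "(1 / sqrt 2) *\<^sub>C (Y + Z)"
    note s = o[THEN orthonormal_pair_sym]
    have U: "orthonormal_pair p X ?U" "orthonormal_pair p W ?U"
      using orthonormal_pair_midpoint[OF s(1,2) o(4)] orthonormal_pair_midpoint[OF o(5,6,4)]
      by (auto intro: orthonormal_pair_sym)
    have "Rm X ?U ?U W p = 0" "Rm X Y Y W p = 0" "Rm X Z Z W p = 0"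
      by (rule Rm_two_equal_orthonormal[OF K]; use U o s in blast)+
    moreover have "Rm X ?U ?U W p = (Rm X Y Y W p + Rm X Y Z W p + (Rm X Z Y W p + Rm X Z Z W p)) / 2"
      using vf by (simp add: Rm_simps field_simps)
    ultimately show ?thesis by simp
  qed
  have vf: "X \<in> vfields A" "Y \<in> vfields A" "Z \<in> vfields A" "W \<in> vfields A"
    using on orthonormal_pair_vf by blast+
  note s = on[THEN orthonormal_pair_sym]
  have "Rm Y Z X W p = - Rm Y X Z W p" by (rule swap) (use on s in blast)+
  moreover have "Rm Y X Z W p = - Rm X Y Z W p" "Rm Z X Y W p = - Rm X Z Y W p"
    using fun_cong[OF Rm_antisym12[OF vf(1,2,3,4)], of p] fun_cong[OF Rm_antisym12[OF vf(1,3,2,4)], of p] by simp_all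
  ultimately show ?thesis
    using swap[OF on] fun_cong[OF Rm_bianchi[OF vf], of p] by simp
qed

lemma horizontal_curvature_const_eq:
  assumes "n \<ge> 2" "horizontal_curvature_const p k"
  shows "k = real s"
proof -
  obtain X Y where X: "horizontal X" and Y: "horizontal Y"
    and on: "ip X X p = 1" "ip Y Y p = 1" "ip X Y p = 0" "ip X (F Y) p = 0"
    using assms(1) by (rule horizontal_pair)
  note vf = X[THEN horizontal_vf] Y[THEN horizontal_vf]
  note h = X Y horizontal_F[OF vf(1)] horizontal_F[OF vf(2)]
  have ips: "ip X (F X) p = 0" "ip Y (F Y) p = 0" "ip Y (F X) p = 0" "ip (F Y) (F X) p = 0"
    "ip (F X) (F X) p = 1" "ip (F Y) (F Y) p = 1"
    using on ip_F_right[OF vf(1,1)] ip_F_self[OF vf(1)] ip_F_right[OF vf(2,2)] ip_F_self[OF vf(2)]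
      ip_F_right[OF vf(2,1)] ip_sym[OF vf(1) F_vf[OF vf(2)]] horizontal_ip_F_F'[OF X vf(2)] ip_sym[OF vf]
      horizontal_ip_F_F[OF X vf(1)] horizontal_ip_F_F[OF Y vf(2)] by simp_all
  have "Rm X Y (F Y) (F X) p = 0"
    by (rule Rm_orthonormal[OF assms(2)]; unfold orthonormal_pair_def; use h on ips in blast)
  moreover have "Rm X Y Y X p = k"
    using assms(2) X Y on by (auto simp: horizontal_curvature_const_def orthonormal_pair_def)
  ultimately show ?thesis using Rm_orthonormal_F[OF X Y on] by simp
qed

lemma Rm_self_12: "X \<in> vfields A \<Longrightarrow> Y \<in> vfields A \<Longrightarrow> Z \<in> vfields A \<Longrightarrow> Rm X X Y Z p = 0"
  and Rm_self_34: "X \<in> vfields A \<Longrightarrow> Y \<in> vfields A \<Longrightarrow> Z \<in> vfields A \<Longrightarrow> Rm Y Z X X p = 0"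
  using fun_cong[OF Rm_antisym12[of X X Y Z], of p] fun_cong[OF Rm_antisym34[of Y Z X X], of p] by simp_all

text \<open>Values at \<open>p\<close> that are linearly dependent are handled by perturbing one field: that the curvature
  vanishes when an argument vanishes at \<open>p\<close> would need local frames, whereas here additivity suffices.\<close>

lemma Rm_horizontal_plane:
  assumes K: "horizontal_curvature_const p k" and X: "horizontal X" and Y: "horizontal Y"
  shows "Rm X Y Y X p = k * (ip X X p * ip Y Y p - (ip X Y p)\<^sup>2)"
proof -
  have sym: "Rm U V V U p = Rm V U U V p" if "U \<in> vfields A" "V \<in> vfields A" for U V
    using fun_cong[OF Rm_pair_sym[OF that that(2,1)], of p] by simp
  have orth: "Rm Z V V Z p = k * (ip Z Z p * ip V V p)"
    if Z: "horizontal Z" and V: "horizontal V" and pos: "ip V V p > 0" and o: "ip Z V p = 0" for Z V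
  proof -
    note vf = Z[THEN horizontal_vf] V[THEN horizontal_vf]
    let ?r = "1 / sqrt (ip V V p)"
    let ?V = "?r *\<^sub>C V"
    have V1: "horizontal ?V" "ip ?V ?V p = 1" using horizontal_normalize[OF V pos] by auto
    have unit: "Rm U ?V ?V U p = k * ip U U p"
      if U: "horizontal U" and oU: "ip U V p = 0" and posU: "ip U U p > 0" for U
    proof -
      let ?q = "1 / sqrt (ip U U p)"
      note Uv = U[THEN horizontal_vf]
      have "orthonormal_pair p (?q *\<^sub>C U) ?V"
        using horizontal_normalize[OF U posU] V1 oU Uv vf by (simp add: orthonormal_pair_def ip_simps)
      then have "Rm (?q *\<^sub>C U) ?V ?V (?q *\<^sub>C U) p = k"
        using K by (simp add: horizontal_curvature_const_def)
      then have "?q * (?q * Rm U ?V ?V U p) = k"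
        using Uv vf by (simp add: Rm_fscale1 Rm_fscale4)
      then show ?thesis using posU by (simp add: field_simps)
    qed
    have "Rm Z ?V ?V Z p = k * ip Z Z p"
    proof (cases "ip Z Z p > 0")
      case True
      then show ?thesis by (rule unit[OF Z o])
    next
      case False
      then have zz: "ip Z Z p = 0" using ip_nonneg[OF vf(1), of p] by simp
      then have Z0: "Z p = 0" by (rule ip_self_eq_0[OF vf(1)])
      \<comment> \<open>\<open>Z\<close> vanishes at \<open>p\<close> and cannot be normalised.
        \<open>N\<close> is a unit vector orthogonal to \<open>V\<close>, so \<open>Z + N\<close>
        and \<open>Z - N\<close> can be treated by \<open>unit\<close>, and the parallelogram
        identity for the quadratic form in \<open>Z\<close> recovers the value at
        \<open>Z\<close>.\<close>
      define N where "N = ?r *\<^sub>C F V"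
      have N: "horizontal N" using horizontal_F[OF vf(2)] by (simp add: N_def horizontal_fscale)
      note Nv = N[THEN horizontal_vf]
      have NV: "ip N V p = 0" "ip N N p = 1"
        using ip_F_self[OF vf(2)] horizontal_ip_F_F[OF V vf(2)] vf pos by (simp_all add: N_def ip_simps)
      have ZN: "ip Z N p = 0" "ip N Z p = 0"
        using ip_at_zero[of Z p N, OF Z0 Nv] ip_sym[OF vf(1) Nv] by simp_all
      have plus: "Rm (Z + N) ?V ?V (Z + N) p = k" and minus: "Rm (Z - N) ?V ?V (Z - N) p = k"
        and only: "Rm N ?V ?V N p = k"
        using unit[of "Z + N"] unit[of "Z - N"] unit[of N] Z N NV ZN o zz vf Nv
        by (simp_all add: horizontal_add horizontal_diff ip_simps)
      have eq: "Z - N = Z + (- 1) *\<^sub>C N" by (simp add: fun_eq_iff fscale_def tscale_def)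
      have "Rm (Z + N) ?V ?V (Z + N) p + Rm (Z - N) ?V ?V (Z - N) p = 2 * Rm Z ?V ?V Z p + 2 * Rm N ?V ?V N p"
        unfolding eq using vf Nv by (simp add: Rm_add1 Rm_add4 Rm_fscale1 Rm_fscale4)
      then show ?thesis using plus minus only zz by simp
    qed
    then have "?r * (?r * Rm Z V V Z p) = k * ip Z Z p"
      using vf by (simp add: Rm_fscale2 Rm_fscale3)
    then show ?thesis using pos by (simp add: field_simps)
  qed
  have main: "Rm U V V U p = k * (ip U U p * ip V V p - (ip U V p)\<^sup>2)"
    if U: "horizontal U" and V: "horizontal V" and pos: "ip V V p > 0" for U V
  proof -
    note vf = U[THEN horizontal_vf] V[THEN horizontal_vf]
    \<comment> \<open>Gram-Schmidt: subtracting the component along \<open>V\<close> changes neither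
      the curvature term nor the area of the parallelogram.\<close>
    define b where "b = ip U V p / ip V V p"
    define Z where "Z = U + (- b) *\<^sub>C V"
    have Z: "horizontal Z" using U V by (simp add: Z_def horizontal_add horizontal_fscale)
    have VU: "ip V U p = ip U V p" using vf by (simp add: ip_sym)
    have "ip Z V p = 0" using vf pos by (simp add: Z_def ip_simps b_def)
    then have "Rm Z V V Z p = k * (ip Z Z p * ip V V p)" by (rule orth[OF Z V pos])
    moreover have "Rm Z V V Z p = Rm U V V U p"
      using vf by (simp add: Z_def Rm_add1 Rm_add4 Rm_fscale1 Rm_fscale4 Rm_self_12 Rm_self_34)
    moreover have "ip Z Z p * ip V V p = ip U U p * ip V V p - (ip U V p)\<^sup>2"
      using vf pos by (simp add: Z_def ip_simps VU) (simp add: b_def field_simps power2_eq_square)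
    ultimately show ?thesis by simp
  qed
  note vf = X[THEN horizontal_vf] Y[THEN horizontal_vf]
  have YX: "ip Y X p = ip X Y p" using vf by (simp add: ip_sym)
  consider "ip Y Y p > 0" | "ip X X p > 0" | "ip X X p = 0" "ip Y Y p = 0"
    using ip_nonneg[OF vf(1), of p] ip_nonneg[OF vf(2), of p] by linarith
  then show ?thesis
  proof cases
    case 1
    then show ?thesis by (rule main[OF X Y])
  next
    case 2
    then show ?thesis using main[OF Y X] sym[OF vf] YX by (simp add: mult.commute)
  next
    case 3
    have zero: "X p = 0" "Y p = 0" using ip_self_eq_0 vf 3 by blast+
    show ?thesis
    \<comment> \<open>Both fields vanish at \<open>p\<close>. Given a horizontal field
      \<open>V\<close> that does not, \<open>Y\<close> is perturbed by \<open>V\<close> and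
      \<open>- V\<close> as above.\<close>
    proof (cases "\<exists>V. horizontal V \<and> ip V V p > 0")
      case True
      then obtain V where V: "horizontal V" "ip V V p > 0" by blast
      note Vv = V(1)[THEN horizontal_vf]
      have ips: "ip X V p = 0" "ip Y V p = 0" "ip V Y p = 0" "ip X Y p = 0"
        using ip_at_zero[of X p V, OF zero(1) Vv] ip_at_zero[of Y p V, OF zero(2) Vv] ip_sym[OF Vv vf(2)] ip_at_zero[of X p Y, OF zero(1) vf(2)]
        by simp_all
      have eq: "Y - V = Y + (- 1) *\<^sub>C V" by (simp add: fun_eq_iff fscale_def tscale_def)
      have "Rm X (Y + V) (Y + V) X p = 0" "Rm X (Y - V) (Y - V) X p = 0" "Rm X V V X p = 0"
        using main[OF X horizontal_add[OF Y V(1)]] main[OF X horizontal_diff[OF Y V(1)]] main[OF X V(1)]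
          3 V ips vf Vv by (simp_all add: ip_simps)
      moreover have "Rm X (Y + V) (Y + V) X p + Rm X (Y - V) (Y - V) X p = 2 * Rm X Y Y X p + 2 * Rm X V V X p"
        unfolding eq using vf Vv by (simp add: Rm_add2 Rm_add3 Rm_fscale2 Rm_fscale3)
      ultimately show ?thesis using 3 ips by simp
    next
      case False
      \<comment> \<open>All horizontal fields vanish at \<open>p\<close>, in particular
        \<open>F\<close> of the curvature vector, whose product with \<open>F X\<close> is the
        curvature term.\<close>
      have FR: "F (curvature D X Y Y) p = 0" 
        using False ip_nonneg horizontal_F[of "curvature D X Y Y"] vf ip_self_eq_0[of "F (curvature D X Y Y)" p]
        by (metis F_vf curvature_vf less_eq_real_def)
      have "ip (F (curvature D X Y Y)) (F X) p = Rm X Y Y X p"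
        using horizontal_ip_F_F'[OF X curvature_vf[OF vf vf(2)]] by (simp add: Rm_def)
      then show ?thesis using ip_at_zero[of "F (curvature D X Y Y)" p "F X", OF FR] 3 vf ip_at_zero[of X p Y, OF zero(1) vf(2)] by simp
    qed
  qed
qed

subsection \<open>The semi-symmetric metric connection\<close>

abbreviation D_star :: "'m conn" where
  "D_star \<equiv> semi_symmetric_connection s \<xi> \<eta> g D"

lemma D_star_eq:
  assumes X: "X \<in> vfields A" and Y: "Y \<in> vfields A"
  shows "D_star X Y = D X Y + ip Y E *\<^sub>F X - ip X Y *\<^sub>F E"
proof -
  have "(\<Sum>j\<in>Ix. (\<lambda>p. \<eta> j p (Y p)) *\<^sub>F X) = ip Y E *\<^sub>F X"
  proof (intro ext)
    fix p u
    have "(\<Sum>j\<in>Ix. (\<lambda>p. \<eta> j p (Y p)) *\<^sub>F X) p u = (\<Sum>j\<in>Ix. \<eta> j p (Y p) * X p u)"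
      by (simp add: sum_fun_at fscale_def tscale_def)
    also have "\<dots> = (\<Sum>j\<in>Ix. ip Y (\<xi> j) p * X p u)"
      by (rule sum.cong) (simp_all add: eta_eq Y)
    also have "\<dots> = (ip Y E *\<^sub>F X) p u"
      by (simp add: ip_E[OF Y] sum_fun_at fscale_def tscale_def sum_distrib_right)
    finally show "(\<Sum>j\<in>Ix. (\<lambda>p. \<eta> j p (Y p)) *\<^sub>F X) p u = (ip Y E *\<^sub>F X) p u" .
  qed
  moreover have "(\<Sum>j\<in>Ix. (\<lambda>p. g p (X p) (Y p)) *\<^sub>F \<xi> j) = ip X Y *\<^sub>F E"
    by (intro ext) (simp add: sum_fun_at E_def ip_def fscale_def tscale_def sum_distrib_left)
  ultimately show ?thesis by (simp add: semi_symmetric_connection_def Ix_def)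
qed

lemma D_star_vf [simp]: "X \<in> vfields A \<Longrightarrow> Y \<in> vfields A \<Longrightarrow> D_star X Y \<in> vfields A"
  by (simp add: D_star_eq)

lemma ip_D_star:
  assumes "X \<in> vfields A" "Y \<in> vfields A" "W \<in> vfields A"
  shows "ip (D_star X Y) W = ip (D X Y) W + ip Y E * ip X W - ip X Y * ip E W"
  using assms by (simp add: D_star_eq ip_left)

lemma ip_D_star_D_star:
  assumes "X \<in> vfields A" "Y \<in> vfields A" "Z \<in> vfields A" "W \<in> vfields A"
  shows "ip (D_star X (D_star Y Z)) W =
      ip (D X (D Y Z)) W + ip Z E * ip (D X Y) W + der X (ip Z E) * ip Y W
      - ip Y Z * ip (D X E) W - der X (ip Y Z) * ip E W
      + (ip (D Y Z) E + ip Z E * ip Y E - ip Y Z * ip E E) * ip X W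
      - (ip X (D Y Z) + ip Z E * ip X Y - ip Y Z * ip X E) * ip E W"
proof -
  have 1: "ip (D X (D_star Y Z)) W = ip (D X (D Y Z)) W + ip Z E * ip (D X Y) W + der X (ip Z E) * ip Y W
      - ip Y Z * ip (D X E) W - der X (ip Y Z) * ip E W"
    using assms by (simp add: D_star_eq D_add_right D_diff_right D_fscale_right ip_left)
  have 2: "ip (D_star Y Z) E = ip (D Y Z) E + ip Z E * ip Y E - ip Y Z * ip E E"
    using assms by (simp add: ip_D_star)
  have 3: "ip X (D_star Y Z) = ip X (D Y Z) + ip Z E * ip X Y - ip Y Z * ip X E"
    using assms by (simp add: D_star_eq ip_right)
  show ?thesis
    unfolding ip_D_star[OF assms(1) D_star_vf[OF assms(2,3)] assms(4)] 1 2 3 ..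
qed

text \<open>The fields are orthonormal at \<open>p\<close> only, so derivatives of their inner
  products remain; they cancel against the terms of the bracket. Derivatives of \<open>E\<close>
  drop out because \<open>D U E\<close> is a multiple of \<open>F U\<close>, hence orthogonal to
  \<open>U\<close>. The constant \<open>- s\<close> is \<open>- ip E E\<close>.\<close>

lemma sect_curv_D_star:
  assumes X: "X \<in> vfields A" and Y: "Y \<in> vfields A"
    and on: "ip X X p = 1" "ip Y Y p = 1" "ip X Y p = 0"
  shows "sect_curv g D_star X Y p = Rm X Y Y X p + (ip X E p)\<^sup>2 + (ip Y E p)\<^sup>2 - real s"
proof -
  have YX: "ip Y X p = 0" using on ip_sym[OF X Y] by simp
  have EX: "ip E X = ip X E" using X by (simp add: ip_sym)
  have DE: "ip (D U E) U p = 0" "ip U (D U E) p = 0" if "U \<in> vfields A" for U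
    using that ip_F_self[OF that] ip_F_right[OF that that] by (simp_all add: D_E ip_simps)
  have 1: "der Y (ip Y E) p = ip (D Y Y) E p"
    using Y DE[OF Y] by (simp add: metric_compatible)
  have 2: "der X (ip Y Y) p = 2 * ip (D X Y) Y p"
    using X Y ip_sym[of Y "D X Y"] by (simp add: metric_compatible)
  have 3: "der Y (ip X Y) p = ip (D Y X) Y p + ip X (D Y Y) p"
    using X Y by (simp add: metric_compatible)
  have 4: "ip Y (D X Y) p = ip (D X Y) Y p" using X Y ip_sym[of Y "D X Y"] by simp
  have s: "sect_curv g D_star X Y p = ip (D_star X (D_star Y Y)) X p - ip (D_star Y (D_star X Y)) X p
      - ip (D_star (lie_bracket X Y) Y) X p"
  proof -
    have "sect_curv g D_star X Y p = ip (curvature D_star X Y Y) X p" by (simp add: sect_curv_def ip_def)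
    then show ?thesis using X Y by (simp add: curvature_def ip_left)
  qed
  have 5: "ip (D_star (lie_bracket X Y) Y) X p = ip (D (lie_bracket X Y) Y) X p
      + ip Y E p * (ip (D X Y) X p - ip (D Y X) X p) - (ip (D X Y) Y p - ip (D Y X) Y p) * ip X E p"
    using ip_D_star[OF lie_bracket_vf[OF X Y] Y X] X Y by (simp add: EX ip_left torsion_free)
  have R: "Rm X Y Y X p = ip (D X (D Y Y)) X p - ip (D Y (D X Y)) X p - ip (D (lie_bracket X Y) Y) X p"
    using X Y by (simp add: Rm_def curvature_def ip_left)
  show ?thesis
    unfolding s R 5 ip_D_star_D_star[OF X Y Y X] ip_D_star_D_star[OF Y X Y X]
    by (simp add: on YX EX DE[OF X] ip_E_E 1 2 3 4 power2_eq_square algebra_simps)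
qed

end

text \<open>Here \<open>x i \<alpha>\<close> stands for the \<open>\<alpha>\<close>-th vertical coordinate of the \<open>i\<close>-th frame vector, and \<open>h\<close> for the
  Gram matrix of the horizontal parts, which is a projection of rank \<open>N - s\<close>.\<close>

lemma frame_sum:
  fixes x :: "'i \<Rightarrow> 'j \<Rightarrow> real"
  assumes I: "finite I" and J: "finite J"
    and parseval: "\<And>\<alpha> \<beta>. \<alpha> \<in> J \<Longrightarrow> \<beta> \<in> J \<Longrightarrow> (\<Sum>i\<in>I. x i \<alpha> * x i \<beta>) = (if \<alpha> = \<beta> then 1 else 0)"
    and h: "\<And>i j. h i j = (if i = j then 1 else 0) - (\<Sum>\<alpha>\<in>J. x i \<alpha> * x j \<alpha>)"
    and a: "\<And>i. a i = (\<Sum>\<alpha>\<in>J. x i \<alpha>)"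
  defines "c \<equiv> real (card J)" and "N \<equiv> real (card I)"
  shows "(\<Sum>i\<in>I. \<Sum>j\<in>I. if i = j then 0 else
      c * (h i i * h j j - (h i j)\<^sup>2) + (a j)\<^sup>2 * h i i - 2 * a i * a j * h i j + (a i)\<^sup>2 * h j j
      + (a i)\<^sup>2 + (a j)\<^sup>2 - c)
    = c * ((N - c)\<^sup>2 + (N - c) + 2 * N - (N)\<^sup>2 - 2 + N)"
proof -
  \<comment> \<open>The vertical coordinates span the kernel of the projection
    \<open>h\<close>.\<close>
  have xh: "(\<Sum>j\<in>I. x j \<alpha> * h i j) = 0" if "\<alpha> \<in> J" "i \<in> I" for \<alpha> i
  proof -
    have "(\<Sum>j\<in>I. x j \<alpha> * h i j) = (\<Sum>j\<in>I. x j \<alpha> * (if i = j then 1 else 0)) - (\<Sum>j\<in>I. \<Sum>\<beta>\<in>J. x j \<alpha> * (x i \<beta> * x j \<beta>))"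
      by (simp only: h right_diff_distrib sum_subtractf sum_distrib_left)
    also have "(\<Sum>j\<in>I. x j \<alpha> * (if i = j then 1 else 0)) = x i \<alpha>"
      using that(2) I by (simp add: if_distrib cong: if_cong)
    also have "(\<Sum>j\<in>I. \<Sum>\<beta>\<in>J. x j \<alpha> * (x i \<beta> * x j \<beta>)) = (\<Sum>\<beta>\<in>J. x i \<beta> * (\<Sum>j\<in>I. x j \<alpha> * x j \<beta>))"
      by (subst sum.swap) (simp add: sum_distrib_left mult_ac)
    also have "\<dots> = (\<Sum>\<beta>\<in>J. x i \<beta> * (if \<alpha> = \<beta> then 1 else 0))"
      by (rule sum.cong) (simp_all add: parseval that(1))
    also have "\<dots> = x i \<alpha>" using that(1) J by (simp add: if_distrib cong: if_cong)
    finally show ?thesis by simp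
  qed
  have trace: "(\<Sum>i\<in>I. h i i) = N - c"
  proof -
    have "(\<Sum>i\<in>I. h i i) = N - (\<Sum>i\<in>I. \<Sum>\<alpha>\<in>J. x i \<alpha> * x i \<alpha>)"
      by (simp add: h sum_subtractf N_def)
    also have "(\<Sum>i\<in>I. \<Sum>\<alpha>\<in>J. x i \<alpha> * x i \<alpha>) = (\<Sum>\<alpha>\<in>J. 1)"
      by (subst sum.swap) (rule sum.cong, simp_all add: parseval)
    finally show ?thesis by (simp add: c_def)
  qed
  \<comment> \<open>For a symmetric projection the squares of the entries in a row add up to the
    diagonal entry.\<close>
  have proj: "(\<Sum>j\<in>I. (h i j)\<^sup>2) = h i i" if i: "i \<in> I" for i
  proof -
    have "(\<Sum>j\<in>I. (h i j)\<^sup>2) = (\<Sum>j\<in>I. (if i = j then 1 else 0) * h i j - (\<Sum>\<alpha>\<in>J. x i \<alpha> * (x j \<alpha> * h i j)))"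
      by (rule sum.cong) (simp_all add: power2_eq_square h[of i] left_diff_distrib sum_distrib_right mult_ac)
    also have "\<dots> = h i i - (\<Sum>j\<in>I. \<Sum>\<alpha>\<in>J. x i \<alpha> * (x j \<alpha> * h i j))"
      using i I by (simp add: sum_subtractf if_distrib[where f = "\<lambda>y. y * _"] cong: if_cong)
    also have "(\<Sum>j\<in>I. \<Sum>\<alpha>\<in>J. x i \<alpha> * (x j \<alpha> * h i j)) = (\<Sum>\<alpha>\<in>J. x i \<alpha> * (\<Sum>j\<in>I. x j \<alpha> * h i j))"
      by (subst sum.swap) (simp add: sum_distrib_left)
    also have "\<dots> = 0" using xh i by simp
    finally show ?thesis by simp
  qed
  have aa: "(\<Sum>i\<in>I. (a i)\<^sup>2) = c"
  proof -
    have "(\<Sum>i\<in>I. (a i)\<^sup>2) = (\<Sum>i\<in>I. \<Sum>\<alpha>\<in>J. \<Sum>\<beta>\<in>J. x i \<alpha> * x i \<beta>)"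
      by (simp add: a power2_eq_square sum_product)
    also have "\<dots> = (\<Sum>\<alpha>\<in>J. \<Sum>\<beta>\<in>J. \<Sum>i\<in>I. x i \<alpha> * x i \<beta>)"
      by (subst sum.swap) (rule sum.cong[OF refl], rule sum.swap)
    also have "\<dots> = (\<Sum>\<alpha>\<in>J. \<Sum>\<beta>\<in>J. if \<alpha> = \<beta> then 1 else 0)"
      by (intro sum.cong refl) (simp only: parseval)
    also have "\<dots> = c" using J by (simp add: c_def)
    finally show ?thesis .
  qed
  have ah: "(\<Sum>j\<in>I. a j * h i j) = 0" if "i \<in> I" for i
  proof -
    have "(\<Sum>j\<in>I. a j * h i j) = (\<Sum>\<alpha>\<in>J. \<Sum>j\<in>I. x j \<alpha> * h i j)"
      unfolding a sum_distrib_right by (rule sum.swap)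
    then show ?thesis using xh that by simp
  qed
  define G where "G i j = c * (h i i * h j j - (h i j)\<^sup>2) + (a j)\<^sup>2 * h i i - 2 * a i * a j * h i j
    + (a i)\<^sup>2 * h j j + (a i)\<^sup>2 + (a j)\<^sup>2 - c" for i j
  have row: "(\<Sum>j\<in>I. G i j) = c * (N - c) * h i i + (2 * N - c) * (a i)\<^sup>2 + (c - N * c)" if i: "i \<in> I" for i
  proof -
    have "(\<Sum>j\<in>I. G i j) = c * (h i i * (\<Sum>j\<in>I. h j j) - (\<Sum>j\<in>I. (h i j)\<^sup>2)) + (\<Sum>j\<in>I. (a j)\<^sup>2) * h i i
        - 2 * a i * (\<Sum>j\<in>I. a j * h i j) + (a i)\<^sup>2 * (\<Sum>j\<in>I. h j j)
        + N * (a i)\<^sup>2 + (\<Sum>j\<in>I. (a j)\<^sup>2) - N * c"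
      unfolding G_def
      by (simp add: sum.distrib sum_subtractf sum_distrib_left sum_distrib_right right_diff_distrib mult.assoc N_def)
    then show ?thesis unfolding trace proj[OF i] aa ah[OF i] by (simp add: algebra_simps)
  qed
  have "(\<Sum>i\<in>I. \<Sum>j\<in>I. G i j) = (\<Sum>i\<in>I. c * (N - c) * h i i + (2 * N - c) * (a i)\<^sup>2 + (c - N * c))"
    by (rule sum.cong[OF refl row])
  also have "\<dots> = c * (N - c) * (\<Sum>i\<in>I. h i i) + (2 * N - c) * (\<Sum>i\<in>I. (a i)\<^sup>2) + N * (c - N * c)"
    by (simp only: sum.distrib sum_distrib_left[symmetric] sum_constant N_def)
  finally have total: "(\<Sum>i\<in>I. \<Sum>j\<in>I. G i j) = c * (N - c) * (N - c) + (2 * N - c) * c + N * (c - N * c)"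
    unfolding trace aa .
  \<comment> \<open>At \<open>i = j\<close> the expression \<open>G\<close> equals
    \<open>2 * (a i)\<^sup>2 - c\<close> rather than 0, so its trace is subtracted from the full
    double sum.\<close>
  have diag: "(\<Sum>i\<in>I. G i i) = 2 * c - N * c"
  proof -
    have "(\<Sum>i\<in>I. G i i) = (\<Sum>i\<in>I. 2 * (a i)\<^sup>2 - c)"
      by (rule sum.cong) (simp_all add: G_def power2_eq_square)
    then show ?thesis by (simp add: sum_subtractf sum_distrib_left[symmetric] aa N_def)
  qed
  have "(\<Sum>j\<in>I. if i = j then 0 else G i j) = (\<Sum>j\<in>I. G i j) - G i i" if "i \<in> I" for i
  proof -
    have "(\<Sum>j\<in>I. G i j) = (\<Sum>j\<in>I. (if i = j then 0 else G i j) + (if i = j then G i i else 0))"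
      by (rule sum.cong) simp_all
    then show ?thesis using that I by (simp add: sum.distrib)
  qed
  then have "(\<Sum>i\<in>I. \<Sum>j\<in>I. if i = j then 0 else G i j) = (\<Sum>i\<in>I. \<Sum>j\<in>I. G i j) - (\<Sum>i\<in>I. G i i)"
    by (simp add: sum_subtractf cong: sum.cong)
  also have "\<dots> = c * ((N - c)\<^sup>2 + (N - c) + 2 * N - (N)\<^sup>2 - 2 + N)"
    unfolding total diag by (simp add: power2_eq_square algebra_simps)
  finally show ?thesis unfolding G_def .
qed

section \<open>Application to constant curvature and to frames\<close>

context S_manifold_connection
begin

text \<open>Globally horizontal fields are particular fields with values in the distribution at
  \<open>p\<close>; for them both terms with \<open>E\<close> in \<open>sect_curv_D_star\<close> are
  0.\<close>

lemma horizontal_curvature_constI: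
  assumes "constant_L_sect_curv A s \<xi> g D_star c"
  shows "horizontal_curvature_const p (c + real s)"
  unfolding horizontal_curvature_const_def
proof (intro allI impI)
  fix X Y assume o: "orthonormal_pair p X Y"
  then have h: "horizontal X" "horizontal Y" and on: "ip X X p = 1" "ip Y Y p = 1" "ip X Y p = 0"
    by (auto simp: orthonormal_pair_def)
  note vf = h[THEN horizontal_vf]
  have L: "Z p \<in> L_distribution A s \<xi> g p" if "horizontal Z" for Z
  proof -
    have "g p (Z p) (\<xi> \<alpha> p) = 0" if "\<alpha> \<in> {1..s}" for \<alpha>
    proof -
      have "ip Z (\<xi> \<alpha>) = 0" using \<open>horizontal Z\<close> that by (simp add: horizontal_def Ix_def)
      from fun_cong[OF this, of p] show ?thesis by (simp add: ip_def)
    qed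
    then show ?thesis unfolding L_distribution_def using vf_tangent[OF horizontal_vf[OF that]] by blast
  qed
  have "sect_curv g D_star X Y p = c"
    using assms L[OF h(1)] L[OF h(2)] on vf unfolding constant_L_sect_curv_def ip_def by blast
  then show "Rm X Y Y X p = c + real s"
    using sect_curv_D_star[OF vf on] h by (simp add: horizontal_ip_E)
qed

lemma frame_scalar_curv_D_star:
  assumes K: "horizontal_curvature_const p (real s)"
    and frame: "local_orthonormal_frame A g U e" and p: "p \<in> U"
  shows "frame_scalar_curv (2 * n + s) g D_star e p
    = (4 * real n * real s + real s * (real s - 1)) * (2 - real s) / 2"
proof -
  let ?I = "{1..2 * n + s}"
  have e: "e i \<in> vfields A" if "i \<in> ?I" for i
    using frame that unfolding local_orthonormal_frame_def dimension by blast
  have on: "ip (e i) (e j) p = (if i = j then 1 else 0)" if "i \<in> ?I" "j \<in> ?I" for i j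
    using frame that p unfolding local_orthonormal_frame_def dimension ip_def by blast
  define x where "x i \<alpha> = ip (e i) (\<xi> \<alpha>) p" for i \<alpha>
  define h where "h i j = (if i = j then 1 else 0) - (\<Sum>\<alpha>\<in>Ix. x i \<alpha> * x j \<alpha>)" for i j
  define a where "a i = (\<Sum>\<alpha>\<in>Ix. x i \<alpha>)" for i
  have a: "ip (e i) E p = a i" if "i \<in> ?I" for i
    using e[OF that] by (simp add: ip_E a_def x_def sum_fun_at)
  have h: "ip (F (e i)) (F (e j)) p = h i j" if "i \<in> ?I" "j \<in> ?I" for i j
    using e[OF that(1)] e[OF that(2)] on[OF that] by (simp add: ip_F_F h_def x_def sum_fun_at)
  have parseval: "(\<Sum>i\<in>?I. x i \<alpha> * x i \<beta>) = (if \<alpha> = \<beta> then 1 else 0)" if ab: "\<alpha> \<in> Ix" "\<beta> \<in> Ix" for \<alpha> \<beta>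
  proof -
    have "\<xi> \<alpha> p = (\<Sum>i\<in>{1..DIM('e)}. g p (\<xi> \<alpha> p) (e i p) *\<^sub>T e i p)"
    proof (rule orthonormal_expansion)
      show "e i p \<in> tangent_space A p" if "i \<in> {1..DIM('e)}" for i
        using that e by (intro vf_tangent) (simp add: dimension)
      show "g p (e i p) (e j p) = (if i = j then 1 else 0)" if "i \<in> {1..DIM('e)}" "j \<in> {1..DIM('e)}" for i j
        using on[of i j] that unfolding dimension ip_def by blast
      show "\<xi> \<alpha> p \<in> tangent_space A p" by (rule vf_tangent[OF xi_vf[OF ab(1)]])
    qed
    then have "g p (\<xi> \<alpha> p) (\<xi> \<beta> p) = g p (\<Sum>i\<in>?I. g p (\<xi> \<alpha> p) (e i p) *\<^sub>T e i p) (\<xi> \<beta> p)"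
      unfolding dimension by simp
    also have "\<dots> = (\<Sum>i\<in>?I. g p (g p (\<xi> \<alpha> p) (e i p) *\<^sub>T e i p) (\<xi> \<beta> p))"
      by (intro g_sum_left tangent_space_scale vf_tangent e xi_vf ab)
    also have "\<dots> = (\<Sum>i\<in>?I. x i \<alpha> * x i \<beta>)"
    proof (rule sum.cong[OF refl])
      fix i assume i: "i \<in> ?I"
      show "g p (g p (\<xi> \<alpha> p) (e i p) *\<^sub>T e i p) (\<xi> \<beta> p) = x i \<alpha> * x i \<beta>"
        using g_scale_left[OF vf_tangent[OF e[OF i]] vf_tangent[OF xi_vf[OF ab(2)]]]
          fun_cong[OF ip_sym[OF e[OF i] xi_vf[OF ab(1)]], of p]
        by (simp add: x_def ip_def)
    qed
    finally show ?thesis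
      using fun_cong[OF ip_xi_xi[OF ab(2,1)], of p] by (simp add: ip_def)
  qed
  have sc: "sect_curv g D_star (e i) (e j) p = real s * (h i i * h j j - (h i j)\<^sup>2) + (a j)\<^sup>2 * h i i
      - 2 * a i * a j * h i j + (a i)\<^sup>2 * h j j + (a i)\<^sup>2 + (a j)\<^sup>2 - real s"
    if "i \<in> ?I" "j \<in> ?I" "i \<noteq> j" for i j
  proof -
    note ei = e[OF that(1)] and ej = e[OF that(2)]
    have "Rm (hor (e i)) (hor (e j)) (hor (e j)) (hor (e i)) p = real s * (h i i * h j j - (h i j)\<^sup>2)"
      using Rm_horizontal_plane[OF K horizontal_hor[OF ei] horizontal_hor[OF ej]] h that
      by (simp only: ip_hor_hor ei ej)
    then have "Rm (e i) (e j) (e j) (e i) p = real s * (h i i * h j j - (h i j)\<^sup>2) + (a j)\<^sup>2 * h i i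
      - 2 * a i * a j * h i j + (a i)\<^sup>2 * h j j"
      unfolding Rm_hor_decomposition[OF ei ej] using h that a by simp
    moreover have "ip (e i) (e i) p = 1" "ip (e j) (e j) p = 1" "ip (e i) (e j) p = 0"
      using on that by simp_all
    ultimately show ?thesis using sect_curv_D_star[OF ei ej] a that by simp
  qed
  have "(\<Sum>i\<in>?I. \<Sum>j\<in>?I. if i = j then 0 else sect_curv g D_star (e i) (e j) p) = (\<Sum>i\<in>?I. \<Sum>j\<in>?I. if i = j then 0 else
      real s * (h i i * h j j - (h i j)\<^sup>2) + (a j)\<^sup>2 * h i i
      - 2 * a i * a j * h i j + (a i)\<^sup>2 * h j j + (a i)\<^sup>2 + (a j)\<^sup>2 - real s)"
    by (intro sum.cong refl if_cong sc) assumption+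
  also have "\<dots> = real s * ((2 * real n)\<^sup>2 + 2 * real n + 2 * (2 * real n + real s)
      - (2 * real n + real s)\<^sup>2 - 2 + (2 * real n + real s))"
    using frame_sum[OF finite_atLeastAtMost finite_Ix parseval h_def a_def, unfolded card_Ix] by simp
  also have "\<dots> = (4 * real n * real s + real s * (real s - 1)) * (2 - real s)"
    by (simp add: power2_eq_square algebra_simps)
  finally show ?thesis unfolding frame_scalar_curv_def by simp
qed

end

theorem mainTheorem5:
  fixes A :: "('m::{t2_space, second_countable_topology}, 'e::euclidean_space) atlas"
    and n s :: nat
    and f :: "'m \<Rightarrow> 'm tvec \<Rightarrow> 'm tvec"
    and \<xi> :: "nat \<Rightarrow> 'm vfield"
    and \<eta> :: "nat \<Rightarrow> 'm \<Rightarrow> 'm tvec \<Rightarrow> real"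
    and g :: "'m \<Rightarrow> 'm tvec \<Rightarrow> 'm tvec \<Rightarrow> real"
    and nabla nabla_star :: "'m conn"
    and c :: real
  assumes "S_manifold A n s f \<xi> \<eta> g"
    and "n \<ge> 2"
    and "levi_civita A g nabla"
    and "nabla_star = semi_symmetric_connection s \<xi> \<eta> g nabla"
    and "constant_L_sect_curv A s \<xi> g nabla_star c"
  shows "c = 0 \<and>
    (\<forall>U e. local_orthonormal_frame A g U e \<longrightarrow>
      (\<forall>p\<in>U. frame_scalar_curv (2 * n + s) g nabla_star e p =
        (4 * real n * real s + real s * (real s - 1)) * (2 - real s) / 2))"
proof -
  interpret S_manifold_connection A g nabla n s f \<xi> \<eta>
    using assms(1,3) by unfold_locales (auto simp: S_manifold_def metric_f_manifold_def)
  have K: "horizontal_curvature_const p (c + real s)" for p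
    using horizontal_curvature_constI assms(4,5) by simp
  \<comment> \<open>A single point decides this, and there is one because every type is
    inhabited.\<close>
  then have "c = 0" using horizontal_curvature_const_eq[OF assms(2)] by fastforce
  then show ?thesis using K frame_scalar_curv_D_star assms(4) by simp
qed

end
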